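(* Let $\mathcal M=\mathbb R$ or $\mathbb T$, let $s<0$, and fix a real-valued $u_0\in H^s(\mathcal M)$. Then, given any $\varepsilon>0$, there exist a smooth solution $u_\varepsilon$ to the BBM equation $$\partial_tu-\partial_{xxt}u+\partial_xu+\tfrac12\partial_x(u^2)=0\quad\text{on }\mathcal M$$ and $t_\varepsilon\in(0,\varepsilon)$ such that $$\|u_\varepsilon(0)-u_0\|_{H^s(\mathcal M)}<\varepsilon\qquad\text{and}\qquad\|u_\varepsilon(t_\varepsilon)\|_{H^s(\mathcal M)}>\varepsilon^{-1}.$$
   Context: $\mathbb T=\mathbb R/(2\pi\mathbb Z)$. Solutions of the BBM equation are real-valued functions. A smooth solution means one with $u\in C([0,\infty);H^\sigma(\mathcal M))$ for every $\sigma$. *)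

theory Defs
  imports "HOL-Analysis.Analysis"
begin

text \<open>Functions on the torus are identified with \<open>2 * pi\<close>-periodic functions on the real line;
  integration over the torus is integration over \<open>{0..<2 * pi}\<close>.\<close>

datatype spatial_domain = Line | Torus

definition cell :: "spatial_domain \<Rightarrow> real set" where
  "cell M = (case M of Line \<Rightarrow> UNIV | Torus \<Rightarrow> {0..<2 * pi})"

definition function_on :: "spatial_domain \<Rightarrow> (real \<Rightarrow> 'a) \<Rightarrow> bool" where
  "function_on M f = (case M of Line \<Rightarrow> True | Torus \<Rightarrow> (\<forall>x. f (x + 2 * pi) = f x))"

definition freq_measure :: "spatial_domain \<Rightarrow> real measure" where
  "freq_measure M = (case M of Line \<Rightarrow> lborel | Torus \<Rightarrow> count_space \<int>)"


subsection \<open>Test functions and distributions\<close>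

definition vderiv :: "(real \<Rightarrow> complex) \<Rightarrow> real \<Rightarrow> complex" where
  "vderiv f x = vector_derivative f (at x)"

definition smooth_fun :: "(real \<Rightarrow> complex) \<Rightarrow> bool" where
  "smooth_fun f \<longleftrightarrow> (\<forall>k x. (vderiv ^^ k) f differentiable (at x))"

definition schwartz :: "(real \<Rightarrow> complex) set" where
  "schwartz = {f. smooth_fun f \<and>
     (\<forall>j k. bounded (range (\<lambda>x. complex_of_real (x ^ j) * (vderiv ^^ k) f x)))}"

definition test_functions :: "spatial_domain \<Rightarrow> (real \<Rightarrow> complex) set" where
  "test_functions M =
     (case M of Line \<Rightarrow> schwartz | Torus \<Rightarrow> {f. smooth_fun f \<and> function_on Torus f})"

definition test_seminorm :: "spatial_domain \<Rightarrow> nat \<Rightarrow> (real \<Rightarrow> complex) \<Rightarrow> real" where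
  "test_seminorm M N f =
     (case M of
        Line \<Rightarrow> (\<Sum>j\<le>N. \<Sum>k\<le>N. (SUP x. \<bar>x\<bar> ^ j * cmod ((vderiv ^^ k) f x)))
      | Torus \<Rightarrow> (\<Sum>k\<le>N. (SUP x. cmod ((vderiv ^^ k) f x))))"

text \<open>Tempered distributions on the line, periodic distributions on the torus. Only the values
  on test functions are meaningful.\<close>

definition distribution :: "spatial_domain \<Rightarrow> ((real \<Rightarrow> complex) \<Rightarrow> complex) \<Rightarrow> bool" where
  "distribution M u \<longleftrightarrow>
     (\<forall>f\<in>test_functions M. \<forall>g\<in>test_functions M. \<forall>a b.
        u (\<lambda>x. a * f x + b * g x) = a * u f + b * u g) \<and>
     (\<exists>C N. \<forall>f\<in>test_functions M. cmod (u f) \<le> C * test_seminorm M N f)"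

definition real_distribution :: "spatial_domain \<Rightarrow> ((real \<Rightarrow> complex) \<Rightarrow> complex) \<Rightarrow> bool" where
  "real_distribution M u \<longleftrightarrow>
     (\<forall>f\<in>test_functions M. (\<forall>x. f x \<in> \<real>) \<longrightarrow> u f \<in> \<real>)"

definition regular_fun :: "spatial_domain \<Rightarrow> (real \<Rightarrow> real) \<Rightarrow> bool" where
  "regular_fun M f \<longleftrightarrow> function_on M f \<and>
     (\<forall>\<phi>\<in>test_functions M. set_integrable lborel (cell M) (\<lambda>x. complex_of_real (f x) * \<phi> x))"

definition dist_of_fun :: "spatial_domain \<Rightarrow> (real \<Rightarrow> real) \<Rightarrow> (real \<Rightarrow> complex) \<Rightarrow> complex" where
  "dist_of_fun M f \<phi> = (LINT x:cell M|lborel. complex_of_real (f x) * \<phi> x)"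


subsection \<open>Fourier transform and Sobolev spaces\<close>

definition fourier :: "(real \<Rightarrow> complex) \<Rightarrow> real \<Rightarrow> complex" where
  "fourier \<phi> \<xi> = (LINT x|lborel. cis (- (x * \<xi>)) * \<phi> x)"

text \<open>On the line, \<open>has_fourier Line u g\<close> says that the distributional Fourier transform of \<open>u\<close>,
  i.e. the functional sending \<open>\<phi>\<close> to \<open>u (fourier \<phi>)\<close>, is the function \<open>g\<close>; such a \<open>g\<close> is unique
  up to null sets. On the torus, the values of \<open>g\<close> at the integers are the Fourier coefficients
  of \<open>u\<close>, and the values elsewhere are irrelevant.\<close>

definition has_fourier ::
  "spatial_domain \<Rightarrow> ((real \<Rightarrow> complex) \<Rightarrow> complex) \<Rightarrow> (real \<Rightarrow> complex) \<Rightarrow> bool" where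
  "has_fourier M u g =
     (case M of
        Line \<Rightarrow> g \<in> borel_measurable lborel \<and>
          (\<forall>\<phi>\<in>schwartz. integrable lborel (\<lambda>\<xi>. g \<xi> * \<phi> \<xi>) \<and>
             u (fourier \<phi>) = (LINT \<xi>|lborel. g \<xi> * \<phi> \<xi>))
      | Torus \<Rightarrow> (\<forall>\<xi>\<in>\<int>. g \<xi> = u (\<lambda>x. cis (- (x * \<xi>))) / complex_of_real (2 * pi)))"

definition in_sobolev :: "spatial_domain \<Rightarrow> real \<Rightarrow> ((real \<Rightarrow> complex) \<Rightarrow> complex) \<Rightarrow> bool" where
  "in_sobolev M s u \<longleftrightarrow> distribution M u \<and>
     (\<exists>g. has_fourier M u g \<and>
        integrable (freq_measure M) (\<lambda>\<xi>. (1 + \<xi>\<^sup>2) powr s * (cmod (g \<xi>))\<^sup>2))"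

text \<open>Meaningful only if \<open>in_sobolev M s u\<close>; the value does not depend on the choice of the
  representative of the Fourier transform.\<close>

definition sobolev_norm :: "spatial_domain \<Rightarrow> real \<Rightarrow> ((real \<Rightarrow> complex) \<Rightarrow> complex) \<Rightarrow> real" where
  "sobolev_norm M s u =
     sqrt (LINT \<xi>|freq_measure M. (1 + \<xi>\<^sup>2) powr s * (cmod ((SOME g. has_fourier M u g) \<xi>))\<^sup>2)"


subsection \<open>Smooth solutions of the BBM equation\<close>

text \<open>Curves \<open>u\<close> are only considered at times \<open>t \<ge> 0\<close>. Without \<open>regular_fun\<close>, a function that is
  not a distribution could be mapped by \<open>dist_of_fun\<close> to the zero functional, since the
  integral of a non-integrable function is \<open>0\<close>.\<close>

definition continuous_into_sobolev ::
  "spatial_domain \<Rightarrow> real \<Rightarrow> (real \<Rightarrow> real \<Rightarrow> real) \<Rightarrow> bool" where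
  "continuous_into_sobolev M \<sigma> u \<longleftrightarrow>
     (\<forall>t\<ge>0. regular_fun M (u t) \<and> in_sobolev M \<sigma> (dist_of_fun M (u t))) \<and>
     (\<forall>t\<ge>0. ((\<lambda>\<tau>. sobolev_norm M \<sigma> (\<lambda>\<phi>. dist_of_fun M (u \<tau>) \<phi> - dist_of_fun M (u t) \<phi>))
               \<longlongrightarrow> 0) (at t within {0..}))"

text \<open>The equation is required to hold classically at all \<open>t \<ge> 0\<close> and all \<open>x\<close>, with a one-sided
  time derivative at \<open>t = 0\<close>. For curves that are continuous into every Sobolev space this is
  equivalent to the equation in the sense of distributions.\<close>

definition solves_bbm :: "(real \<Rightarrow> real \<Rightarrow> real) \<Rightarrow> bool" where
  "solves_bbm u \<longleftrightarrow>
     (\<exists>u_t u_tx u_txx u_x usq_x. \<forall>t\<ge>0. \<forall>x.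
        ((\<lambda>\<tau>. u \<tau> x) has_real_derivative u_t t x) (at t within {0..}) \<and>
        ((\<lambda>y. u_t t y) has_real_derivative u_tx t x) (at x) \<and>
        ((\<lambda>y. u_tx t y) has_real_derivative u_txx t x) (at x) \<and>
        ((\<lambda>y. u t y) has_real_derivative u_x t x) (at x) \<and>
        ((\<lambda>y. (u t y)\<^sup>2) has_real_derivative usq_x t x) (at x) \<and>
        u_t t x - u_txx t x + u_x t x + 1 / 2 * usq_x t x = 0)"

definition smooth_bbm_solution :: "spatial_domain \<Rightarrow> (real \<Rightarrow> real \<Rightarrow> real) \<Rightarrow> bool" where
  "smooth_bbm_solution M u \<longleftrightarrow> (\<forall>\<sigma>. continuous_into_sobolev M \<sigma> u) \<and> solves_bbm u"

end

theory Submission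
  imports "HOL-Probability.Probability" "HOL-Real_Asymp.Real_Asymp" Defs
begin

text \<open>The inflation comes from the quadratic term, which moves mass from high to low frequencies. With
  \<open>K = \<partial>\<^sub>x (1 - \<partial>\<^sub>x\<^sup>2)\<inverse>\<close>, convolution
  with an integrable kernel, the equation reads \<open>u\<^sub>t = - K (u + u\<^sup>2 /
  2)\<close>. The initial value is \<open>a + A cos (n x) E x\<close>, where \<open>a\<close> is
  smooth and close to the given distribution and \<open>E\<close> is a fixed smooth envelope. For
  fixed amplitude \<open>A\<close> the wave packet tends to \<open>0\<close> in
  \<open>H\<^sup>s\<close> as \<open>n \<rightarrow> \<infinity>\<close>, because \<open>s <
  0\<close> (\<open>wave_packet_small\<close>); hence \<open>A\<close> may be taken as large as
  desired before \<open>n\<close> is chosen. The square of the wave packet contains the term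
  \<open>A\<^sup>2 E\<^sup>2 / 2\<close>, which does not depend on \<open>n\<close> and has a
  nonzero Fourier transform on a fixed set of low frequencies.

  Let \<open>t = \<delta> / A\<close> with a small constant \<open>\<delta>\<close>. Up to time
  \<open>t\<close> the solution stays bounded by a multiple of \<open>A\<close>, so it moves by
  \<open>O(A\<^sup>2 t) = O(\<delta> A)\<close> only (\<open>bbm_short_time_bound\<close>), and
  its square keeps its low-frequency part, of size \<open>A\<^sup>2\<close>, up to an error
  \<open>O(\<delta> A\<^sup>2)\<close>. The low frequencies of \<open>u\<close> itself therefore
  grow to the size \<open>A\<^sup>2 t = \<delta> A\<close> (\<open>low_frequency_growth\<close>).
  This tends to infinity with \<open>A\<close> while \<open>t\<close> tends to \<open>0\<close>,
  and low frequencies bound every \<open>H\<^sup>s\<close> norm from below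
  (\<open>sobolev_norm_lower_bound\<close>).

  Global smooth solutions (\<open>bbm_global_solution\<close>) are obtained by truncation. If the
  square is truncated outside \<open>[-R, R]\<close>, the equation is an ordinary differential
  equation with a globally Lipschitz right-hand side, and Picard iteration gives a solution for
  all times. The integral of \<open>u\<^sup>2 + u\<^sub>x\<^sup>2\<close> is conserved for the
  truncated equation as well and bounds \<open>|u|\<close> by a number that depends on the initial
  value only. If \<open>R\<close> is that number, the truncation is never active. Spatial
  derivatives follow by bootstrapping, since \<open>(1 - \<partial>\<^sub>x\<^sup>2) u\<^sub>t = -
  \<partial>\<^sub>x (u + u\<^sup>2 / 2)\<close>.

  The line and the torus are treated together: all functions are bounded by a multiple of a weight
  \<open>rho\<close>, which is \<open>exp (-|x|/2)\<close> on the line and \<open>1\<close> on the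
  torus, and are periodic in the second case. The weight is integrable over the domain, so bounds
  by \<open>rho\<close> replace all \<open>L\<^sup>p\<close> norms, and integration by parts turns
  smoothness into decay of the Fourier transform.

  Smooth data are dense in \<open>H\<^sup>s\<close> for \<open>s \<le> 0\<close>
  (\<open>smooth_profiles_dense\<close>). On the torus one truncates the Fourier series. On the
  line one approximates the Fourier transform by products of \<open>exp (-\<xi>\<^sup>2/2)\<close>
  with finite sums of exponentials, which are the Fourier transforms of finite sums of translated
  Gaussians; this is possible by the Stone-Weierstrass theorem on the unit circle
  (\<open>gaussian_expsum_dense\<close>). The same approximation shows that the Fourier transform
  of a distribution is unique up to null sets and that it is hermitian if the distribution is
  real.\<close>

section \<open>The decay weight and integrals over a period or over the line\<close>

text \<open>The exponent \<open>1/2\<close> is smaller than the exponent \<open>1\<close> of the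
  kernel \<open>exp (-|x|)\<close> of the resolvent, so that convolution with the kernel preserves
  decay like \<open>rho\<close>.\<close>

definition rho :: "spatial_domain \<Rightarrow> real \<Rightarrow> real" where
  "rho M x = (case M of Line \<Rightarrow> exp (- \<bar>x\<bar> / 2) | Torus \<Rightarrow> 1)"

lemma rho_pos [simp]: "0 < rho M x"
  by (simp add: rho_def split: spatial_domain.split)

lemma rho_nonneg [simp]: "0 \<le> rho M x"
  using rho_pos less_imp_le by blast

lemma rho_le_1: "rho M x \<le> 1"
  by (simp add: rho_def split: spatial_domain.split)

lemma rho_shift: "rho M (x + z) \<le> rho M x * exp (\<bar>z\<bar> / 2)"
proof -
  have "- (\<bar>x + z\<bar> / 2) \<le> \<bar>z\<bar> / 2 - \<bar>x\<bar> / 2"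
    using abs_triangle_ineq4[of "x + z" z] by simp
  then show ?thesis
    by (auto simp: rho_def simp flip: exp_add split: spatial_domain.split)
qed

lemma continuous_rho: "continuous_on UNIV (rho M)"
  by (cases M) (auto simp: rho_def[abs_def] intro!: continuous_intros)

lemma rho_Torus [simp]: "rho Torus x = 1"
  by (simp add: rho_def)

lemma rho_Line: "rho Line x = exp (- \<bar>x\<bar> / 2)"
  by (simp add: rho_def)

lemma integral_exp_halfline:
  fixes c :: real assumes "0 < c"
  shows "set_integrable lborel {0..} (\<lambda>z. exp (- z * c))" (is ?A)
    and "(LINT z:{0..}|lborel. exp (- z * c)) = 1 / c" (is ?B)
proof -
  have "(\<integral>\<^sup>+x. ennreal (exp (- x * c)) * indicator {0..} x \<partial>lborel)
          = ennreal (0 - - (exp (- 0 * c) / c))"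
  proof (rule nn_integral_FTC_atLeast)
    show "((\<lambda>z. - (exp (- z * c) / c)) has_real_derivative exp (- z * c)) (at z)" for z
      using assms by (auto intro!: derivative_eq_intros)
    show "((\<lambda>z. - (exp (- z * c) / c)) \<longlongrightarrow> 0) at_top"
      using assms by real_asymp
  qed auto
  then have "has_bochner_integral lborel (\<lambda>x. indicator {0..} x *\<^sub>R exp (- x * c)) (1 / c)"
    using assms
    by (intro has_bochner_integral_nn_integral) (auto simp: mult.commute ennreal_mult' ennreal_indicator)
  then show ?A ?B
    by (simp_all add: has_bochner_integral_iff set_integrable_def set_lebesgue_integral_def)
qed

lemma sets_cell [measurable]: "cell M \<in> sets borel"
  by (cases M) (auto simp: cell_def)

lemma integrable_rho: "set_integrable lborel (cell M) (rho M)"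
proof (cases M)
  case Line
  have 1: "set_integrable lborel {0..} (\<lambda>z::real. exp (- z * (1/2)))"
    by (rule integral_exp_halfline) auto
  have a: "set_integrable lborel {0..} (rho Line)"
    by (rule set_integrable_cong[THEN iffD1, OF _ _ _ 1]) (auto simp: rho_def)
  have "integrable lborel (\<lambda>x. indicator {0..} (0 + -1 * x) *\<^sub>R rho Line (0 + -1 * x))"
    using a unfolding set_integrable_def by (rule lborel_integrable_real_affine) auto
  also have "(\<lambda>x. indicator {0..} (0 + -1 * x) *\<^sub>R rho Line (0 + -1 * x)) =
      (\<lambda>x. indicator {..0} x *\<^sub>R rho Line x)"
    by (auto simp: fun_eq_iff indicator_def rho_def)
  finally have b: "set_integrable lborel {..0} (rho Line)"
    unfolding set_integrable_def .
  have "set_integrable lborel ({0..} \<union> {..0}) (rho Line)"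
    using a b by (rule set_integrable_Un) auto
  also have "{0..} \<union> {..0} = (UNIV :: real set)" by auto
  finally show ?thesis by (simp add: Line cell_def)
next
  case Torus
  have "set_integrable lborel {0..<2*pi} (\<lambda>x. 1::real)"
    unfolding set_integrable_def by (auto intro!: integrable_real_indicator)
  then show ?thesis
    by (simp add: Torus cell_def rho_def[abs_def])
qed

definition rho_mass :: "spatial_domain \<Rightarrow> real" where
  "rho_mass M = (LINT x:cell M|lborel. rho M x)"

lemma rho_mass_nonneg [simp]: "0 \<le> rho_mass M"
  unfolding rho_mass_def set_lebesgue_integral_def by (rule integral_nonneg_AE) simp

context
  fixes f :: "real \<Rightarrow> 'a::{banach, second_countable_topology}" and C :: real and M
  assumes meas: "f \<in> borel_measurable borel" and bound: "\<And>x. norm (f x) \<le> C * rho M x"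
begin

lemma integrable_of_rho_bound: "set_integrable lborel (cell M) f"
  by (rule set_integrable_bound[where f = "\<lambda>x. C * rho M x"])
    (use meas order.trans[OF bound abs_ge_self] integrable_rho in \<open>auto simp: set_borel_measurable_def\<close>)

lemma integral_of_rho_bound: "norm (LINT x:cell M|lborel. f x) \<le> C * rho_mass M"
proof -
  have "norm (LINT x:cell M|lborel. f x) \<le> (LINT x:cell M|lborel. norm (f x))"
    by (rule set_integral_norm_bound[OF integrable_of_rho_bound])
  also have "\<dots> \<le> (LINT x:cell M|lborel. C * rho M x)"
    using integrable_of_rho_bound integrable_rho
    by (intro set_integral_mono) (auto simp: set_integrable_norm bound)
  finally show ?thesis by (simp add: rho_mass_def)
qed

end

lemma rho_decay:
  assumes "\<And>x. \<bar>J x\<bar> \<le> C * rho Line x"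
  shows "(J \<longlongrightarrow> 0) at_top" "(J \<longlongrightarrow> 0) at_bot"
proof -
  have lim: "((\<lambda>x::real. exp (- \<bar>x\<bar> / 2)) \<longlongrightarrow> 0) at_top" "((\<lambda>x::real. exp (- \<bar>x\<bar> / 2)) \<longlongrightarrow> 0) at_bot"
    by real_asymp+
  have "\<forall>\<^sub>F x in F. norm (J x) \<le> norm (exp (- \<bar>x\<bar> / 2)) * C" for F
    using assms by (intro always_eventually) (simp add: rho_Line mult.commute)
  then show "(J \<longlongrightarrow> 0) at_top" "(J \<longlongrightarrow> 0) at_bot"
    using tendsto_0_le[OF lim(1)] tendsto_0_le[OF lim(2)] by blast+
qed

lemma cell_integral_derivative:
  fixes J :: "real \<Rightarrow> real"
  assumes J: "\<And>x. (J has_real_derivative J' x) (at x)" and cont: "continuous_on UNIV J'"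
    and per: "function_on M J" and b0: "\<And>x. \<bar>J x\<bar> \<le> C * rho M x" and b1: "\<And>x. \<bar>J' x\<bar> \<le> C * rho M x"
  shows "(LINT x:cell M|lborel. J' x) = 0"
proof -
  have int: "set_integrable lborel (cell M) J'"
    using cont b1 by (intro integrable_of_rho_bound[of _ C]) (auto intro: borel_measurable_continuous_onI)
  show ?thesis
  proof (cases M)
    case Line
    have "(LBINT x=-\<infinity>..\<infinity>. J' x) = 0 - 0"
    proof (rule interval_integral_FTC_integrable)
      show "(J has_vector_derivative J' x) (at x)" for x
        using J has_real_derivative_iff_has_vector_derivative by blast
      show "isCont J' x" for x
        using cont by (simp add: continuous_on_eq_continuous_at)
      show "set_integrable lborel (einterval (- \<infinity>) \<infinity>) J'"
        using int by (simp add: Line cell_def)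
      show "((J \<circ> real_of_ereal) \<longlongrightarrow> 0) (at_right (- \<infinity>))" "((J \<circ> real_of_ereal) \<longlongrightarrow> 0) (at_left \<infinity>)"
        using rho_decay[of J C] b0 Line by (simp_all add: ereal_tendsto_simps)
    qed simp
    then show ?thesis
      by (simp add: Line cell_def interval_lebesgue_integral_def)
  next
    case Torus
    have "(LBINT x=ereal 0..ereal (2*pi). J' x) = J (2*pi) - J 0"
      by (rule interval_integral_FTC_finite)
        (use cont J in \<open>auto intro: continuous_on_subset has_field_derivative_at_within
           simp flip: has_real_derivative_iff_has_vector_derivative\<close>)
    moreover have "J (0 + 2*pi) = J 0"
      using per by (simp only: function_on_def Torus spatial_domain.case)
    ultimately show ?thesis
      by (simp add: Torus cell_def interval_integral_Ico)
  qed
qed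

lemma torus_representative:
  assumes per: "function_on Torus h"
  obtains y where "0 \<le> y" "y < 2 * pi" "h x = h y"
proof -
  have per_nat: "h (y + real n * (2*pi)) = h y" for y n
  proof (induction n arbitrary: y)
    case (Suc n)
    have "h (y + real (Suc n) * (2*pi)) = h ((y + real n * (2*pi)) + 2 * pi)"
      by (simp add: algebra_simps)
    also have "\<dots> = h (y + real n * (2*pi))"
      using per unfolding function_on_def spatial_domain.case by blast
    finally show ?case using Suc by simp
  qed simp
  define k where "k = \<lfloor>x / (2*pi)\<rfloor>"
  define y where "y = x - of_int k * (2*pi)"
  have "of_int k \<le> x / (2*pi)" "x / (2*pi) < of_int k + 1"
    unfolding k_def by linarith+
  then have y: "0 \<le> y" "y < 2*pi"
    unfolding y_def by (simp_all add: field_simps)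
  have "h x = h y"
  proof (cases "0 \<le> k")
    case True
    then show ?thesis using per_nat[of y "nat k"] by (simp add: y_def)
  next
    case False
    then show ?thesis using per_nat[of x "nat (-k)"] by (simp add: y_def)
  qed
  with y show ?thesis using that by blast
qed

text \<open>The Sobolev inequality in dimension one. On an interval of length \<open>1\<close> the
  function \<open>h\<^sup>2\<close> varies by at most the integral of \<open>2 |h h'| \<le>
  h\<^sup>2 + h'\<^sup>2\<close>; averaging over the interval gives the bound. Length
  \<open>1\<close> is chosen because such an interval fits into a period on one side of any given
  point.\<close>

lemma square_le_energy:
  fixes h :: "real \<Rightarrow> real"
  assumes h: "\<And>x. (h has_real_derivative h' x) (at x)" and cont: "continuous_on UNIV h'"
    and per: "function_on M h" and b0: "\<And>x. \<bar>h x\<bar> \<le> C * rho M x" and b1: "\<And>x. \<bar>h' x\<bar> \<le> C * rho M x"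
  shows "(h x)\<^sup>2 \<le> 2 * (LINT y:cell M|lborel. (h y)\<^sup>2 + (h' y)\<^sup>2)"
proof -
  let ?e = "\<lambda>y. (h y)\<^sup>2 + (h' y)\<^sup>2"
  have conth: "continuous_on A h" for A
    using h by (meson DERIV_continuous continuous_at_imp_continuous_on)
  have conth': "continuous_on A h'" for A
    by (rule continuous_on_subset[OF cont]) simp
  have conte: "continuous_on A ?e" for A
    by (intro continuous_intros conth conth')
  have C: "0 \<le> C"
    using order.trans[OF abs_ge_zero b0[of 0]] rho_pos[of M 0] by (auto simp: zero_le_mult_iff simp del: rho_pos)
  have sq: "r\<^sup>2 \<le> C\<^sup>2 * rho M y" if "\<bar>r\<bar> \<le> C * rho M y" for r y
  proof -
    have "r\<^sup>2 \<le> (C * rho M y)\<^sup>2"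
      using power_mono[OF that abs_ge_zero, of 2] by simp
    also have "\<dots> \<le> C\<^sup>2 * rho M y"
      unfolding power_mult_distrib power2_eq_square[of "rho M y"]
      using mult_left_mono[OF rho_le_1, of "rho M y" M y] by (intro mult_left_mono) auto
    finally show ?thesis .
  qed
  have int: "set_integrable lborel (cell M) ?e"
  proof (rule integrable_of_rho_bound)
    show "norm (?e y) \<le> 2 * C\<^sup>2 * rho M y" for y
      using add_mono[OF sq[OF b0] sq[OF b1], of y y] by (simp add: mult_ac)
  qed (intro borel_measurable_continuous_onI conte)
  have int_ab: "set_integrable lborel {a..b} ?e" for a b
    using conte borel_integrable_atLeastAtMost'[of a b ?e] by (simp add: set_integrable_def)
  have main: "(h x)\<^sup>2 \<le> 2 * (LINT y:cell M|lborel. ?e y)"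
    if x: "x \<in> {a..a+1}" and sub: "{a..a+1} \<subseteq> cell M" for x a
  proof -
    have E: "integral {a..a+1} ?e \<le> (LINT y:cell M|lborel. ?e y)"
    proof -
      have "integral {a..a+1} ?e = (LINT y:{a..a+1}|lborel. ?e y)"
        using set_borel_integral_eq_integral(2)[OF int_ab] by simp
      also have "\<dots> \<le> (LINT y:cell M|lborel. ?e y)"
        unfolding set_lebesgue_integral_def
        by (rule integral_mono)
          (use int_ab int sub in \<open>auto simp: set_integrable_def split: split_indicator\<close>)
      finally show ?thesis .
    qed
    have ii: "?e integrable_on {c..d}" for c d
      by (intro integrable_continuous_interval conte)
    have diff: "\<bar>(h d)\<^sup>2 - (h c)\<^sup>2\<bar> \<le> integral {a..a+1} ?e" if "a \<le> c" "c \<le> d" "d \<le> a + 1" for c d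
    proof -
      have "((\<lambda>z. (h z)\<^sup>2) has_real_derivative 2 * h z * h' z) (at z within {c..d})" for z
        by (rule derivative_eq_intros has_field_derivative_at_within[OF h] refl)+ simp
      then have "((\<lambda>z. 2 * h z * h' z) has_integral (h d)\<^sup>2 - (h c)\<^sup>2) {c..d}"
        using that
        by (intro fundamental_theorem_of_calculus)
          (simp_all add: has_real_derivative_iff_has_vector_derivative)
      then have "\<bar>(h d)\<^sup>2 - (h c)\<^sup>2\<bar> = norm (integral {c..d} (\<lambda>z. 2 * h z * h' z))"
        by (simp add: integral_unique)
      also have "\<dots> \<le> integral {c..d} ?e"
      proof (rule integral_norm_bound_integral)
        show "(\<lambda>z. 2 * h z * h' z) integrable_on {c..d}"
          by (intro integrable_continuous_interval continuous_intros conth conth')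
        show "norm (2 * h z * h' z) \<le> ?e z" for z
          using sum_squares_bound[of "\<bar>h z\<bar>" "\<bar>h' z\<bar>"] by (simp add: abs_mult)
      qed (rule ii)
      also have "\<dots> \<le> integral {a..a+1} ?e"
        using that by (intro integral_subset_le ii) auto
      finally show ?thesis .
    qed
    have "(h x)\<^sup>2 \<le> (h y)\<^sup>2 + integral {a..a+1} ?e" if "y \<in> {a..a+1}" for y
      using diff[of x y] diff[of y x] x that by (cases "x \<le> y") auto
    then have "integral {a..a+1} (\<lambda>y. (h x)\<^sup>2) \<le> integral {a..a+1} (\<lambda>y. (h y)\<^sup>2 + integral {a..a+1} ?e)"
      by (intro integral_le integrable_continuous_interval continuous_intros conth) auto
    also have "\<dots> = integral {a..a+1} (\<lambda>y. (h y)\<^sup>2) + integral {a..a+1} ?e"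
      by (subst Henstock_Kurzweil_Integration.integral_add)
        (simp_all add: integrable_continuous_interval continuous_on_power conth)
    also have "integral {a..a+1} (\<lambda>y. (h y)\<^sup>2) \<le> integral {a..a+1} ?e"
      by (intro integral_le ii integrable_continuous_interval continuous_intros conth) auto
    finally show ?thesis using E by simp
  qed
  show ?thesis
  proof (cases M)
    case Line
    then show ?thesis using main[of x x] by (simp add: cell_def)
  next
    case Torus
    obtain x' where x': "0 \<le> x'" "x' < 2 * pi" "h x = h x'"
      using torus_representative[of h x] per Torus by auto
    have "(h x')\<^sup>2 \<le> 2 * (LINT y:cell M|lborel. ?e y)"
    proof (cases "x' < 3")
      case True
      then have "{x'..x' + 1} \<subseteq> cell M" using x' pi_gt3 by (auto simp: Torus cell_def)
      then show ?thesis by (intro main[of x' x']) auto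
    next
      case False
      then have "{x' - 1..x' - 1 + 1} \<subseteq> cell M" using x' pi_gt3 by (auto simp: Torus cell_def)
      then show ?thesis by (intro main[of x' "x' - 1"]) auto
    qed
    then show ?thesis using x' by simp
  qed
qed

section \<open>The resolvent of the second derivative\<close>

lemma lower_integral_derivative:
  fixes h :: "real \<Rightarrow> real"
  assumes cont: "continuous_on UNIV h" and int: "\<And>x. set_integrable lborel {..x} h"
  shows "((\<lambda>u. LINT y:{..u}|lborel. h y) has_real_derivative h x) (at x)"
proof -
  let ?I = "\<lambda>u. LINT y:{..u}|lborel. h y"
  have split: "?I u = ?I (x - 1) + (LBINT y=ereal (x-1)..u. h y)" if "x - 1 < u" for u
  proof -
    have "?I u = (LINT y:{..x-1} \<union> {x-1<..u}|lborel. h y)"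
      using that by (intro arg_cong2[where f="\<lambda>A. set_lebesgue_integral lborel A"]) auto
    also have "\<dots> = ?I (x - 1) + (LINT y:{x-1<..u}|lborel. h y)"
      by (intro set_integral_Un int set_integrable_subset[OF int[of u]]) auto
    finally show ?thesis using that by (simp add: interval_integral_Ioc)
  qed
  have "((\<lambda>u. LBINT y=ereal (x-1)..u. h y) has_vector_derivative h x) (at x within {x-1..x+1})"
    by (rule interval_integral_FTC2) (auto intro: continuous_on_subset[OF cont])
  then have "((\<lambda>u. LBINT y=ereal (x-1)..u. h y) has_real_derivative h x) (at x)"
    by (simp add: has_real_derivative_iff_has_vector_derivative at_within_Icc_at)
  then have "((\<lambda>u. ?I (x-1) + (LBINT y=ereal (x-1)..u. h y)) has_real_derivative h x) (at x)"
    by (auto intro!: derivative_eq_intros)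
  then show ?thesis
    by (rule has_field_derivative_transform_within_open[where S = "{x-1<..}"]) (auto simp: split)
qed

text \<open>The kernel \<open>exp (-|z|) / 2\<close> of \<open>(1 -
  \<partial>\<^sub>x\<^sup>2)\<inverse>\<close> is split at its kink. The half-line averages
  \<open>bwd f\<close> and \<open>fwd f\<close> solve the first-order equations \<open>g' = f -
  g\<close> and \<open>g' = g - f\<close>, from which the derivatives of the resolvent follow
  without differentiating a kernel.\<close>

definition bwd :: "(real \<Rightarrow> real) \<Rightarrow> real \<Rightarrow> real" where
  "bwd f x = (LINT z:{0..}|lborel. exp (- z) * f (x - z))"

definition fwd :: "(real \<Rightarrow> real) \<Rightarrow> real \<Rightarrow> real" where
  "fwd f x = (LINT z:{0..}|lborel. exp (- z) * f (x + z))"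

definition resolvent :: "(real \<Rightarrow> real) \<Rightarrow> real \<Rightarrow> real" where
  "resolvent f x = (fwd f x + bwd f x) / 2"

text \<open>The derivative of the resolvent, \<open>\<partial>\<^sub>x (1 -
  \<partial>\<^sub>x\<^sup>2)\<inverse>\<close>; see \<open>resolvent_derivative\<close>.\<close>

definition resolvent_dx :: "(real \<Rightarrow> real) \<Rightarrow> real \<Rightarrow> real" where
  "resolvent_dx f x = (fwd f x - bwd f x) / 2"

text \<open>The part of \<open>decaying\<close> that makes sense for all functions in the Banach
  space in which the equation is solved; that space also contains functions without
  periodicity.\<close>

definition dominated :: "spatial_domain \<Rightarrow> real \<Rightarrow> (real \<Rightarrow> real) \<Rightarrow> bool" where
  "dominated M C f \<longleftrightarrow> continuous_on UNIV f \<and> (\<forall>x. \<bar>f x\<bar> \<le> C * rho M x)"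

lemma fwd_eq_bwd: "fwd f x = bwd (\<lambda>y. f (- y)) (- x)"
  by (simp add: fwd_def bwd_def add.commute)

lemma rho_minus [simp]: "rho M (- x) = rho M x"
  by (cases M) (auto simp: rho_def)

lemma dominated_minus: "dominated M C f \<Longrightarrow> dominated M C (\<lambda>y. f (- y))"
  by (auto simp: dominated_def intro!: continuous_on_compose2[of UNIV f] continuous_intros)
    (metis rho_minus)

context
  fixes M C f
  assumes f: "dominated M C f"
begin

lemma dominatedD: "continuous_on UNIV f" "\<bar>f x\<bar> \<le> C * rho M x"
  "f \<in> borel_measurable borel"
  using f by (auto simp: dominated_def intro: borel_measurable_continuous_onI)

lemma dominated_const_nonneg: "0 \<le> C"
  using order.trans[OF abs_ge_zero dominatedD(2)[of 0]] rho_pos[of M 0]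
  by (auto simp: zero_le_mult_iff simp del: rho_pos)

lemma bwd_integrand_bound:
  "0 \<le> z \<Longrightarrow> \<bar>exp (- z) * f (x - z)\<bar> \<le> C * rho M x * exp (- z * (1/2))"
proof -
  assume z: "0 \<le> z"
  have "\<bar>f (x - z)\<bar> \<le> C * (rho M x * exp (\<bar>- z\<bar> / 2))"
    using order.trans[OF dominatedD(2) mult_left_mono[OF rho_shift dominated_const_nonneg, of M x "- z"]] by simp
  then have "exp (- z) * \<bar>f (x - z)\<bar> \<le> exp (- z) * (C * (rho M x * exp (z / 2)))"
    using z by (intro mult_left_mono) auto
  also have "\<dots> = C * rho M x * (exp (- z) * exp (z / 2))" by simp
  also have "exp (- z) * exp (z / 2) = exp (- z * (1/2))" by (simp flip: exp_add)
  finally show ?thesis by (simp add: abs_mult)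
qed

lemma bwd_integrable: "set_integrable lborel {0..} (\<lambda>z. exp (- z) * f (x - z))"
proof (rule set_integrable_bound)
  show "set_integrable lborel {0..} (\<lambda>z. C * rho M x * exp (- z * (1/2)))"
    using integral_exp_halfline(1)[of "1/2"] by (intro set_integrable_mult_right) auto
  show "set_borel_measurable lborel {0..} (\<lambda>z. exp (- z) * f (x - z))"
    using dominatedD(3) unfolding set_borel_measurable_def by measurable
  show "AE z in lborel. z \<in> {0..} \<longrightarrow> norm (exp (- z) * f (x - z)) \<le> norm (C * rho M x * exp (- z * (1/2)))"
    using order.trans[OF bwd_integrand_bound abs_ge_self] by auto
qed

lemma bwd_bound: "\<bar>bwd f x\<bar> \<le> 2 * C * rho M x"
proof -
  have "norm (bwd f x) \<le> (LINT z:{0..}|lborel. norm (exp (- z) * f (x - z)))"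
    unfolding bwd_def by (rule set_integral_norm_bound[OF bwd_integrable])
  also have "\<dots> \<le> (LINT z:{0..}|lborel. C * rho M x * exp (- z * (1/2)))"
    using integral_exp_halfline(1)[of "1/2"] bwd_integrand_bound
    by (intro set_integral_mono set_integrable_norm bwd_integrable set_integrable_mult_right) auto
  also have "\<dots> = 2 * C * rho M x"
    using integral_exp_halfline(2)[of "1/2"] by simp
  finally show ?thesis by simp
qed

text \<open>After multiplication by \<open>exp x\<close> the average becomes an integral up to the
  variable endpoint \<open>x\<close>, to which the fundamental theorem of calculus
  applies.\<close>

lemma bwd_substitution:
  "set_integrable lborel {..x} (\<lambda>y. exp y * f y)"
  "(LINT y:{..x}|lborel. exp y * f y) = exp x * bwd f x"
proof -
  let ?g = "\<lambda>y. indicator {..x} y *\<^sub>R (exp y * f y)"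
  have g: "?g (x + -1 * z) = exp x * (indicator {0..} z *\<^sub>R (exp (- z) * f (x - z)))" for z
    by (auto simp: indicator_def exp_diff exp_minus field_simps)
  have "integrable lborel (\<lambda>z. ?g (x + -1 * z))"
    unfolding g using bwd_integrable[of x] by (simp add: set_integrable_def)
  then show "set_integrable lborel {..x} (\<lambda>y. exp y * f y)"
    unfolding set_integrable_def by (subst (asm) lborel_integrable_real_affine_iff) auto
  show "(LINT y:{..x}|lborel. exp y * f y) = exp x * bwd f x"
    unfolding set_lebesgue_integral_def bwd_def
    by (subst lborel_integral_real_affine[of "-1" _ x]) (simp_all only: g, simp_all)
qed

lemma bwd_derivative: "(bwd f has_real_derivative f x - bwd f x) (at x)"
proof -
  have "((\<lambda>u. LINT y:{..u}|lborel. exp y * f y) has_real_derivative exp x * f x) (at x)"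
    by (rule lower_integral_derivative)
      (auto intro!: continuous_intros dominatedD bwd_substitution)
  then have d: "((\<lambda>u. exp u * bwd f u) has_real_derivative exp x * f x) (at x)"
    unfolding bwd_substitution .
  have "((\<lambda>u. exp (- u)) has_real_derivative - exp (- x)) (at x)"
    by (auto intro!: derivative_eq_intros)
  from DERIV_mult[OF this d]
  have "((\<lambda>u. exp (- u) * (exp u * bwd f u)) has_real_derivative
      exp (- x) * (exp x * f x) - exp (- x) * (exp x * bwd f x)) (at x)"
    by (simp add: algebra_simps)
  moreover have "exp (- u) * (exp u * y) = y" for u y :: real
    by (simp add: exp_minus)
  ultimately show ?thesis by simp
qed

end

context
  fixes M C f
  assumes f: "dominated M C f"
begin

lemma fwd_derivative: "(fwd f has_real_derivative fwd f x - f x) (at x)"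
  unfolding fwd_eq_bwd[abs_def]
  using DERIV_chain[OF bwd_derivative[OF dominated_minus[OF f]], of uminus "-1" x UNIV]
  by (simp add: o_def DERIV_minus)

lemma fwd_bound: "\<bar>fwd f x\<bar> \<le> 2 * C * rho M x"
  using bwd_bound[OF dominated_minus[OF f], of "- x"] by (simp add: fwd_eq_bwd)

lemma resolvent_derivative: "(resolvent f has_real_derivative resolvent_dx f x) (at x)"
  unfolding resolvent_def[abs_def] resolvent_dx_def
  by (auto intro!: derivative_eq_intros fwd_derivative bwd_derivative[OF f])

text \<open>This is the resolvent equation \<open>g - g'' = f\<close> for \<open>g = resolvent
  f\<close>.\<close>

lemma resolvent_dx_derivative: "(resolvent_dx f has_real_derivative resolvent f x - f x) (at x)"
  unfolding resolvent_dx_def[abs_def] resolvent_def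
  by (auto intro!: derivative_eq_intros fwd_derivative bwd_derivative[OF f] simp: field_simps)

lemma dominated_resolvent: "dominated M (2 * C) (resolvent f)"
  and dominated_resolvent_dx: "dominated M (2 * C) (resolvent_dx f)"
proof -
  have b: "\<bar>resolvent f x\<bar> \<le> 2 * C * rho M x \<and> \<bar>resolvent_dx f x\<bar> \<le> 2 * C * rho M x" for x
  proof -
    have "\<bar>(a + b) / 2\<bar> \<le> B \<and> \<bar>(a - b) / 2\<bar> \<le> B" if "\<bar>a\<bar> \<le> B" "\<bar>b\<bar> \<le> B" for a b B :: real
      using that by (auto simp: abs_le_iff)
    from this[OF fwd_bound bwd_bound[OF f]] show ?thesis
      unfolding resolvent_def resolvent_dx_def .
  qed
  show "dominated M (2 * C) (resolvent f)" "dominated M (2 * C) (resolvent_dx f)"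
    using b DERIV_isCont[OF resolvent_derivative] DERIV_isCont[OF resolvent_dx_derivative]
    by (auto simp: dominated_def continuous_on_eq_continuous_at)
qed

end

lemma dominated_diff:
  assumes "dominated M C f" "dominated M D g" "\<And>x. \<bar>f x - g x\<bar> \<le> E * rho M x"
  shows "dominated M E (\<lambda>x. f x - g x)"
  using assms by (auto simp: dominated_def intro!: continuous_intros)

lemma resolvent_diff:
  assumes f: "dominated M C f" and g: "dominated M D g"
  shows "resolvent (\<lambda>x. f x - g x) x = resolvent f x - resolvent g x"
    and "resolvent_dx (\<lambda>x. f x - g x) x = resolvent_dx f x - resolvent_dx g x"
proof -
  have b: "bwd (\<lambda>x. f x - g x) x = bwd f x - bwd g x" if "dominated M C f" "dominated M D g" for f g x
    unfolding bwd_def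
    using set_integral_diff(2)[OF bwd_integrable[OF that(1), of x] bwd_integrable[OF that(2), of x]]
    by (simp add: right_diff_distrib)
  show "resolvent (\<lambda>x. f x - g x) x = resolvent f x - resolvent g x"
    "resolvent_dx (\<lambda>x. f x - g x) x = resolvent_dx f x - resolvent_dx g x"
    unfolding resolvent_def resolvent_dx_def fwd_eq_bwd b[OF f g]
      b[OF dominated_minus[OF f] dominated_minus[OF g]] by argo+
qed

definition decaying :: "spatial_domain \<Rightarrow> real \<Rightarrow> (real \<Rightarrow> real) \<Rightarrow> bool" where
  "decaying M C f \<longleftrightarrow> dominated M C f \<and> function_on M f"

lemma decayingD:
  assumes "decaying M C f"
  shows "continuous_on UNIV f" "function_on M f" "\<bar>f x\<bar> \<le> C * rho M x" "f \<in> borel_measurable borel"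
    "dominated M C f"
  using assms dominatedD by (auto simp: decaying_def)

lemmas decaying_const_nonneg = dominated_const_nonneg[OF decayingD(5)]

lemma function_on_resolvent:
  assumes "function_on M f"
  shows "function_on M (resolvent f)" and "function_on M (resolvent_dx f)"
proof -
  have "function_on M (bwd f) \<and> function_on M (fwd f)"
  proof (cases M)
    case Torus
    then have f: "f (y + 2 * pi) = f y" for y
      using assms by (simp add: function_on_def)
    have "f (x + 2 * pi - z) = f (x - z)" "f (x + 2 * pi + z) = f (x + z)" for x z
      using f[of "x - z"] f[of "x + z"] by (simp_all add: algebra_simps)
    then show ?thesis
      by (simp add: Torus function_on_def bwd_def fwd_def)
  qed (simp_all add: function_on_def)
  then show "function_on M (resolvent f)" "function_on M (resolvent_dx f)"
    by (auto simp: function_on_def resolvent_def resolvent_dx_def split: spatial_domain.splits)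
qed

lemma decaying_resolvent: "decaying M C f \<Longrightarrow> decaying M (2 * C) (resolvent f)"
  and decaying_resolvent_dx: "decaying M C f \<Longrightarrow> decaying M (2 * C) (resolvent_dx f)"
  using dominated_resolvent dominated_resolvent_dx function_on_resolvent by (auto simp: decaying_def)

lemma decaying_diff:
  assumes "decaying M C f" "decaying M D g" "\<And>x. \<bar>f x - g x\<bar> \<le> E * rho M x"
  shows "decaying M E (\<lambda>x. f x - g x)"
  using assms dominated_diff by (auto simp: decaying_def function_on_def split: spatial_domain.splits)

section \<open>Globally Lipschitz evolution equations\<close>

lemma indefinite_integral_derivative:
  fixes g :: "real \<Rightarrow> 'a::banach"
  assumes g: "continuous_on {0..} g" and t: "0 \<le> t"
  shows "((\<lambda>u. integral {0..u} g) has_vector_derivative g t) (at t within {0..})"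
proof -
  have "((\<lambda>u. integral {0..u} g) has_vector_derivative g t) (at t within {0..t+1})"
    by (rule integral_has_vector_derivative) (use t in \<open>auto intro: continuous_on_subset[OF g]\<close>)
  moreover have "at t within {0..t+1} = at t within {0..}"
    by (rule at_within_nhd[of t "{..<t+1}"]) auto
  ultimately show ?thesis by simp
qed

lemma integral_exp_growth_bound:
  fixes g :: "real \<Rightarrow> 'a::banach"
  assumes g: "continuous_on {0..p} g" and p: "0 \<le> p" and L: "0 < L"
    and b: "\<And>s. 0 \<le> s \<Longrightarrow> s \<le> p \<Longrightarrow> norm (g s) \<le> A + L * B * exp (2 * L * s)"
  shows "norm (integral {0..p} g) \<le> A * p + B * (exp (2 * L * p) - 1) / 2"
proof -
  have "((\<lambda>s. A + L * B * exp (2 * L * s)) has_integral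
      (A * p + B * exp (2 * L * p) / 2) - (A * 0 + B * exp (2 * L * 0) / 2)) {0..p}"
  proof (rule fundamental_theorem_of_calculus[OF p])
    fix s
    show "((\<lambda>s. A * s + B * exp (2 * L * s) / 2) has_vector_derivative A + L * B * exp (2 * L * s)) (at s within {0..p})"
      unfolding has_real_derivative_iff_has_vector_derivative[symmetric]
      by (auto intro!: derivative_eq_intros)
  qed
  then have i: "((\<lambda>s. A + L * B * exp (2 * L * s)) has_integral A * p + B * (exp (2 * L * p) - 1) / 2) {0..p}"
    by (simp add: algebra_simps diff_divide_distrib)
  show ?thesis
    using integral_norm_bound_integral[OF integrable_continuous_interval[OF g] has_integral_integrable[OF i]] b
    by (simp add: integral_unique[OF i])
qed

text \<open>Picard's theorem on the whole half-line: in the norm with weight \<open>exp (-2 L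
  t)\<close> the integral operator is a contraction with constant \<open>1/2\<close>. Uniqueness
  of its fixed point gives the last conclusion, that symmetries of the equation and of the initial
  value are inherited by the solution.\<close>

theorem global_lipschitz_ode:
  fixes F :: "'a::banach \<Rightarrow> 'a"
  assumes lip: "\<And>x y. norm (F x - F y) \<le> L * norm (x - y)" and L: "0 < L"
  obtains u where "u 0 = x0"
    and "\<And>t. 0 \<le> t \<Longrightarrow> (u has_vector_derivative F (u t)) (at t within {0..})"
    and "\<And>T t. bounded_linear T \<Longrightarrow> (\<And>x. T (F x) = F (T x)) \<Longrightarrow> T x0 = x0 \<Longrightarrow> 0 \<le> t \<Longrightarrow> T (u t) = u t"
proof -
  have contF: "continuous_on A F" for A
    using lip L by (intro lipschitz_on_continuous_on[of L] lipschitz_onI) (auto simp: dist_norm)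
  \<comment> \<open>A path \<open>u\<close> is represented by the bounded continuous function
    \<open>w = e (-1) u\<close>. It has to be defined on the whole real line; the operator
    \<open>Phi0\<close> below extends it by a constant to negative times.\<close>
  define e where "e c t = exp (c * (2 * L * t))" for c t :: real
  have e_inv: "e 1 t * e (-1) t = 1" for t
    by (simp_all add: e_def exp_minus)
  have e_pos: "0 < e c t" for c t by (simp add: e_def)
  define I where "I w t = x0 + integral {0..t} (\<lambda>s. F (e 1 s *\<^sub>R apply_bcontfun w s))" for w :: "real \<Rightarrow>\<^sub>C 'a" and t
  define Phi0 where "Phi0 w t = e (-1) (max 0 t) *\<^sub>R I w (max 0 t)" for w t
  have cont_in: "continuous_on A (\<lambda>s. F (e 1 s *\<^sub>R apply_bcontfun w s))" for A w
    unfolding e_def by (intro continuous_on_compose2[OF contF[of UNIV]] continuous_intros) auto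
  have I_deriv: "(I w has_vector_derivative F (e 1 t *\<^sub>R apply_bcontfun w t)) (at t within {0..})" if "0 \<le> t" for w t
    unfolding I_def using indefinite_integral_derivative[OF cont_in that]
    by (auto intro!: derivative_eq_intros)
  have cont_I: "continuous_on {0..} (I w)" for w
    using I_deriv has_vector_derivative_continuous by (fastforce simp: continuous_on_eq_continuous_within)
  have Phi0: "Phi0 w \<in> bcontfun" for w
  proof (rule bcontfun_normI)
    show "continuous_on UNIV (Phi0 w)"
      unfolding Phi0_def e_def
      by (intro continuous_intros continuous_on_compose2[OF cont_I]) auto
    fix t :: real
    define p where "p = max 0 t"
    have p: "0 \<le> p" by (simp add: p_def)
    have "norm (F (e 1 s *\<^sub>R apply_bcontfun w s)) \<le> norm (F 0) + L * norm w * exp (2 * L * s)" for s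
    proof -
      have "norm (F (e 1 s *\<^sub>R apply_bcontfun w s)) \<le> norm (F 0) + L * norm (e 1 s *\<^sub>R apply_bcontfun w s)"
        using lip[of "e 1 s *\<^sub>R apply_bcontfun w s" 0] norm_triangle_sub[of "F (e 1 s *\<^sub>R apply_bcontfun w s)" "F 0"] by simp
      also have "L * norm (e 1 s *\<^sub>R apply_bcontfun w s) \<le> L * (exp (2 * L * s) * norm w)"
        using L by (intro mult_left_mono) (auto simp: e_def norm_bounded)
      finally show ?thesis by (simp add: mult_ac)
    qed
    from integral_exp_growth_bound[OF cont_in p L this]
    have "norm (I w p) \<le> norm x0 + (norm (F 0) * p + norm w * (exp (2 * L * p) - 1) / 2)"
      unfolding I_def by (intro norm_triangle_le add_mono) auto
    moreover have "1 \<le> exp (2 * L * p)" using p L by simp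
    then have "norm x0 \<le> norm x0 * exp (2 * L * p)" by (simp add: mult_le_cancel_left1)
    moreover have "2 * L * p \<le> exp (2 * L * p)"
      using exp_ge_add_one_self[of "2 * L * p"] by linarith
    then have "p \<le> exp (2 * L * p) / (2 * L)"
      using L by (simp add: field_simps)
    then have "norm (F 0) * p \<le> norm (F 0) * (exp (2 * L * p) / (2 * L))"
      by (rule mult_left_mono) simp
    moreover have "norm w * (exp (2 * L * p) - 1) / 2 \<le> norm w * exp (2 * L * p)"
    proof -
      have "norm w * (exp (2 * L * p) - 1) \<le> norm w * exp (2 * L * p)"
        by (rule mult_left_mono) auto
      moreover have "0 \<le> norm w * exp (2 * L * p)" by simp
      ultimately show ?thesis by linarith
    qed
    ultimately have "norm (I w p) \<le> (norm x0 + norm (F 0) / (2 * L) + norm w) * exp (2 * L * p)"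
      unfolding distrib_right times_divide_eq_left times_divide_eq_right by linarith
    then have "e (-1) p * norm (I w p) \<le> e (-1) p * ((norm x0 + norm (F 0) / (2 * L) + norm w) * exp (2 * L * p))"
      using e_pos by (intro mult_left_mono) (auto intro: less_imp_le)
    also have "\<dots> = norm x0 + norm (F 0) / (2 * L) + norm w"
      by (simp add: e_def exp_minus)
    finally show "norm (Phi0 w t) \<le> norm x0 + norm (F 0) / (2 * L) + norm w"
      using e_pos[of "-1" p] by (simp add: Phi0_def p_def)
  qed
  define Phi where "Phi w = Bcontfun (Phi0 w)" for w
  have Phi: "apply_bcontfun (Phi w) t = Phi0 w t" for w t
    unfolding Phi_def using Bcontfun_inverse[OF Phi0] by simp
  have "dist (Phi w) (Phi w') \<le> 1/2 * dist w w'" for w w'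
  proof (rule dist_bound)
    fix t :: real
    define p where "p = max 0 t"
    have p: "0 \<le> p" by (simp add: p_def)
    let ?D = "\<lambda>s. F (e 1 s *\<^sub>R apply_bcontfun w s) - F (e 1 s *\<^sub>R apply_bcontfun w' s)"
    have "norm (?D s) \<le> 0 + L * dist w w' * exp (2 * L * s)" for s
    proof -
      have "norm (?D s) \<le> L * norm (e 1 s *\<^sub>R (apply_bcontfun w s - apply_bcontfun w' s))"
        using lip[of "e 1 s *\<^sub>R apply_bcontfun w s" "e 1 s *\<^sub>R apply_bcontfun w' s"] by (simp add: scaleR_diff_right)
      also have "\<dots> \<le> L * (exp (2 * L * s) * dist w w')"
        using L dist_bounded[of w s w'] by (intro mult_left_mono) (auto simp: e_def dist_norm)
      finally show ?thesis by (simp add: mult_ac)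
    qed
    from integral_exp_growth_bound[OF continuous_on_diff[OF cont_in cont_in] p L this]
    have "norm (integral {0..p} ?D) \<le> dist w w' * (exp (2 * L * p) - 1) / 2" by simp
    also have "\<dots> \<le> dist w w' * exp (2 * L * p) / 2"
      by (intro divide_right_mono mult_left_mono) auto
    finally have *: "e (-1) p * norm (integral {0..p} ?D) \<le> e (-1) p * (dist w w' * exp (2 * L * p) / 2)"
      using e_pos by (intro mult_left_mono) (auto intro: less_imp_le)
    have "Phi0 w t - Phi0 w' t = e (-1) p *\<^sub>R integral {0..p} ?D"
      unfolding Phi0_def I_def p_def[symmetric]
      by (subst Henstock_Kurzweil_Integration.integral_diff)
        (auto intro!: integrable_continuous_interval cont_in simp: scaleR_diff_right[symmetric])
    then have "dist (apply_bcontfun (Phi w) t) (apply_bcontfun (Phi w') t) = e (-1) p * norm (integral {0..p} ?D)"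
      using e_pos[of "-1" p] by (simp add: Phi dist_norm)
    also note *
    also have "e (-1) p * (dist w w' * exp (2 * L * p) / 2) = 1/2 * dist w w'"
      by (simp add: e_def exp_minus)
    finally show "dist (apply_bcontfun (Phi w) t) (apply_bcontfun (Phi w') t) \<le> 1/2 * dist w w'" .
  qed
  then have ex1: "\<exists>!w. Phi w = w"
    by (intro banach_fix_type[of "1/2"]) auto
  then obtain w where w: "Phi w = w" by blast
  define u where "u t = e 1 t *\<^sub>R apply_bcontfun w t" for t
  have u_I: "u t = I w t" if "0 \<le> t" for t
  proof -
    have "u t = e 1 t *\<^sub>R Phi0 w t" using Phi[of w t] by (simp add: u_def w)
    then show ?thesis using that by (simp add: Phi0_def e_inv)
  qed
  show ?thesis
  proof (rule that)
    show "u 0 = x0" using u_I[of 0] by (simp add: I_def)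
    show "(u has_vector_derivative F (u t)) (at t within {0..})" if "0 \<le> t" for t
      by (rule has_vector_derivative_transform[OF _ _ I_deriv[OF that, of w, folded u_def]])
        (use that u_I in auto)
    fix T :: "'a \<Rightarrow> 'a" and t :: real
    assume T: "bounded_linear T" and TF: "\<And>x. T (F x) = F (T x)" and T0: "T x0 = x0" and t: "0 \<le> t"
    interpret T: bounded_linear T by fact
    obtain K where K: "0 \<le> K" "\<And>x. norm (T x) \<le> norm x * K" using T.nonneg_bounded by blast
    obtain w' where w': "apply_bcontfun w' = (\<lambda>t. T (apply_bcontfun w t))"
    proof (rule bcontfunE[of "\<lambda>t. T (apply_bcontfun w t)"])
      show "(\<lambda>t. T (apply_bcontfun w t)) \<in> bcontfun"
      proof (rule bcontfun_normI)
        show "continuous_on UNIV (\<lambda>t. T (apply_bcontfun w t))"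
          by (intro T.continuous_on continuous_on_apply_bcontfun)
        show "norm (T (apply_bcontfun w t)) \<le> norm w * K" for t
          by (rule order.trans[OF K(2) mult_right_mono]) (auto simp: norm_bounded K(1))
      qed
    qed auto
    have "T (I w p) = I w' p" for p
    proof -
      have "T (integral {0..p} (\<lambda>s. F (e 1 s *\<^sub>R apply_bcontfun w s)))
          = integral {0..p} (T \<circ> (\<lambda>s. F (e 1 s *\<^sub>R apply_bcontfun w s)))"
        by (subst integral_linear[OF integrable_continuous_interval[OF cont_in] T]) simp
      then show ?thesis
        unfolding I_def by (simp add: T.add T0 o_def TF T.scaleR w')
    qed
    then have "Phi w' = w'"
      by (intro bcontfun_eqI) (metis Phi Phi0_def T.scaleR w w')
    then have "w' = w" using ex1 w by blast
    then show "T (u t) = u t"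
      unfolding u_def T.scaleR using w' by (metis)
  qed
qed

section \<open>Curves of decaying functions\<close>

text \<open>Continuity in time is strengthened to a Lipschitz condition with respect to the
  weighted supremum norm: this is what solutions satisfy, and it passes through products and
  integrals with pointwise estimates only.\<close>

definition decaying_curve :: "spatial_domain \<Rightarrow> (real \<Rightarrow> real \<Rightarrow> real) \<Rightarrow> bool" where
  "decaying_curve M u \<longleftrightarrow>
     (\<forall>T. \<exists>C. (\<forall>t\<in>{0..T}. decaying M C (u t)) \<and>
        (\<forall>t\<in>{0..T}. \<forall>t'\<in>{0..T}. \<forall>x. \<bar>u t x - u t' x\<bar> \<le> C * \<bar>t - t'\<bar> * rho M x))"

lemma decaying_mono: "decaying M C f \<Longrightarrow> C \<le> D \<Longrightarrow> decaying M D f"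
  unfolding decaying_def dominated_def by (meson mult_right_mono order_trans rho_nonneg)

lemma decaying_curveE:
  assumes "decaying_curve M u"
  obtains C where "0 \<le> C" "\<And>t. 0 \<le> t \<Longrightarrow> t \<le> T \<Longrightarrow> decaying M C (u t)"
    "\<And>t t' x. 0 \<le> t \<Longrightarrow> t \<le> T \<Longrightarrow> 0 \<le> t' \<Longrightarrow> t' \<le> T \<Longrightarrow> \<bar>u t x - u t' x\<bar> \<le> C * \<bar>t - t'\<bar> * rho M x"
proof -
  obtain C where C: "\<forall>t\<in>{0..T}. decaying M C (u t)"
    "\<forall>t\<in>{0..T}. \<forall>t'\<in>{0..T}. \<forall>x. \<bar>u t x - u t' x\<bar> \<le> C * \<bar>t - t'\<bar> * rho M x"
    using assms unfolding decaying_curve_def by blast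
  show ?thesis
  proof (rule that[of "max 0 C"])
    show "\<bar>u t x - u t' x\<bar> \<le> max 0 C * \<bar>t - t'\<bar> * rho M x"
      if "0 \<le> t" "t \<le> T" "0 \<le> t'" "t' \<le> T" for t t' x
    proof -
      have "C * \<bar>t - t'\<bar> * rho M x \<le> max 0 C * \<bar>t - t'\<bar> * rho M x"
        by (intro mult_right_mono) auto
      then show ?thesis using C(2) that by (meson atLeastAtMost_iff order_trans)
    qed
  qed (use C(1) decaying_mono[of M C _ "max 0 C"] in auto)
qed

lemma decaying_curveI:
  assumes "\<And>T. 0 \<le> T \<Longrightarrow> \<exists>C D. (\<forall>t\<in>{0..T}. decaying M C (u t)) \<and>
        (\<forall>t\<in>{0..T}. \<forall>t'\<in>{0..T}. \<forall>x. \<bar>u t x - u t' x\<bar> \<le> D * \<bar>t - t'\<bar> * rho M x)"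
  shows "decaying_curve M u"
  unfolding decaying_curve_def
proof
  fix T :: real
  obtain C D where C: "\<forall>t\<in>{0..max 0 T}. decaying M C (u t)"
    "\<forall>t\<in>{0..max 0 T}. \<forall>t'\<in>{0..max 0 T}. \<forall>x. \<bar>u t x - u t' x\<bar> \<le> D * \<bar>t - t'\<bar> * rho M x"
    using assms[of "max 0 T"] by auto
  have le: "D * \<bar>t - t'\<bar> * rho M x \<le> max C D * \<bar>t - t'\<bar> * rho M x" for t t' x
    by (intro mult_right_mono) auto
  have "decaying M (max C D) (u t)" if "t \<in> {0..T}" for t
    by (rule decaying_mono[of M C]) (use C(1) that in auto)
  moreover have "\<bar>u t x - u t' x\<bar> \<le> max C D * \<bar>t - t'\<bar> * rho M x" if "t \<in> {0..T}" "t' \<in> {0..T}" for t t' x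
    using C(2) that by (intro order.trans[OF _ le]) auto
  ultimately show "\<exists>C. (\<forall>t\<in>{0..T}. decaying M C (u t)) \<and>
        (\<forall>t\<in>{0..T}. \<forall>t'\<in>{0..T}. \<forall>x. \<bar>u t x - u t' x\<bar> \<le> C * \<bar>t - t'\<bar> * rho M x)"
    by blast
qed

lemma decaying_curveD: "decaying_curve M u \<Longrightarrow> 0 \<le> t \<Longrightarrow> \<exists>C. decaying M C (u t)"
  by (metis decaying_curveE order_refl)

lemma decaying_curve_const: "decaying M C a \<Longrightarrow> decaying_curve M (\<lambda>t. a)"
  by (rule decaying_curveI, rule exI[of _ C], rule exI[of _ 0]) auto

lemma decaying_curve_cong:
  assumes eq: "\<And>t x. 0 \<le> t \<Longrightarrow> u t x = v t x" and u: "decaying_curve M u"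
  shows "decaying_curve M v"
proof (rule decaying_curveI)
  fix T :: real
  obtain C where C: "\<And>t. 0 \<le> t \<Longrightarrow> t \<le> T \<Longrightarrow> decaying M C (u t)"
    "\<And>t t' x. 0 \<le> t \<Longrightarrow> t \<le> T \<Longrightarrow> 0 \<le> t' \<Longrightarrow> t' \<le> T \<Longrightarrow> \<bar>u t x - u t' x\<bar> \<le> C * \<bar>t - t'\<bar> * rho M x"
    using decaying_curveE[OF u] by metis
  have "u t = v t" if "0 \<le> t" for t using eq that by auto
  then show "\<exists>C D. (\<forall>t\<in>{0..T}. decaying M C (v t)) \<and>
        (\<forall>t\<in>{0..T}. \<forall>t'\<in>{0..T}. \<forall>x. \<bar>v t x - v t' x\<bar> \<le> D * \<bar>t - t'\<bar> * rho M x)"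
    using C by (intro exI[of _ C]) (metis atLeastAtMost_iff)
qed

lemma dominated_lipschitz_comp:
  assumes "dominated M C f" and "\<And>r s. \<bar>G r - G s\<bar> \<le> L * \<bar>r - s\<bar>" and "G 0 = 0" and "0 \<le> L"
  shows "dominated M (L * C) (\<lambda>x. G (f x))"
proof -
  have "continuous_on UNIV G"
    using assms(2,4) by (intro lipschitz_on_continuous_on[of L] lipschitz_onI) (auto simp: dist_real_def)
  moreover have "\<bar>G (f x)\<bar> \<le> L * C * rho M x" for x
    using assms(2)[of "f x" 0] assms(3) mult_left_mono[OF dominatedD(2)[OF assms(1), of x] assms(4)] by simp
  ultimately show ?thesis
    using assms(1) by (auto simp: dominated_def intro: continuous_on_compose2)
qed

lemma decaying_lipschitz_comp:
  assumes "decaying M C f" and "\<And>r s. \<bar>G r - G s\<bar> \<le> L * \<bar>r - s\<bar>" and "G 0 = 0" and "0 \<le> L"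
  shows "decaying M (L * C) (\<lambda>x. G (f x))"
  using dominated_lipschitz_comp[OF decayingD(5)[OF assms(1)] assms(2-4)] assms(1)
  by (auto simp: decaying_def function_on_def split: spatial_domain.splits)

lemma decaying_add: "decaying M C f \<Longrightarrow> decaying M D g \<Longrightarrow> decaying M (C + D) (\<lambda>x. f x + g x)"
  unfolding decaying_def dominated_def function_on_def
  by (auto intro!: continuous_intros order.trans[OF abs_triangle_ineq] simp: add_mono distrib_right
      split: spatial_domain.splits)

lemma decaying_mult:
  assumes "decaying M C f" "decaying M D g" shows "decaying M (C * D) (\<lambda>x. f x * g x)"
proof -
  have "\<bar>f x * g x\<bar> \<le> C * D * rho M x" for x
  proof -
    have D: "\<bar>g x\<bar> \<le> D"
      using decayingD(3)[OF assms(2), of x] mult_left_mono[OF rho_le_1 decaying_const_nonneg[OF assms(2)], of M x]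
      by linarith
    have "\<bar>f x\<bar> * \<bar>g x\<bar> \<le> (C * rho M x) * D"
      using decayingD(3)[OF assms(1), of x] D by (intro mult_mono) auto
    then show ?thesis by (simp add: abs_mult mult_ac)
  qed
  with assms show ?thesis
    by (auto simp: decaying_def dominated_def function_on_def intro!: continuous_intros split: spatial_domain.splits)
qed

lemma decaying_curve_lipschitz_comp:
  assumes u: "decaying_curve M u" and "\<And>r s. \<bar>G r - G s\<bar> \<le> L * \<bar>r - s\<bar>" "G 0 = 0" "0 \<le> L"
  shows "decaying_curve M (\<lambda>t x. G (u t x))"
proof (rule decaying_curveI)
  fix T :: real
  obtain C where C: "\<And>t. 0 \<le> t \<Longrightarrow> t \<le> T \<Longrightarrow> decaying M C (u t)"
    "\<And>t t' x. 0 \<le> t \<Longrightarrow> t \<le> T \<Longrightarrow> 0 \<le> t' \<Longrightarrow> t' \<le> T \<Longrightarrow> \<bar>u t x - u t' x\<bar> \<le> C * \<bar>t - t'\<bar> * rho M x"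
    using decaying_curveE[OF u] by metis
  have "\<bar>G (u t x) - G (u t' x)\<bar> \<le> (L * C) * \<bar>t - t'\<bar> * rho M x"
    if "0 \<le> t" "t \<le> T" "0 \<le> t'" "t' \<le> T" for t t' x
    using order.trans[OF assms(2) mult_left_mono[OF C(2)[OF that] assms(4)]] by (simp add: mult_ac)
  then show "\<exists>C D. (\<forall>t\<in>{0..T}. decaying M C (\<lambda>x. G (u t x))) \<and>
        (\<forall>t\<in>{0..T}. \<forall>t'\<in>{0..T}. \<forall>x. \<bar>G (u t x) - G (u t' x)\<bar> \<le> D * \<bar>t - t'\<bar> * rho M x)"
    using decaying_lipschitz_comp[OF C(1) assms(2-4)] by (intro exI[of _ "L * C"]) auto
qed

lemma decaying_curve_scale: "decaying_curve M u \<Longrightarrow> decaying_curve M (\<lambda>t x. c * u t x)"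
  by (rule decaying_curve_lipschitz_comp[where L = "\<bar>c\<bar>"])
    (auto simp: abs_mult right_diff_distrib[symmetric])

lemma decaying_curve_add:
  assumes "decaying_curve M u" "decaying_curve M v"
  shows "decaying_curve M (\<lambda>t x. u t x + v t x)"
proof (rule decaying_curveI)
  fix T :: real
  obtain C where C: "\<And>t. 0 \<le> t \<Longrightarrow> t \<le> T \<Longrightarrow> decaying M C (u t)"
    "\<And>t t' x. 0 \<le> t \<Longrightarrow> t \<le> T \<Longrightarrow> 0 \<le> t' \<Longrightarrow> t' \<le> T \<Longrightarrow> \<bar>u t x - u t' x\<bar> \<le> C * \<bar>t - t'\<bar> * rho M x"
    using decaying_curveE[OF assms(1)] by metis
  obtain D where D: "\<And>t. 0 \<le> t \<Longrightarrow> t \<le> T \<Longrightarrow> decaying M D (v t)"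
    "\<And>t t' x. 0 \<le> t \<Longrightarrow> t \<le> T \<Longrightarrow> 0 \<le> t' \<Longrightarrow> t' \<le> T \<Longrightarrow> \<bar>v t x - v t' x\<bar> \<le> D * \<bar>t - t'\<bar> * rho M x"
    using decaying_curveE[OF assms(2)] by metis
  have "\<bar>u t x + v t x - (u t' x + v t' x)\<bar> \<le> (C + D) * \<bar>t - t'\<bar> * rho M x"
    if "0 \<le> t" "t \<le> T" "0 \<le> t'" "t' \<le> T" for t t' x
    using C(2)[OF that, of x] D(2)[OF that, of x] by (simp add: distrib_right)
  then show "\<exists>C D. (\<forall>t\<in>{0..T}. decaying M C (\<lambda>x. u t x + v t x)) \<and>
        (\<forall>t\<in>{0..T}. \<forall>t'\<in>{0..T}. \<forall>x. \<bar>u t x + v t x - (u t' x + v t' x)\<bar> \<le> D * \<bar>t - t'\<bar> * rho M x)"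
    using decaying_add[OF C(1) D(1)] by (intro exI[of _ "C + D"]) auto
qed

lemma decaying_curve_mult:
  assumes "decaying_curve M u" "decaying_curve M v"
  shows "decaying_curve M (\<lambda>t x. u t x * v t x)"
proof (rule decaying_curveI)
  fix T :: real
  obtain C where C: "0 \<le> C" "\<And>t. 0 \<le> t \<Longrightarrow> t \<le> T \<Longrightarrow> decaying M C (u t)"
    "\<And>t t' x. 0 \<le> t \<Longrightarrow> t \<le> T \<Longrightarrow> 0 \<le> t' \<Longrightarrow> t' \<le> T \<Longrightarrow> \<bar>u t x - u t' x\<bar> \<le> C * \<bar>t - t'\<bar> * rho M x"
    using decaying_curveE[OF assms(1)] by metis
  obtain D where D: "0 \<le> D" "\<And>t. 0 \<le> t \<Longrightarrow> t \<le> T \<Longrightarrow> decaying M D (v t)"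
    "\<And>t t' x. 0 \<le> t \<Longrightarrow> t \<le> T \<Longrightarrow> 0 \<le> t' \<Longrightarrow> t' \<le> T \<Longrightarrow> \<bar>v t x - v t' x\<bar> \<le> D * \<bar>t - t'\<bar> * rho M x"
    using decaying_curveE[OF assms(2)] by metis
  have le: "B * rho M x \<le> B" if "0 \<le> B" for B x
    using mult_left_mono[OF rho_le_1 that] by simp
  have "\<bar>u t x * v t x - u t' x * v t' x\<bar> \<le> (2 * C * D) * \<bar>t - t'\<bar> * rho M x"
    if "0 \<le> t" "t \<le> T" "0 \<le> t'" "t' \<le> T" for t t' x
  proof -
    have "\<bar>u t x * v t x - u t' x * v t' x\<bar> = \<bar>(u t x - u t' x) * v t x + u t' x * (v t x - v t' x)\<bar>"
      by (simp add: algebra_simps)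
    also have "\<dots> \<le> \<bar>u t x - u t' x\<bar> * \<bar>v t x\<bar> + \<bar>u t' x\<bar> * \<bar>v t x - v t' x\<bar>"
      using abs_triangle_ineq by (simp add: abs_mult[symmetric])
    also have "\<dots> \<le> (C * \<bar>t - t'\<bar> * rho M x) * D + C * (D * \<bar>t - t'\<bar> * rho M x)"
      using C(3)[OF that, of x] D(3)[OF that, of x] order.trans[OF decayingD(3)[OF D(2)[OF that(1,2)]] le[OF D(1)]]
        order.trans[OF decayingD(3)[OF C(2)[OF that(3,4)]] le[OF C(1)]] C(1) D(1)
      by (intro add_mono mult_mono) auto
    finally show ?thesis by (simp add: mult_ac)
  qed
  then show "\<exists>C D. (\<forall>t\<in>{0..T}. decaying M C (\<lambda>x. u t x * v t x)) \<and>
        (\<forall>t\<in>{0..T}. \<forall>t'\<in>{0..T}. \<forall>x. \<bar>u t x * v t x - u t' x * v t' x\<bar> \<le> D * \<bar>t - t'\<bar> * rho M x)"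
    using decaying_mult[OF C(2) D(2)] by (intro exI[of _ "C * D"] exI[of _ "2 * C * D"]) auto
qed

lemma decaying_curve_resolvent:
  assumes "decaying_curve M u"
  shows "decaying_curve M (\<lambda>t. resolvent (u t))" and "decaying_curve M (\<lambda>t. resolvent_dx (u t))"
proof -
  have "\<exists>C D. (\<forall>t\<in>{0..T}. decaying M C (R (u t))) \<and>
        (\<forall>t\<in>{0..T}. \<forall>t'\<in>{0..T}. \<forall>x. \<bar>R (u t) x - R (u t') x\<bar> \<le> D * \<bar>t - t'\<bar> * rho M x)"
    if R: "\<And>C f. decaying M C f \<Longrightarrow> decaying M (2 * C) (R f)"
      "\<And>C f D g x. decaying M C f \<Longrightarrow> decaying M D g \<Longrightarrow> R (\<lambda>x. f x - g x) x = R f x - R g x" for R T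
  proof -
    obtain C where C: "\<And>t. 0 \<le> t \<Longrightarrow> t \<le> T \<Longrightarrow> decaying M C (u t)"
      "\<And>t t' x. 0 \<le> t \<Longrightarrow> t \<le> T \<Longrightarrow> 0 \<le> t' \<Longrightarrow> t' \<le> T \<Longrightarrow> \<bar>u t x - u t' x\<bar> \<le> C * \<bar>t - t'\<bar> * rho M x"
      using decaying_curveE[OF assms] by metis
    have "\<bar>R (u t) x - R (u t') x\<bar> \<le> (2 * C) * \<bar>t - t'\<bar> * rho M x"
      if "0 \<le> t" "t \<le> T" "0 \<le> t'" "t' \<le> T" for t t' x
      using R(2)[OF C(1)[OF that(1,2)] C(1)[OF that(3,4)], of x]
        decayingD(3)[OF R(1)[OF decaying_diff[OF C(1)[OF that(1,2)] C(1)[OF that(3,4)] C(2)[OF that]]], of x]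
      by (simp add: mult_ac)
    then show ?thesis
      using R(1)[OF C(1)] by (intro exI[of _ "2 * C"]) auto
  qed
  then show "decaying_curve M (\<lambda>t. resolvent (u t))" "decaying_curve M (\<lambda>t. resolvent_dx (u t))"
    using decaying_resolvent decaying_resolvent_dx resolvent_diff[OF decayingD(5) decayingD(5)]
    by (auto intro!: decaying_curveI)
qed

context
  fixes M u assumes u: "decaying_curve M u"
begin

text \<open>Joint continuity, as required for differentiation under a time integral: the curve is
  continuous in \<open>x\<close> at each time and Lipschitz in time uniformly in
  \<open>x\<close>.\<close>

lemma decaying_curve_continuous_pair: "continuous_on (UNIV \<times> {0..T}) (\<lambda>(x, s). u s x)"
proof -
  obtain C where C: "0 \<le> C" "\<And>t. 0 \<le> t \<Longrightarrow> t \<le> T \<Longrightarrow> decaying M C (u t)"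
    "\<And>t t' x. 0 \<le> t \<Longrightarrow> t \<le> T \<Longrightarrow> 0 \<le> t' \<Longrightarrow> t' \<le> T \<Longrightarrow> \<bar>u t x - u t' x\<bar> \<le> C * \<bar>t - t'\<bar> * rho M x"
    using decaying_curveE[OF u] by metis
  have "((\<lambda>(x, s). u s x) \<longlongrightarrow> u s0 x0) (at (x0, s0) within UNIV \<times> {0..T})"
    if s0: "0 \<le> s0" "s0 \<le> T" for x0 s0
  proof -
    let ?F = "at (x0, s0) within UNIV \<times> {0..T}"
    have "isCont (u s0) x0"
      using decayingD(1)[OF C(2)[OF s0]] by (simp add: continuous_on_eq_continuous_at)
    then have "((\<lambda>p. u s0 (fst p)) \<longlongrightarrow> u s0 x0) ?F"
      by (rule isCont_tendsto_compose) (use tendsto_fst[OF tendsto_ident_at] in fastforce)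
    then have l1: "((\<lambda>p. u s0 (fst p) - u s0 x0) \<longlongrightarrow> 0) ?F"
      by (simp add: LIM_zero_iff)
    have "(snd \<longlongrightarrow> s0) ?F"
      using tendsto_snd[OF tendsto_ident_at[of "(x0, s0)" "UNIV \<times> {0..T}"]] by simp
    then have "((\<lambda>p. C * \<bar>snd p - s0\<bar>) \<longlongrightarrow> C * \<bar>s0 - s0\<bar>) ?F"
      by (intro tendsto_intros)
    then have l0: "((\<lambda>p. C * \<bar>snd p - s0\<bar>) \<longlongrightarrow> 0) ?F" by simp
    have l2: "((\<lambda>p. u (snd p) (fst p) - u s0 (fst p)) \<longlongrightarrow> 0) ?F"
    proof (rule Lim_null_comparison[OF _ l0])
      show "\<forall>\<^sub>F p in ?F. norm (u (snd p) (fst p) - u s0 (fst p)) \<le> C * \<bar>snd p - s0\<bar>"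
        unfolding eventually_at_filter
      proof (intro always_eventually allI impI)
        fix p assume "p \<noteq> (x0, s0)" "p \<in> UNIV \<times> {0..T}"
        then have "\<bar>u (snd p) (fst p) - u s0 (fst p)\<bar> \<le> C * \<bar>snd p - s0\<bar> * rho M (fst p)"
          using s0 by (intro C(3)) auto
        also have "\<dots> \<le> C * \<bar>snd p - s0\<bar>"
          using mult_left_mono[OF rho_le_1, of "C * \<bar>snd p - s0\<bar>"] C(1) by simp
        finally show "norm (u (snd p) (fst p) - u s0 (fst p)) \<le> C * \<bar>snd p - s0\<bar>" by simp
      qed
    qed
    have "((\<lambda>p. u (snd p) (fst p) - u s0 x0) \<longlongrightarrow> 0) ?F"
      using tendsto_add[OF l1 l2] by simp
    then show ?thesis by (simp add: LIM_zero_iff case_prod_beta')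
  qed
  then show ?thesis
    unfolding continuous_on_def by auto
qed

lemma decaying_curve_continuous_time: "continuous_on {0..} (\<lambda>s. u s x)"
proof -
  have "continuous_on {0..T} ((\<lambda>(x, s). u s x) \<circ> (\<lambda>s. (x, s)))" for T
    by (intro continuous_on_compose continuous_intros continuous_on_subset[OF decaying_curve_continuous_pair[of T]]) auto
  then have "continuous_on {0..T} (\<lambda>s. u s x)" for T
    by (simp add: o_def)
  then show ?thesis
    unfolding continuous_on_eq_continuous_within
  proof (intro ballI)
    fix t :: real assume t: "t \<in> {0..}" and c: "\<And>T. \<forall>t\<in>{0..T}. continuous (at t within {0..T}) (\<lambda>s. u s x)"
    have "at t within {0..t+1} = at t within {0..}"
      using t by (intro at_within_nhd[of t "{..<t+1}"]) auto
    then show "continuous (at t within {0..}) (\<lambda>s. u s x)"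
      using bspec[OF c[of "t + 1"], of t] t by (metis add_increasing2 atLeastAtMost_iff atLeast_iff less_add_one less_imp_le zero_le_one)
  qed
qed

lemma decaying_curve_integrable_time: "(\<lambda>s. u s x) integrable_on {0..T}"
  by (intro integrable_continuous_interval continuous_on_subset[OF decaying_curve_continuous_time]) auto

lemma time_integral_derivative:
  "0 \<le> t \<Longrightarrow> ((\<lambda>\<tau>. integral {0..\<tau>} (\<lambda>s. u s x)) has_real_derivative u t x) (at t within {0..})"
  unfolding has_real_derivative_iff_has_vector_derivative
  by (rule indefinite_integral_derivative[OF decaying_curve_continuous_time])

end

lemma time_integral_x_derivative:
  assumes "decaying_curve M u" "decaying_curve M v"
    and "\<And>t x. 0 \<le> t \<Longrightarrow> (u t has_real_derivative v t x) (at x)"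
  shows "((\<lambda>x. integral {0..t} (\<lambda>s. u s x)) has_real_derivative integral {0..t} (\<lambda>s. v s x)) (at x)"
  unfolding cbox_interval[symmetric]
  by (rule leibniz_rule_field_derivative[where U = UNIV and fx = "\<lambda>x s. v s x"])
    (use assms decaying_curve_continuous_pair[OF assms(2), of t] decaying_curve_integrable_time[OF assms(1)] in auto)

lemma decaying_curve_integral:
  assumes u: "decaying_curve M u"
  shows "decaying_curve M (\<lambda>t x. integral {0..t} (\<lambda>s. u s x))"
proof (rule decaying_curveI)
  fix T :: real assume T: "0 \<le> T"
  obtain C where C: "0 \<le> C" "\<And>t. 0 \<le> t \<Longrightarrow> t \<le> T \<Longrightarrow> decaying M C (u t)"
    using decaying_curveE[OF u] by metis
  have bound: "\<bar>integral {a..b} (\<lambda>s. u s x)\<bar> \<le> C * (b - a) * rho M x" if "0 \<le> a" "a \<le> b" "b \<le> T" for a b x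
  proof -
    have "norm (integral {a..b} (\<lambda>s. u s x)) \<le> C * rho M x * (b - a)"
      using that decayingD(3)[OF C(2)]
      by (intro integral_bound continuous_on_subset[OF decaying_curve_continuous_time[OF u]]) auto
    then show ?thesis by (simp add: mult_ac)
  qed
  have diff: "integral {0..b} (\<lambda>s. u s x) - integral {0..a} (\<lambda>s. u s x) = integral {a..b} (\<lambda>s. u s x)"
    if "0 \<le> a" "a \<le> b" for a b x
    using Henstock_Kurzweil_Integration.integral_combine[OF that decaying_curve_integrable_time[OF u, where x = x]] by linarith
  have "continuous_on UNIV (\<lambda>x. integral {0..t} (\<lambda>s. u s x))" for t
    unfolding cbox_interval[symmetric]
    using integral_continuous_on_param[of UNIV 0 t "\<lambda>x s. u s x"] decaying_curve_continuous_pair[OF u, of t] by simp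
  moreover have "function_on M (\<lambda>x. integral {0..t} (\<lambda>s. u s x))" if "t \<le> T" for t
  proof (cases M)
    case Torus
    have "u s (x + 2 * pi) = u s x" if "s \<in> {0..t}" for s x
      using decayingD(2)[OF C(2)[of s]] that \<open>t \<le> T\<close> unfolding function_on_def Torus by auto
    then show ?thesis
      unfolding function_on_def Torus spatial_domain.case by (intro allI integral_cong) auto
  qed (simp add: function_on_def)
  moreover have "\<bar>integral {0..t} (\<lambda>s. u s x)\<bar> \<le> C * T * rho M x" if "0 \<le> t" "t \<le> T" for t x
  proof -
    have "C * (t - 0) * rho M x \<le> C * T * rho M x"
      using that C(1) by (intro mult_right_mono mult_left_mono) auto
    then show ?thesis using bound[of 0 t x] that by linarith
  qed
  moreover have "\<bar>integral {0..t} (\<lambda>s. u s x) - integral {0..t'} (\<lambda>s. u s x)\<bar> \<le> C * \<bar>t - t'\<bar> * rho M x"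
    if "0 \<le> t" "t \<le> T" "0 \<le> t'" "t' \<le> T" for t t' x
    using that bound[of t t' x] bound[of t' t x] diff[of t t' x] diff[of t' t x]
    by (cases "t \<le> t'") (auto simp: abs_minus_commute)
  ultimately show "\<exists>C D. (\<forall>t\<in>{0..T}. decaying M C (\<lambda>x. integral {0..t} (\<lambda>s. u s x))) \<and>
        (\<forall>t\<in>{0..T}. \<forall>t'\<in>{0..T}. \<forall>x. \<bar>integral {0..t} (\<lambda>s. u s x) - integral {0..t'} (\<lambda>s. u s x)\<bar> \<le> D * \<bar>t - t'\<bar> * rho M x)"
    by (intro exI[of _ "C * T"] exI[of _ C]) (auto simp: decaying_def dominated_def)
qed

lemma real_derivative_of_quadratic_error:
  fixes f :: "real \<Rightarrow> real"
  assumes "0 \<le> t" and "\<And>t'. 0 \<le> t' \<Longrightarrow> t' \<le> t + 1 \<Longrightarrow> \<bar>f t' - f t - (t' - t) * D\<bar> \<le> B * (t' - t)\<^sup>2"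
  shows "(f has_real_derivative D) (at t within {0..})"
  unfolding has_field_derivative_iff
proof (rule LIM_zero_cancel, rule Lim_null_comparison)
  show "((\<lambda>y. B * \<bar>y - t\<bar>) \<longlongrightarrow> 0) (at t within {0..})"
    by (auto intro!: tendsto_eq_intros)
  have "\<forall>\<^sub>F y in at t within {0..}. y \<in> {..<t + 1}"
    by (rule eventually_at_topological[THEN iffD2], rule exI[of _ "{..<t + 1}"]) auto
  moreover have "\<forall>\<^sub>F y in at t within {0..}. y \<in> {0..} \<and> y \<noteq> t"
    by (auto simp: eventually_at_filter)
  ultimately show "\<forall>\<^sub>F y in at t within {0..}. norm ((f y - f t) / (y - t) - D) \<le> B * \<bar>y - t\<bar>"
  proof eventually_elim
    case (elim y)
    have "(f y - f t) / (y - t) - D = (f y - f t - (y - t) * D) / (y - t)"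
      using elim by (simp add: field_simps)
    also have "norm \<dots> = \<bar>f y - f t - (y - t) * D\<bar> / \<bar>y - t\<bar>" by simp
    also have "\<dots> \<le> B * (y - t)\<^sup>2 / \<bar>y - t\<bar>"
      using elim by (intro divide_right_mono assms) auto
    also have "\<dots> = B * \<bar>y - t\<bar>"
      using elim by (simp add: field_simps power2_eq_square abs_if)
    finally show ?case .
  qed
qed

text \<open>Differentiation under the integral over the domain. As \<open>v\<close> is Lipschitz
  in time, the remainder of the first-order expansion of \<open>u\<close> is bounded by \<open>C
  (t' - t)\<^sup>2 rho\<close>, which can be integrated.\<close>

lemma cell_integral_time_derivative:
  assumes u: "decaying_curve M u" and v: "decaying_curve M v"
    and deriv: "\<And>t x. 0 \<le> t \<Longrightarrow> ((\<lambda>\<tau>. u \<tau> x) has_real_derivative v t x) (at t within {0..})"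
    and q: "continuous_on UNIV q" "\<And>x. \<bar>q x\<bar> \<le> Q" and t: "0 \<le> t"
  shows "((\<lambda>\<tau>. LINT x:cell M|lborel. q x * u \<tau> x) has_real_derivative (LINT x:cell M|lborel. q x * v t x)) (at t within {0..})"
proof -
  obtain C where C: "0 \<le> C" "\<And>s. 0 \<le> s \<Longrightarrow> s \<le> t + 1 \<Longrightarrow> decaying M C (v s)"
    "\<And>s s' x. 0 \<le> s \<Longrightarrow> s \<le> t + 1 \<Longrightarrow> 0 \<le> s' \<Longrightarrow> s' \<le> t + 1 \<Longrightarrow> \<bar>v s x - v s' x\<bar> \<le> C * \<bar>s - s'\<bar> * rho M x"
    using decaying_curveE[OF v] by metis
  have Q: "0 \<le> Q" using order.trans[OF abs_ge_zero q(2)] .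
  have int: "set_integrable lborel (cell M) (\<lambda>x. q x * w s x)" if w: "decaying_curve M w" and s: "0 \<le> s" for w s
  proof -
    obtain B where B: "decaying M B (w s)" using decaying_curveD[OF w s] by blast
    show ?thesis
    proof (rule integrable_of_rho_bound)
      show "norm (q x * w s x) \<le> (Q * B) * rho M x" for x
        using mult_mono[OF q(2)[of x] decayingD(3)[OF B, of x] Q abs_ge_zero] by (simp add: abs_mult mult_ac)
    qed (auto intro!: borel_measurable_continuous_onI continuous_intros q(1) decayingD(1)[OF B])
  qed
  show ?thesis
  proof (rule real_derivative_of_quadratic_error[OF t])
    fix t' assume t': "0 \<le> t'" "t' \<le> t + 1"
    have pt: "\<bar>u t' x - u t x - (t' - t) * v t x\<bar> \<le> C * (t' - t)\<^sup>2 * rho M x" for x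
    proof -
      let ?S = "{min t t'..max t t'}"
      have "norm ((u t' x - t' * v t x) - (u t x - t * v t x)) \<le> (C * \<bar>t' - t\<bar> * rho M x) * norm (t' - t)"
      proof (rule field_differentiable_bound[of ?S "\<lambda>s. u s x - s * v t x" "\<lambda>s. v s x - v t x"])
        fix s assume s: "s \<in> ?S"
        then have s0: "0 \<le> s" "s \<le> t + 1" using t t' by auto
        show "((\<lambda>s. u s x - s * v t x) has_real_derivative v s x - v t x) (at s within ?S)"
          using t t' by (auto intro!: derivative_eq_intros has_field_derivative_subset[OF deriv[OF s0(1)]])
        have "\<bar>v s x - v t x\<bar> \<le> C * \<bar>s - t\<bar> * rho M x"
          using C(3)[OF s0 t, of x] by simp
        also have "\<dots> \<le> C * \<bar>t' - t\<bar> * rho M x"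
          using s C(1) by (intro mult_right_mono mult_left_mono) auto
        finally show "norm (v s x - v t x) \<le> C * \<bar>t' - t\<bar> * rho M x" by simp
      qed auto
      also have "\<dots> = C * (t' - t)\<^sup>2 * rho M x"
        by (simp add: power2_eq_square abs_mult_self_eq mult_ac flip: abs_mult)
      finally show ?thesis by (simp add: algebra_simps)
    qed
    let ?r = "\<lambda>x. q x * u t' x - q x * u t x - (t' - t) * (q x * v t x)"
    have "norm (LINT x:cell M|lborel. ?r x) \<le> (Q * (C * (t' - t)\<^sup>2)) * rho_mass M"
    proof (rule integral_of_rho_bound)
      have "?r x = q x * (u t' x - u t x - (t' - t) * v t x)" for x by (simp add: algebra_simps)
      then show "norm (?r x) \<le> (Q * (C * (t' - t)\<^sup>2)) * rho M x" for x
        using mult_mono[OF q(2)[of x] pt[of x] Q abs_ge_zero] by (simp add: abs_mult mult_ac)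
      show "?r \<in> borel_measurable borel"
        using decaying_curveD[OF u t] decaying_curveD[OF u t'(1)] decaying_curveD[OF v t]
        by (intro borel_measurable_continuous_onI continuous_intros q(1)) (metis decayingD(1))+
    qed
    also have "(LINT x:cell M|lborel. ?r x) =
        (LINT x:cell M|lborel. q x * u t' x) - (LINT x:cell M|lborel. q x * u t x) - (t' - t) * (LINT x:cell M|lborel. q x * v t x)"
      using int[OF u t'(1)] int[OF u t] int[OF v t] by (simp add: set_integral_diff)
    finally show "\<bar>(LINT x:cell M|lborel. q x * u t' x) - (LINT x:cell M|lborel. q x * u t x)
        - (t' - t) * (LINT x:cell M|lborel. q x * v t x)\<bar> \<le> (Q * C * rho_mass M) * (t' - t)\<^sup>2"
      by (simp add: mult_ac)
  qed
qed

section \<open>The truncated equation\<close>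

text \<open>The class \<open>banach\<close> is the combination of two classes of which this type
  already is an instance.\<close>

instance bcontfun :: (metric_space, banach) banach ..

lemma resolvent_dx_translate: "resolvent_dx (\<lambda>y. f (y + c)) x = resolvent_dx f (x + c)"
proof -
  have e: "x - z + c = x + c - z" "x + z + c = x + c + z" for z by simp_all
  show ?thesis unfolding resolvent_dx_def bwd_def fwd_def e ..
qed

lemma bounded_linear_apply_bcontfun:
  "bounded_linear (\<lambda>v :: real \<Rightarrow>\<^sub>C real. apply_bcontfun v x * r)"
proof (rule bounded_linear_intro)
  show "norm (apply_bcontfun v x * r) \<le> norm v * \<bar>r\<bar>" for v :: "real \<Rightarrow>\<^sub>C real"
    using norm_bounded[of v x] by (simp add: abs_mult mult_right_mono)
qed (simp_all add: algebra_simps)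

lemma lipschitz_of_vector_derivative:
  fixes w :: "real \<Rightarrow> 'a::real_normed_vector"
  assumes "\<And>s. 0 \<le> s \<Longrightarrow> (w has_vector_derivative w' s) (at s within {0..})"
    and "\<And>s. 0 \<le> s \<Longrightarrow> s \<le> T \<Longrightarrow> norm (w' s) \<le> B"
    and "0 \<le> t" "t \<le> T" "0 \<le> t'" "t' \<le> T"
  shows "norm (w t - w t') \<le> B * \<bar>t - t'\<bar>"
proof -
  have "norm (w t - w t') \<le> B * norm (t - t')"
  proof (rule differentiable_bound[of "{0..T}" w "\<lambda>s h. h *\<^sub>R w' s"])
    fix s assume s: "s \<in> {0..T}"
    have "(w has_vector_derivative w' s) (at s within {0..T})"
      using has_vector_derivative_within_subset[OF assms(1)] s by auto
    then show "(w has_derivative (\<lambda>h. h *\<^sub>R w' s)) (at s within {0..T})"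
      by (simp add: has_vector_derivative_def)
    show "onorm (\<lambda>h. h *\<^sub>R w' s) \<le> B"
    proof (rule onorm_bound)
      show "norm (h *\<^sub>R w' s) \<le> B * norm h" for h
        using mult_left_mono[OF assms(2)[of s] abs_ge_zero[of h]] s by (simp add: mult.commute)
    qed (use order.trans[OF norm_ge_zero assms(2)[of s]] s in auto)
  qed (use assms in auto)
  then show ?thesis by simp
qed

text \<open>The unknown is \<open>u / rho\<close>, which ranges over the Banach space of bounded
  continuous functions; the decay of \<open>u\<close> is thereby built into the space. On the
  torus the solution is periodic because the equation commutes with translation by a
  period.\<close>

lemma global_lipschitz_evolution:
  fixes G :: "real \<Rightarrow> real"
  assumes a: "decaying M A a"
    and lip: "\<And>r s. \<bar>G r - G s\<bar> \<le> L * \<bar>r - s\<bar>" and L: "0 < L" and G0: "G 0 = 0"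
  obtains u where "u 0 = a" "decaying_curve M u"
    "\<And>t x. 0 \<le> t \<Longrightarrow> ((\<lambda>\<tau>. u \<tau> x) has_real_derivative - resolvent_dx (\<lambda>y. G (u t y)) x) (at t within {0..})"
proof -
  define V where "V v y = apply_bcontfun v y * rho M y" for v :: "real \<Rightarrow>\<^sub>C real" and y
  have V: "dominated M (norm v) (V v)" for v
    unfolding dominated_def V_def using norm_bounded[of v]
    by (auto intro!: continuous_intros continuous_rho mult_right_mono simp: abs_mult)
  have GV: "dominated M (L * norm v) (\<lambda>y. G (V v y))" for v
    by (rule dominated_lipschitz_comp[OF V lip G0]) (use L in simp)
  have div: "dominated M C f \<Longrightarrow> \<bar>f x / rho M x\<bar> \<le> C" for C f x
    using dominatedD(2)[of M C f x] by (simp add: divide_le_eq abs_divide)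
  have divc: "dominated M C f \<Longrightarrow> (\<lambda>x. f x / rho M x) \<in> bcontfun" for C f
    by (rule bcontfun_normI[of _ C])
      (use div in \<open>auto intro!: continuous_on_divide[OF dominatedD(1) continuous_rho]
        simp: less_imp_neq[OF rho_pos, symmetric]\<close>)
  define F where "F v = - Bcontfun (\<lambda>x. resolvent_dx (\<lambda>y. G (V v y)) x / rho M x)" for v
  have F: "apply_bcontfun (F v) x = - (resolvent_dx (\<lambda>y. G (V v y)) x / rho M x)" for v x
    unfolding F_def using Bcontfun_inverse[OF divc[OF dominated_resolvent_dx[OF GV]]] by simp
  have lipF: "norm (F v - F w) \<le> (2 * L) * norm (v - w)" for v w
  proof (rule norm_bound)
    fix x
    have "\<bar>G (V v y) - G (V w y)\<bar> \<le> L * norm (v - w) * rho M y" for y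
    proof -
      have "\<bar>G (V v y) - G (V w y)\<bar> \<le> L * \<bar>apply_bcontfun (v - w) y * rho M y\<bar>"
        using lip[of "V v y" "V w y"] by (simp add: V_def left_diff_distrib)
      also have "\<dots> \<le> L * (norm (v - w) * rho M y)"
        using L norm_bounded[of "v - w" y] by (intro mult_left_mono) (auto simp: abs_mult intro: mult_right_mono)
      finally show ?thesis by simp
    qed
    from div[OF dominated_resolvent_dx[OF dominated_diff[OF GV GV this]], of x]
    show "norm (apply_bcontfun (F v - F w) x) \<le> (2 * L) * norm (v - w)"
      by (simp add: F resolvent_diff[OF GV GV] diff_divide_distrib abs_minus_commute)
  qed
  have F_0: "norm (F v) \<le> 2 * L * norm v" for v
    by (rule norm_bound) (use div[OF dominated_resolvent_dx[OF GV]] in \<open>simp add: F mult.assoc\<close>)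
  define x0 where "x0 = Bcontfun (\<lambda>x. a x / rho M x)"
  have x0: "apply_bcontfun x0 x = a x / rho M x" for x
    unfolding x0_def using Bcontfun_inverse[OF divc[OF decayingD(5)[OF a]]] by simp
  obtain w where w0: "w 0 = x0"
    and w: "\<And>t. 0 \<le> t \<Longrightarrow> (w has_vector_derivative F (w t)) (at t within {0..})"
    and inv: "\<And>T t. bounded_linear T \<Longrightarrow> (\<And>x. T (F x) = F (T x)) \<Longrightarrow> T x0 = x0 \<Longrightarrow> 0 \<le> t \<Longrightarrow> T (w t) = w t"
    using global_lipschitz_ode[of F "2 * L" x0] lipF L by auto
  have per: "function_on M (V (w t))" if t: "0 \<le> t" for t
  proof (cases M)
    case Torus
    have tr: "(\<lambda>x. apply_bcontfun v (x + 2 * pi)) \<in> bcontfun" for v :: "real \<Rightarrow>\<^sub>C real"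
      by (rule bcontfun_normI[of _ "norm v"], rule continuous_on_compose2[OF continuous_on_apply_bcontfun[of UNIV]])
        (auto intro!: continuous_intros norm_bounded simp del: real_norm_def)
    define T where "T v = Bcontfun (\<lambda>x. apply_bcontfun v (x + 2 * pi))" for v :: "real \<Rightarrow>\<^sub>C real"
    have T: "apply_bcontfun (T v) x = apply_bcontfun v (x + 2 * pi)" for v x
      unfolding T_def using Bcontfun_inverse[OF tr] by simp
    have "T (w t) = w t"
    proof (rule inv[OF _ _ _ t])
      show "bounded_linear T"
      proof (rule bounded_linear_intro[where K = 1])
        show "norm (T v) \<le> norm v * 1" for v
          using norm_bound[of "T v" "norm v"] norm_bounded[of v] by (simp add: T)
      qed (rule bcontfun_eqI, simp add: T)+
      show "T (F v) = F (T v)" for v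
        by (rule bcontfun_eqI) (simp add: T F V_def Torus resolvent_dx_translate[of "\<lambda>y. G (apply_bcontfun v y)"])
      show "T x0 = x0"
        using decayingD(2)[OF a] by (intro bcontfun_eqI) (simp add: T x0 Torus function_on_def)
    qed
    then have "apply_bcontfun (w t) (x + 2 * pi) = apply_bcontfun (w t) x" for x
      by (metis T)
    then show ?thesis by (simp add: Torus function_on_def V_def)
  qed (simp add: function_on_def)
  show ?thesis
  proof (rule that[of "\<lambda>t. V (w t)"])
    show "V (w 0) = a" by (simp add: fun_eq_iff V_def w0 x0 less_imp_neq[OF rho_pos, symmetric])
    show "((\<lambda>\<tau>. V (w \<tau>) x) has_real_derivative - resolvent_dx (\<lambda>y. G (V (w t) y)) x) (at t within {0..})"
      if "0 \<le> t" for t x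
      using bounded_linear.has_vector_derivative[OF bounded_linear_apply_bcontfun[of x "rho M x"] w[OF that]]
      by (simp add: F V_def has_real_derivative_iff_has_vector_derivative less_imp_neq[OF rho_pos, symmetric])
    show "decaying_curve M (\<lambda>t. V (w t))"
    proof (rule decaying_curveI)
      fix T :: real assume T: "0 \<le> T"
      have "continuous_on {0..} w"
        using w has_vector_derivative_continuous by (fastforce simp: continuous_on_eq_continuous_within)
      then have "continuous_on {0..T} w"
        by (rule continuous_on_subset) auto
      then have "bounded (w ` {0..T})"
        using compact_Icc compact_continuous_image compact_imp_bounded by blast
      then obtain W where W: "\<And>t. 0 \<le> t \<Longrightarrow> t \<le> T \<Longrightarrow> norm (w t) \<le> W"
        unfolding bounded_iff by (metis atLeastAtMost_iff imageI)
      have W0: "0 \<le> W" using order.trans[OF norm_ge_zero W[of 0]] T by simp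
      have "decaying M W (V (w t))" if "0 \<le> t" "t \<le> T" for t
      proof -
        have "\<bar>V (w t) x\<bar> \<le> W * rho M x" for x
          using order.trans[OF dominatedD(2)[OF V] mult_right_mono[OF W[OF that] rho_nonneg]] .
        then show ?thesis
          using V[of "w t"] per[OF that(1)] by (simp add: decaying_def dominated_def)
      qed
      moreover have "\<bar>V (w t) x - V (w t') x\<bar> \<le> (2 * L * W) * \<bar>t - t'\<bar> * rho M x"
        if "0 \<le> t" "t \<le> T" "0 \<le> t'" "t' \<le> T" for t t' x
      proof -
        have b: "norm (F (w s)) \<le> 2 * L * W" if "0 \<le> s" "s \<le> T" for s
          using order.trans[OF F_0 mult_left_mono[OF W[OF that], of "2 * L"]] L by simp
        have "\<bar>apply_bcontfun (w t - w t') x\<bar> \<le> 2 * L * W * \<bar>t - t'\<bar>"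
          using order.trans[OF norm_bounded[of "w t - w t'" x] lipschitz_of_vector_derivative[OF w b that]] by simp
        from mult_right_mono[OF this, of "rho M x"] show ?thesis
          by (simp add: V_def abs_mult left_diff_distrib[symmetric])
      qed
      ultimately show "\<exists>C D. (\<forall>t\<in>{0..T}. decaying M C (V (w t))) \<and>
        (\<forall>t\<in>{0..T}. \<forall>t'\<in>{0..T}. \<forall>x. \<bar>V (w t) x - V (w t') x\<bar> \<le> D * \<bar>t - t'\<bar> * rho M x)"
        by (intro exI[of _ W] exI[of _ "2 * L * W"]) auto
    qed
  qed
qed

section \<open>Conservation of energy\<close>

text \<open>An antiderivative is needed only on the range of a bounded function, so the base point
  of the integral may be chosen to the left of this range.\<close>

lemma local_antiderivative:
  fixes G :: "real \<Rightarrow> real"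
  assumes lip: "\<And>r s. \<bar>G r - G s\<bar> \<le> L * \<bar>r - s\<bar>" and G0: "G 0 = 0" and B: "0 < B"
  obtains \<Phi> where "\<And>r. \<bar>r\<bar> < B \<Longrightarrow> (\<Phi> has_real_derivative G r) (at r)"
    and "\<And>r. \<bar>r\<bar> < B \<Longrightarrow> \<bar>\<Phi> r\<bar> \<le> L * B * \<bar>r\<bar>"
proof -
  have L: "0 \<le> L" using order.trans[OF abs_ge_zero lip[of 1 0]] by simp
  have cont: "continuous_on A G" for A
    using lip L by (intro lipschitz_on_continuous_on[of L] lipschitz_onI) (auto simp: dist_real_def)
  define \<Phi> where "\<Phi> r = integral {-B..r} G - integral {-B..0} G" for r
  have d: "(\<Phi> has_real_derivative G r) (at r)" if "\<bar>r\<bar> < B" for r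
  proof -
    have "((\<lambda>u. integral {-B..u} G) has_real_derivative G r) (at r within {-B..B})"
      using integral_has_vector_derivative[OF cont, of r "-B" B] that
      by (simp add: has_real_derivative_iff_has_vector_derivative abs_less_iff)
    then have "((\<lambda>u. integral {-B..u} G) has_real_derivative G r) (at r)"
      using that by (simp add: at_within_Icc_at abs_less_iff)
    then show ?thesis unfolding \<Phi>_def by (auto intro!: derivative_eq_intros)
  qed
  have "\<bar>\<Phi> r\<bar> \<le> L * B * \<bar>r\<bar>" if r: "\<bar>r\<bar> < B" for r
  proof -
    have "norm (\<Phi> r - \<Phi> 0) \<le> (L * B) * norm (r - 0)"
    proof (rule field_differentiable_bound[of "{-\<bar>r\<bar>..\<bar>r\<bar>}" \<Phi> G])
      fix s assume s: "s \<in> {-\<bar>r\<bar>..\<bar>r\<bar>}"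
      then have "\<bar>s\<bar> < B" using r by auto
      then show "(\<Phi> has_real_derivative G s) (at s within {-\<bar>r\<bar>..\<bar>r\<bar>})" "norm (G s) \<le> L * B"
        using d lip[of s 0] G0 mult_left_mono[of "\<bar>s\<bar>" B L] L
        by (auto intro: has_field_derivative_at_within)
    qed auto
    then show ?thesis by (simp add: \<Phi>_def)
  qed
  with d show ?thesis using that by blast
qed

text \<open>The equation \<open>u\<^sub>t = - K (G u)\<close> for an arbitrary nonlinearity. It is
  used for the truncated flux, for which the energy is estimated, and again for the flux of the
  BBM equation, for which smoothness is proved.\<close>

locale bbm_type_flow =
  fixes M :: spatial_domain and G :: "real \<Rightarrow> real" and u :: "real \<Rightarrow> real \<Rightarrow> real"
    and a' :: "real \<Rightarrow> real" and A' :: real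
  assumes u: "decaying_curve M u"
    and Gu: "decaying_curve M (\<lambda>t x. G (u t x))"
    and u_t: "\<And>t x. 0 \<le> t \<Longrightarrow> ((\<lambda>\<tau>. u \<tau> x) has_real_derivative - resolvent_dx (\<lambda>y. G (u t y)) x) (at t within {0..})"
    and a': "\<And>x. (u 0 has_real_derivative a' x) (at x)" "decaying M A' a'"
begin

text \<open>The spatial derivative of \<open>u\<close>, written as the time integral of \<open>-
  \<partial>\<^sub>x K (G u) = G u - resolvent (G u)\<close>. In this form it is visibly a
  decaying curve.\<close>

definition ux :: "real \<Rightarrow> real \<Rightarrow> real" where
  "ux t x = a' x + integral {0..t} (\<lambda>s. G (u s x) + (-1) * resolvent (\<lambda>y. G (u s y)) x)"

lemmas resolvent_Gu = decaying_curve_resolvent[OF Gu]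

lemma ux_integrand: "decaying_curve M (\<lambda>t x. G (u t x) + (-1) * resolvent (\<lambda>y. G (u t y)) x)"
  by (intro decaying_curve_add Gu decaying_curve_scale resolvent_Gu)

lemma ux: "decaying_curve M ux"
  unfolding ux_def[abs_def] by (intro decaying_curve_add decaying_curve_const[OF a'(2)] decaying_curve_integral ux_integrand)

lemma u_integral:
  assumes "0 \<le> t"
  shows "u t x = u 0 x + integral {0..t} (\<lambda>s. (-1) * resolvent_dx (\<lambda>y. G (u s y)) x)"
proof -
  have "((\<lambda>s. (-1) * resolvent_dx (\<lambda>y. G (u s y)) x) has_integral u t x - u 0 x) {0..t}"
  proof (rule fundamental_theorem_of_calculus[OF assms])
    fix s assume "s \<in> {0..t}"
    then show "((\<lambda>s. u s x) has_vector_derivative (-1) * resolvent_dx (\<lambda>y. G (u s y)) x) (at s within {0..t})"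
      using has_field_derivative_subset[OF u_t[of s x], of "{0..t}"]
      by (simp add: has_real_derivative_iff_has_vector_derivative)
  qed
  from integral_unique[OF this] show ?thesis by linarith
qed

lemma Gu_decaying: "0 \<le> t \<Longrightarrow> \<exists>C. decaying M C (\<lambda>y. G (u t y))"
  using decaying_curveD[OF Gu] .

lemma x_derivative:
  assumes t: "0 \<le> t"
  shows "(u t has_real_derivative ux t x) (at x)"
proof -
  have "((\<lambda>x. integral {0..t} (\<lambda>s. (-1) * resolvent_dx (\<lambda>y. G (u s y)) x)) has_real_derivative
      integral {0..t} (\<lambda>s. G (u s x) + (-1) * resolvent (\<lambda>y. G (u s y)) x)) (at x)"
  proof (rule time_integral_x_derivative[OF _ ux_integrand])
    show "decaying_curve M (\<lambda>s x. (-1) * resolvent_dx (\<lambda>y. G (u s y)) x)"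
      by (intro decaying_curve_scale resolvent_Gu)
    fix s x assume "0 \<le> (s::real)"
    then obtain C where "decaying M C (\<lambda>y. G (u s y))" using Gu_decaying by blast
    from resolvent_dx_derivative[OF decayingD(5)[OF this]]
    show "((\<lambda>x. (-1) * resolvent_dx (\<lambda>y. G (u s y)) x) has_real_derivative
      G (u s x) + (-1) * resolvent (\<lambda>y. G (u s y)) x) (at x)"
      by (auto intro!: derivative_eq_intros)
  qed
  then have d: "((\<lambda>x. u 0 x + integral {0..t} (\<lambda>s. (-1) * resolvent_dx (\<lambda>y. G (u s y)) x)) has_real_derivative ux t x) (at x)"
    unfolding ux_def by (rule DERIV_add[OF a'(1)])
  have eq: "u t = (\<lambda>x. u 0 x + integral {0..t} (\<lambda>s. (-1) * resolvent_dx (\<lambda>y. G (u s y)) x))"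
    by (rule ext) (rule u_integral[OF t])
  show ?thesis by (subst eq) (rule d)
qed

lemma ux_t:
  "0 \<le> t \<Longrightarrow> ((\<lambda>\<tau>. ux \<tau> x) has_real_derivative G (u t x) - resolvent (\<lambda>y. G (u t y)) x) (at t within {0..})"
  unfolding ux_def using time_integral_derivative[OF ux_integrand, of t x]
  by (auto intro!: derivative_eq_intros)

text \<open>Write \<open>p\<close> for the resolvent of \<open>G u\<close>. Then \<open>u\<^sub>t
  = - p'\<close> and \<open>u\<^sub>x\<^sub>t = G u - p\<close>, so the time derivative of
  \<open>(u\<^sup>2 + u\<^sub>x\<^sup>2) / 2\<close> is \<open>- u p' + u\<^sub>x (G u -
  p)\<close>. This is the spatial derivative of \<open>\<Phi> u - u p\<close>, where
  \<open>\<Phi>\<close> is an antiderivative of \<open>G\<close>. Its integral vanishes.\<close>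

lemma energy_conserved:
  assumes lip: "\<And>r s. \<bar>G r - G s\<bar> \<le> L * \<bar>r - s\<bar>" and G0: "G 0 = 0" and t: "0 \<le> t"
  shows "(LINT x:cell M|lborel. (u t x)\<^sup>2 + (ux t x)\<^sup>2) = (LINT x:cell M|lborel. (u 0 x)\<^sup>2 + (a' x)\<^sup>2)"
proof -
  let ?P = "\<lambda>t x. resolvent (\<lambda>y. G (u t y)) x" and ?K = "\<lambda>t x. resolvent_dx (\<lambda>y. G (u t y)) x"
  let ?e = "\<lambda>t x. u t x * u t x + ux t x * ux t x"
  let ?k = "\<lambda>t x. 2 * (u t x * ((-1) * ?K t x)) + 2 * (ux t x * (G (u t x) + (-1) * ?P t x))"
  let ?E = "\<lambda>t. LINT x:cell M|lborel. 1 * ?e t x"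
  have e: "decaying_curve M ?e"
    by (intro decaying_curve_add decaying_curve_mult u ux)
  have k: "decaying_curve M ?k"
    by (intro decaying_curve_add decaying_curve_mult decaying_curve_scale u ux Gu resolvent_Gu)
  have k0: "(LINT x:cell M|lborel. ?k t x) = 0" if t: "0 \<le> t" for t
  proof -
    obtain C where C: "decaying M C (u t)" using decaying_curveD[OF u t] by blast
    obtain D where D: "decaying M D (\<lambda>y. G (u t y))" using Gu_decaying[OF t] by blast
    obtain K where K: "decaying M K (?k t)" using decaying_curveD[OF k t] by blast
    have C0: "0 \<le> C" using decaying_const_nonneg[OF C] .
    have C1: "0 < C + 1" using C0 by simp
    obtain \<Phi> where \<Phi>: "\<And>r. \<bar>r\<bar> < C + 1 \<Longrightarrow> (\<Phi> has_real_derivative G r) (at r)"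
      "\<And>r. \<bar>r\<bar> < C + 1 \<Longrightarrow> \<bar>\<Phi> r\<bar> \<le> L * (C + 1) * \<bar>r\<bar>"
      using local_antiderivative[OF lip G0 C1] by blast
    have uC: "\<bar>u t x\<bar> < C + 1" for x
      using decayingD(3)[OF C, of x] mult_left_mono[OF rho_le_1 C0, of M x] by simp
    have L: "0 \<le> L" using order.trans[OF abs_ge_zero lip[of 1 0]] by simp
    have uP: "decaying M (C * (2 * D)) (\<lambda>x. u t x * ?P t x)"
      by (intro decaying_mult C decaying_resolvent D)
    let ?J = "\<lambda>x. 2 * \<Phi> (u t x) - 2 * (u t x * ?P t x)"
    let ?B = "max K (2 * (L * (C + 1) * C) + 2 * (C * (2 * D)))"
    have B: "K * rho M x \<le> ?B * rho M x" "(2 * (L * (C + 1) * C) + 2 * (C * (2 * D))) * rho M x \<le> ?B * rho M x" for x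
      by (auto intro!: mult_right_mono)
    show ?thesis
    proof (rule cell_integral_derivative[where J = ?J and C = ?B])
      show "(?J has_real_derivative ?k t x) (at x)" for x
        using DERIV_chain2[OF \<Phi>(1)[OF uC] x_derivative[OF t], of x]
        by (auto intro!: derivative_eq_intros x_derivative[OF t] resolvent_derivative[OF decayingD(5)[OF D]]
            simp: algebra_simps)
      show "continuous_on UNIV (?k t)" by (rule decayingD(1)[OF K])
      show "function_on M ?J"
        using decayingD(2)[OF C] decayingD(2)[OF uP] by (auto simp: function_on_def split: spatial_domain.splits)
      show "\<bar>?k t x\<bar> \<le> ?B * rho M x" for x
        using order.trans[OF decayingD(3)[OF K] B(1)] .
      show "\<bar>?J x\<bar> \<le> ?B * rho M x" for x
      proof -
        have "\<bar>\<Phi> (u t x)\<bar> \<le> L * (C + 1) * (C * rho M x)"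
          using order.trans[OF \<Phi>(2)[OF uC] mult_left_mono[OF decayingD(3)[OF C]]] L C0 by simp
        moreover have "\<bar>?J x\<bar> \<le> 2 * \<bar>\<Phi> (u t x)\<bar> + 2 * \<bar>u t x * ?P t x\<bar>"
          using abs_triangle_ineq4[of "2 * \<Phi> (u t x)" "2 * (u t x * ?P t x)"] by simp
        ultimately have "\<bar>?J x\<bar> \<le> 2 * (L * (C + 1) * (C * rho M x)) + 2 * (C * (2 * D) * rho M x)"
          using decayingD(3)[OF uP, of x] by linarith
        also have "\<dots> = (2 * (L * (C + 1) * C) + 2 * (C * (2 * D))) * rho M x"
          by (simp add: algebra_simps)
        also note B(2)
        finally show ?thesis .
      qed
    qed
  qed
  have "(?E has_real_derivative 0) (at \<tau> within {0..})" if \<tau>: "0 \<le> \<tau>" for \<tau>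
  proof -
    have "((\<lambda>\<tau>. ?e \<tau> x) has_real_derivative ?k t x) (at t within {0..})" if "0 \<le> t" for t x
      by (rule derivative_eq_intros u_t[OF that] ux_t[OF that] refl)+ (simp add: algebra_simps)
    from cell_integral_time_derivative[OF e k this, of "\<lambda>_. 1" 1 \<tau>] show ?thesis
      using k0[OF \<tau>] \<tau> by simp
  qed
  then have "\<exists>c. \<forall>\<tau>\<in>{0..}. ?E \<tau> = c"
    by (intro has_field_derivative_zero_constant) auto
  then obtain c where c: "\<forall>\<tau>\<in>{0..}. ?E \<tau> = c" by blast
  have "?E t = ?E 0"
    by (rule trans[OF bspec[OF c] bspec[OF c, symmetric]]) (use t in auto)
  then show ?thesis by (simp add: power2_eq_square ux_def)
qed

end

section \<open>Smooth curves\<close>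

text \<open>The derivative is existentially quantified, which makes the closure properties below
  immediate inductions.\<close>

primrec smooth_curve :: "spatial_domain \<Rightarrow> nat \<Rightarrow> (real \<Rightarrow> real \<Rightarrow> real) \<Rightarrow> bool" where
  "smooth_curve M 0 u \<longleftrightarrow> decaying_curve M u"
| "smooth_curve M (Suc k) u \<longleftrightarrow> decaying_curve M u \<and>
     (\<exists>u'. smooth_curve M k u' \<and> (\<forall>t\<ge>0. \<forall>x. (u t has_real_derivative u' t x) (at x)))"

lemma smooth_curve_decaying: "smooth_curve M k u \<Longrightarrow> decaying_curve M u"
  by (cases k) auto

lemma smooth_curve_SucI:
  "decaying_curve M u \<Longrightarrow> smooth_curve M k u' \<Longrightarrow>
    (\<And>t x. 0 \<le> t \<Longrightarrow> (u t has_real_derivative u' t x) (at x)) \<Longrightarrow> smooth_curve M (Suc k) u"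
  by auto

lemma smooth_curve_SucE:
  assumes "smooth_curve M (Suc k) u"
  obtains u' where "smooth_curve M k u'" "\<And>t x. 0 \<le> t \<Longrightarrow> (u t has_real_derivative u' t x) (at x)"
  using assms by auto

lemma smooth_curve_mono: "smooth_curve M (Suc k) u \<Longrightarrow> smooth_curve M k u"
proof (induction k arbitrary: u)
  case (Suc k)
  then show ?case by (metis smooth_curve.simps(2))
qed simp

lemma smooth_curve_add: "smooth_curve M k u \<Longrightarrow> smooth_curve M k v \<Longrightarrow> smooth_curve M k (\<lambda>t x. u t x + v t x)"
proof (induction k arbitrary: u v)
  case (Suc k)
  obtain u' where u': "smooth_curve M k u'" "\<And>t x. 0 \<le> t \<Longrightarrow> (u t has_real_derivative u' t x) (at x)"
    using smooth_curve_SucE[OF Suc.prems(1)] by blast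
  obtain v' where v': "smooth_curve M k v'" "\<And>t x. 0 \<le> t \<Longrightarrow> (v t has_real_derivative v' t x) (at x)"
    using smooth_curve_SucE[OF Suc.prems(2)] by blast
  show ?case
    by (rule smooth_curve_SucI[OF decaying_curve_add Suc.IH[OF u'(1) v'(1)]])
      (use Suc.prems u'(2) v'(2) in \<open>auto intro!: DERIV_add dest: smooth_curve_decaying\<close>)
qed (simp add: decaying_curve_add)

lemma smooth_curve_scale: "smooth_curve M k u \<Longrightarrow> smooth_curve M k (\<lambda>t x. c * u t x)"
proof (induction k arbitrary: u)
  case (Suc k)
  obtain u' where u': "smooth_curve M k u'" "\<And>t x. 0 \<le> t \<Longrightarrow> (u t has_real_derivative u' t x) (at x)"
    using smooth_curve_SucE[OF Suc.prems(1)] by blast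
  show ?case
    by (rule smooth_curve_SucI[OF decaying_curve_scale Suc.IH[OF u'(1)]])
      (use Suc.prems u'(2) in \<open>auto intro!: DERIV_cmult dest: smooth_curve_decaying\<close>)
qed (simp add: decaying_curve_scale)

lemma smooth_curve_mult: "smooth_curve M k u \<Longrightarrow> smooth_curve M k v \<Longrightarrow> smooth_curve M k (\<lambda>t x. u t x * v t x)"
proof (induction k arbitrary: u v)
  case (Suc k)
  obtain u' where u': "smooth_curve M k u'" "\<And>t x. 0 \<le> t \<Longrightarrow> (u t has_real_derivative u' t x) (at x)"
    using smooth_curve_SucE[OF Suc.prems(1)] by blast
  obtain v' where v': "smooth_curve M k v'" "\<And>t x. 0 \<le> t \<Longrightarrow> (v t has_real_derivative v' t x) (at x)"
    using smooth_curve_SucE[OF Suc.prems(2)] by blast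
  have "smooth_curve M k (\<lambda>t x. u' t x * v t x + v' t x * u t x)"
    by (rule smooth_curve_add[OF Suc.IH[OF u'(1) smooth_curve_mono[OF Suc.prems(2)]]
          Suc.IH[OF v'(1) smooth_curve_mono[OF Suc.prems(1)]]])
  moreover have "decaying_curve M (\<lambda>t x. u t x * v t x)"
    by (intro decaying_curve_mult smooth_curve_decaying[OF Suc.prems(1)] smooth_curve_decaying[OF Suc.prems(2)])
  ultimately show ?case
    using DERIV_mult[OF u'(2) v'(2)] by (intro smooth_curve_SucI)
qed (simp add: decaying_curve_mult)

lemma smooth_curve_integral: "smooth_curve M k u \<Longrightarrow> smooth_curve M k (\<lambda>t x. integral {0..t} (\<lambda>s. u s x))"
proof (induction k arbitrary: u)
  case (Suc k)
  obtain u' where u': "smooth_curve M k u'" "\<And>t x. 0 \<le> t \<Longrightarrow> (u t has_real_derivative u' t x) (at x)"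
    using smooth_curve_SucE[OF Suc.prems(1)] by blast
  have "decaying_curve M u" "decaying_curve M u'"
    using smooth_curve_decaying Suc.prems u'(1) by blast+
  then show ?case
    by (intro smooth_curve_SucI[OF decaying_curve_integral Suc.IH[OF u'(1)]] time_integral_x_derivative u'(2))
qed (simp add: decaying_curve_integral)

text \<open>Smoothness of a function is expressed by an explicit sequence of its
  derivatives.\<close>

definition smooth_profile :: "spatial_domain \<Rightarrow> (real \<Rightarrow> real) \<Rightarrow> bool" where
  "smooth_profile M a \<longleftrightarrow>
     (\<exists>A. A 0 = a \<and> (\<forall>j. (\<exists>C. decaying M C (A j)) \<and> (\<forall>x. (A j has_real_derivative A (Suc j) x) (at x))))"

lemma smooth_curve_chain:
  assumes "\<And>j. \<exists>C. decaying M C (A j)" "\<And>j x. (A j has_real_derivative A (Suc j) x) (at x)"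
  shows "smooth_curve M k (\<lambda>t. A j)"
proof (induction k arbitrary: j)
  case 0
  obtain C where "decaying M C (A j)" using assms(1) by blast
  then show ?case by (simp add: decaying_curve_const)
next
  case (Suc k)
  obtain C where "decaying M C (A j)" using assms(1) by blast
  then show ?case
    by (intro smooth_curve_SucI[OF decaying_curve_const Suc[of "Suc j"]] assms(2))
qed

lemma smooth_profile_curve: "smooth_profile M a \<Longrightarrow> smooth_curve M k (\<lambda>t. a)"
  unfolding smooth_profile_def using smooth_curve_chain by metis

section \<open>Global smooth solutions\<close>

definition bbm_flux :: "real \<Rightarrow> real" where
  "bbm_flux r = r + r\<^sup>2 / 2"

definition bbm_curve :: "spatial_domain \<Rightarrow> (real \<Rightarrow> real \<Rightarrow> real) \<Rightarrow> bool" where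
  "bbm_curve M u \<longleftrightarrow> (\<forall>k. smooth_curve M k u) \<and>
     (\<forall>t\<ge>0. \<forall>x. ((\<lambda>\<tau>. u \<tau> x) has_real_derivative - resolvent_dx (\<lambda>y. bbm_flux (u t y)) x) (at t within {0..}))"

lemma smooth_curve_flux: "smooth_curve M k u \<Longrightarrow> smooth_curve M k (\<lambda>t x. bbm_flux (u t x))"
  using smooth_curve_add[OF _ smooth_curve_scale[OF smooth_curve_mult, of M k u u "1/2"], of u]
  by (simp add: bbm_flux_def power2_eq_square)

text \<open>The truncated square is the composition of the projection onto \<open>[-R, R]\<close>,
  which does not increase distances, and the square, whose derivative is at most \<open>2
  R\<close> in modulus there.\<close>

lemma truncated_square_lipschitz:
  fixes R :: real assumes "0 \<le> R"
  shows "\<bar>(max (-R) (min R r))\<^sup>2 - (max (-R) (min R s))\<^sup>2\<bar> \<le> 2 * R * \<bar>r - s\<bar>"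
proof -
  let ?c = "\<lambda>r. max (-R) (min R r)"
  have "\<bar>(?c r)\<^sup>2 - (?c s)\<^sup>2\<bar> = \<bar>?c r + ?c s\<bar> * \<bar>?c r - ?c s\<bar>"
    by (simp add: abs_mult[symmetric] power2_eq_square algebra_simps)
  also have "\<dots> \<le> (2 * R) * \<bar>r - s\<bar>"
    using assms by (intro mult_mono) (auto simp: max_def min_def)
  finally show ?thesis .
qed

text \<open>The truncation level is the supremum bound that conservation of energy provides, so
  the solution of the truncated equation solves the equation itself. For smoothness,
  \<open>u\<^sub>x\<^sub>x\<close> is expressed by \<open>u\<close>, the initial value and the
  time integral of the first spatial derivative of \<open>u + u\<^sup>2/2\<close>. If
  \<open>u\<close> has \<open>k + 1\<close> derivatives, this shows that \<open>u\<^sub>x\<close>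
  has \<open>k + 1\<close> derivatives, hence that \<open>u\<close> has \<open>k +
  2\<close>.\<close>

theorem bbm_global_solution:
  assumes "smooth_profile M a"
  obtains u where "u 0 = a" "bbm_curve M u"
proof -
  obtain A where A0: "A 0 = a" and A: "\<And>j. \<exists>C. decaying M C (A j)"
    and A_deriv: "\<And>j x. (A j has_real_derivative A (Suc j) x) (at x)"
    using assms unfolding smooth_profile_def by metis
  obtain C0 where C0: "decaying M C0 a" using A[of 0] A0 by auto
  obtain C1 where C1: "decaying M C1 (A 1)" using A by blast
  have A01: "(a has_real_derivative A 1 x) (at x)" for x
    using A_deriv[of 0 x] by (simp add: A0)
  define E where "E = (LINT x:cell M|lborel. (a x)\<^sup>2 + (A 1 x)\<^sup>2)"
  have E: "0 \<le> E"
    unfolding E_def set_lebesgue_integral_def by (rule integral_nonneg_AE) simp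
  \<comment> \<open>By \<open>square_le_energy\<close>, a function of energy \<open>E\<close> is
    bounded by \<open>R\<close>.\<close>
  define R where "R = sqrt (2 * E)"
  have R: "0 \<le> R" using E by (simp add: R_def)
  define G where "G r = r + (max (-R) (min R r))\<^sup>2 / 2" for r
  have lip: "\<bar>G r - G s\<bar> \<le> (1 + R) * \<bar>r - s\<bar>" for r s
  proof -
    have "\<bar>(r + X / 2) - (s + Y / 2)\<bar> \<le> \<bar>r - s\<bar> + \<bar>X - Y\<bar> / 2" for X Y :: real
    proof -
      have "(r + X / 2) - (s + Y / 2) = (r - s) + (X - Y) / 2" by (simp add: field_simps)
      then show ?thesis using abs_triangle_ineq[of "r - s" "(X - Y) / 2"] by (simp only: abs_divide) 
    qed
    from this[of "(max (-R) (min R r))\<^sup>2" "(max (-R) (min R s))\<^sup>2"] show ?thesis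
      using truncated_square_lipschitz[OF R, of r s] unfolding G_def distrib_right by linarith
  qed
  have G0: "G 0 = 0" using R by (simp add: G_def)
  have L: "0 < 1 + R" using R by simp
  obtain u where u0: "u 0 = a" and u: "decaying_curve M u"
    and u_t: "\<And>t x. 0 \<le> t \<Longrightarrow> ((\<lambda>\<tau>. u \<tau> x) has_real_derivative - resolvent_dx (\<lambda>y. G (u t y)) x) (at t within {0..})"
    using global_lipschitz_evolution[OF C0 lip L G0] by blast
  have Gu: "decaying_curve M (\<lambda>t x. G (u t x))"
    by (rule decaying_curve_lipschitz_comp[OF u lip G0]) (use L in simp)
  interpret T: bbm_type_flow M G u "A 1" C1
    by unfold_locales (use u Gu u_t A01 C1 in \<open>auto simp: u0\<close>)
  have "\<bar>u t x\<bar> \<le> R" if t: "0 \<le> t" for t x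
  proof -
    obtain D where D: "decaying M D (u t)" using decaying_curveD[OF u t] by blast
    obtain D' where D': "decaying M D' (T.ux t)" using decaying_curveD[OF T.ux t] by blast
    have "(u t x)\<^sup>2 \<le> 2 * (LINT x:cell M|lborel. (u t x)\<^sup>2 + (T.ux t x)\<^sup>2)"
    proof (rule square_le_energy[OF T.x_derivative[OF t] decayingD(1)[OF D'] decayingD(2)[OF D]])
      have "decaying M (max D D') (u t)" "decaying M (max D D') (T.ux t)"
        using decaying_mono[OF D] decaying_mono[OF D'] by auto
      then show "\<bar>u t x\<bar> \<le> max D D' * rho M x" "\<bar>T.ux t x\<bar> \<le> max D D' * rho M x" for x
        using decayingD(3) by blast+
    qed
    also have "\<dots> = 2 * E"
      using T.energy_conserved[OF lip G0 t] by (simp add: E_def u0)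
    finally show ?thesis
      unfolding R_def using real_le_rsqrt real_sqrt_abs by (metis real_sqrt_le_iff)
  qed
  then have G_eq: "G (u t x) = bbm_flux (u t x)" if "0 \<le> t" for t x
    using that[THEN \<open>\<And>x t. 0 \<le> t \<Longrightarrow> \<bar>u t x\<bar> \<le> R\<close>, of x] by (simp add: G_def bbm_flux_def abs_le_iff)
  have u_t': "((\<lambda>\<tau>. u \<tau> x) has_real_derivative - resolvent_dx (\<lambda>y. bbm_flux (u t y)) x) (at t within {0..})"
    if "0 \<le> t" for t x
    using u_t[OF that] by (simp add: G_eq that)
  have fu: "decaying_curve M (\<lambda>t x. bbm_flux (u t x))"
    by (rule decaying_curve_cong[OF _ Gu]) (rule G_eq)
  interpret B: bbm_type_flow M bbm_flux u "A 1" C1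
    by unfold_locales (use u fu u_t' A01 C1 in \<open>auto simp: u0\<close>)
  have smooth: "smooth_curve M (Suc k) u" for k
  proof (induction k)
    case 0
    then show ?case
      using B.u B.ux B.x_derivative by (intro smooth_curve_SucI[of M u 0 B.ux]) auto
  next
    case (Suc k)
    obtain f' where f': "smooth_curve M k f'"
      "\<And>t x. 0 \<le> t \<Longrightarrow> ((\<lambda>x. bbm_flux (u t x)) has_real_derivative f' t x) (at x)"
      using smooth_curve_SucE[OF smooth_curve_flux[OF Suc]] by blast
    \<comment> \<open>From \<open>(u\<^sub>x\<^sub>x - u)\<^sub>t = \<partial>\<^sub>x (u +
      u\<^sup>2/2)\<close>, integrated in time.\<close>
    define uxx where "uxx t x = u t x + (A 2 x + ((-1) * a x + integral {0..t} (\<lambda>s. f' s x)))" for t x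
    have sm: "smooth_curve M k (\<lambda>t. A j)" for j
      by (rule smooth_curve_chain[of M A]) (rule A, rule A_deriv)
    have uxx: "smooth_curve M k uxx"
      unfolding uxx_def[abs_def]
      by (intro smooth_curve_add smooth_curve_mono[OF Suc] smooth_curve_scale smooth_curve_integral f'(1) sm[of 2]
          sm[of 0, unfolded A0])
    have "(B.ux t has_real_derivative uxx t x) (at x)" if t: "0 \<le> t" for t x
    proof -
      have c: "decaying_curve M (\<lambda>t x. f' t x + (-1) * resolvent_dx (\<lambda>y. bbm_flux (u t y)) x)"
        by (intro decaying_curve_add decaying_curve_scale smooth_curve_decaying[OF f'(1)] B.resolvent_Gu)
      have "((\<lambda>x. integral {0..t} (\<lambda>s. bbm_flux (u s x) + (-1) * resolvent (\<lambda>y. bbm_flux (u s y)) x)) has_real_derivative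
        integral {0..t} (\<lambda>s. f' s x + (-1) * resolvent_dx (\<lambda>y. bbm_flux (u s y)) x)) (at x)"
      proof (rule time_integral_x_derivative[OF B.ux_integrand c])
        fix s x assume s: "0 \<le> (s::real)"
        obtain C where "decaying M C (\<lambda>y. bbm_flux (u s y))" using B.Gu_decaying[OF s] by blast
        from resolvent_derivative[OF decayingD(5)[OF this]] f'(2)[OF s]
        show "((\<lambda>x. bbm_flux (u s x) + (-1) * resolvent (\<lambda>y. bbm_flux (u s y)) x) has_real_derivative
          f' s x + (-1) * resolvent_dx (\<lambda>y. bbm_flux (u s y)) x) (at x)"
          by (auto intro!: derivative_eq_intros)
      qed
      from DERIV_add[OF A_deriv[of 1 x] this]
      have "(B.ux t has_real_derivative A 2 x +
          integral {0..t} (\<lambda>s. f' s x + (-1) * resolvent_dx (\<lambda>y. bbm_flux (u s y)) x)) (at x)"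
        unfolding B.ux_def[abs_def] by (simp add: numeral_2_eq_2)
      moreover have "integral {0..t} (\<lambda>s. f' s x + (-1) * resolvent_dx (\<lambda>y. bbm_flux (u s y)) x) =
          integral {0..t} (\<lambda>s. f' s x) + (u t x - a x)"
        using Henstock_Kurzweil_Integration.integral_add[OF decaying_curve_integrable_time[OF smooth_curve_decaying[OF f'(1)], of x t]
          decaying_curve_integrable_time[OF decaying_curve_scale[OF B.resolvent_Gu(2), of "-1"], of x t]]
          B.u_integral[OF t, of x] fun_cong[OF u0, of x] by linarith
      ultimately have "(B.ux t has_real_derivative A 2 x + (integral {0..t} (\<lambda>s. f' s x) + (u t x - a x))) (at x)"
        by (simp only:)
      then show ?thesis by (rule DERIV_cong) (simp add: uxx_def)
    qed
    then have "smooth_curve M (Suc k) B.ux"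
      by (intro smooth_curve_SucI[OF B.ux uxx])
    then show ?case
      by (intro smooth_curve_SucI[OF B.u _ B.x_derivative])
  qed
  show ?thesis
    using that[of u] u0 smooth smooth_curve_mono u_t' unfolding bbm_curve_def by metis
qed

lemma bbm_curve_solves: 
  assumes "bbm_curve M u" shows "solves_bbm u"
proof -
  have sm: "smooth_curve M 1 u" and u_t: "\<And>t x. 0 \<le> t \<Longrightarrow>
      ((\<lambda>\<tau>. u \<tau> x) has_real_derivative - resolvent_dx (\<lambda>y. bbm_flux (u t y)) x) (at t within {0..})"
    using assms unfolding bbm_curve_def by blast+
  obtain ux where ux: "\<And>t x. 0 \<le> t \<Longrightarrow> (u t has_real_derivative ux t x) (at x)"
    using sm by auto
  have fu: "decaying_curve M (\<lambda>t x. bbm_flux (u t x))"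
    using smooth_curve_flux[of M 0 u] smooth_curve_decaying[OF sm] by simp
  let ?f = "\<lambda>t y. bbm_flux (u t y)"
  show ?thesis
    unfolding solves_bbm_def
  proof (intro exI allI impI conjI)
    fix t x :: real assume t: "0 \<le> t"
    obtain C where C: "dominated M C (?f t)" using decaying_curveD[OF fu t] decayingD(5) by blast
    show "((\<lambda>\<tau>. u \<tau> x) has_real_derivative - resolvent_dx (?f t) x) (at t within {0..})"
      using u_t[OF t] .
    show "((\<lambda>y. - resolvent_dx (?f t) y) has_real_derivative ?f t x - resolvent (?f t) x) (at x)"
      by (auto intro!: derivative_eq_intros resolvent_dx_derivative[OF C])
    have f: "(?f t has_real_derivative ux t x + u t x * ux t x) (at x)"
      unfolding bbm_flux_def using ux[OF t, of x] by (auto intro!: derivative_eq_intros)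
    show "((\<lambda>y. ?f t y - resolvent (?f t) y) has_real_derivative ux t x + u t x * ux t x - resolvent_dx (?f t) x) (at x)"
      by (intro DERIV_diff f resolvent_derivative[OF C])
    show "((\<lambda>y. u t y) has_real_derivative ux t x) (at x)" by (rule ux[OF t])
    show "((\<lambda>y. (u t y)\<^sup>2) has_real_derivative 2 * (u t x * ux t x)) (at x)"
      using ux[OF t, of x] by (auto intro!: derivative_eq_intros)
    show "- resolvent_dx (?f t) x - (ux t x + u t x * ux t x - resolvent_dx (?f t) x) + ux t x
        + 1 / 2 * (2 * (u t x * ux t x)) = 0"
      by simp
  qed
qed

section \<open>Gaussians\<close>

text \<open>Products of polynomials with Gaussians \<open>exp (b x - x\<^sup>2/2)\<close> with a
  complex parameter \<open>b\<close>. For fixed \<open>b\<close> this class is closed under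
  differentiation and under multiplication by powers of \<open>x\<close>, which reduces the
  Schwartz property to boundedness. Real \<open>b\<close> gives translated Gaussians, imaginary
  \<open>b\<close> gives modulated ones.\<close>

definition gauss :: "complex poly \<Rightarrow> complex \<Rightarrow> real \<Rightarrow> complex" where
  "gauss p b x = poly p (of_real x) * exp (b * of_real x - of_real (x\<^sup>2 / 2))"

definition gauss_step :: "complex \<Rightarrow> complex poly \<Rightarrow> complex poly" where
  "gauss_step b p = pderiv p + [:b, -1:] * p"

lemma gauss_derivative: "(gauss p b has_vector_derivative gauss (gauss_step b p) b x) (at x)"
proof -
  have "((\<lambda>z. poly p z * exp (b * z - z\<^sup>2 / 2)) has_field_derivative
      poly (gauss_step b p) (of_real x) * exp (b * of_real x - (of_real x)\<^sup>2 / 2)) (at (of_real x))"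
    by (auto intro!: derivative_eq_intros poly_DERIV simp: gauss_step_def algebra_simps)
  from has_vector_derivative_real_field[OF this]
  show ?thesis by (simp add: gauss_def[abs_def])
qed

lemma continuous_gauss: "continuous_on A (gauss p b)"
  by (intro continuous_at_imp_continuous_on ballI has_vector_derivative_continuous[OF gauss_derivative])

text \<open>A bound by an exponential is weaker than one by a power but is better suited to an
  induction over the coefficients, and the Gaussian factor absorbs it equally well.\<close>

lemma poly_exp_bound: "\<exists>C k. 0 \<le> C \<and> (\<forall>x::real. cmod (poly p (of_real x)) \<le> C * exp (real k * \<bar>x\<bar>))"
proof (induction p)
  case 0
  show ?case by (rule exI[of _ 0]) auto
next
  case (pCons a p)
  then obtain C k where C: "0 \<le> C" "\<And>x::real. cmod (poly p (of_real x)) \<le> C * exp (real k * \<bar>x\<bar>)" by blast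
  have "cmod (poly (pCons a p) (of_real x)) \<le> (cmod a + C) * exp (real (Suc k) * \<bar>x\<bar>)" for x :: real
  proof -
    have x: "\<bar>x\<bar> \<le> exp \<bar>x\<bar>" using exp_ge_add_one_self[of "\<bar>x\<bar>"] by linarith
    have 1: "1 \<le> exp (real (Suc k) * \<bar>x\<bar>)" by simp
    have "cmod (poly (pCons a p) (of_real x)) \<le> cmod a + \<bar>x\<bar> * cmod (poly p (of_real x))"
      using norm_triangle_ineq[of a "of_real x * poly p (of_real x)"] by (simp add: norm_mult)
    also have "\<dots> \<le> cmod a * exp (real (Suc k) * \<bar>x\<bar>) + exp \<bar>x\<bar> * (C * exp (real k * \<bar>x\<bar>))"
      using mult_left_mono[OF 1, of "cmod a"] C x by (intro add_mono mult_mono) auto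
    also have "\<dots> = (cmod a + C) * exp (real (Suc k) * \<bar>x\<bar>)"
      by (simp add: algebra_simps exp_add)
    finally show ?thesis .
  qed
  then show ?case using C(1) by (intro exI[of _ "cmod a + C"] exI[of _ "Suc k"]) auto
qed

lemma gauss_bound: "\<exists>C. \<forall>x. cmod (gauss p b x) \<le> C * rho Line x"
proof -
  obtain C k where C: "0 \<le> C" "\<And>x::real. cmod (poly p (of_real x)) \<le> C * exp (real k * \<bar>x\<bar>)"
    using poly_exp_bound by blast
  define K where "K = real k + \<bar>Re b\<bar> + 1/2"
  have "cmod (gauss p b x) \<le> (C * exp (K\<^sup>2 / 2)) * rho Line x" for x
  proof -
    have "Re b * x \<le> \<bar>Re b\<bar> * \<bar>x\<bar>" by (metis abs_ge_self abs_mult)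
    moreover have "0 \<le> (\<bar>x\<bar> - K)\<^sup>2" by simp
    then have "K * \<bar>x\<bar> - x\<^sup>2 / 2 \<le> K\<^sup>2 / 2"
      by (simp add: power2_diff mult_ac)
    ultimately have e: "real k * \<bar>x\<bar> + (Re b * x - x\<^sup>2 / 2) \<le> K\<^sup>2 / 2 + - \<bar>x\<bar> / 2"
      by (simp add: K_def distrib_right)
    have "cmod (gauss p b x) = cmod (poly p (of_real x)) * exp (Re b * x - x\<^sup>2 / 2)"
      by (simp add: gauss_def norm_mult)
    also have "\<dots> \<le> C * exp (real k * \<bar>x\<bar>) * exp (Re b * x - x\<^sup>2 / 2)"
      by (intro mult_right_mono C) auto
    also have "\<dots> = C * exp (real k * \<bar>x\<bar> + (Re b * x - x\<^sup>2 / 2))"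
      by (simp only: exp_add mult.assoc)
    also have "\<dots> \<le> C * exp (K\<^sup>2 / 2 + - \<bar>x\<bar> / 2)"
      using e C(1) by (intro mult_left_mono) auto
    finally show ?thesis by (simp only: exp_add rho_Line mult.assoc)
  qed
  then show ?thesis by blast
qed

lemma smooth_profile_gauss: "smooth_profile Line (\<lambda>x. Re (gauss p b x))"
  unfolding smooth_profile_def
proof (intro exI[of _ "\<lambda>j x. Re (gauss ((gauss_step b ^^ j) p) b x)"] conjI allI)
  fix j x
  obtain C where "\<And>x. cmod (gauss ((gauss_step b ^^ j) p) b x) \<le> C * rho Line x"
    using gauss_bound by blast
  then have "\<bar>Re (gauss ((gauss_step b ^^ j) p) b x)\<bar> \<le> C * rho Line x" for x
    using abs_Re_le_cmod order_trans by blast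
  then show "\<exists>C. decaying Line C (\<lambda>x. Re (gauss ((gauss_step b ^^ j) p) b x))"
    by (intro exI[of _ C]) (auto simp: decaying_def dominated_def function_on_def intro!: continuous_intros continuous_gauss)
  show "((\<lambda>x. Re (gauss ((gauss_step b ^^ j) p) b x)) has_real_derivative
       Re (gauss ((gauss_step b ^^ Suc j) p) b x)) (at x)"
    using bounded_linear.has_vector_derivative[OF bounded_linear_Re gauss_derivative]
    by (simp add: has_real_derivative_iff_has_vector_derivative)
qed simp

lemma vderiv_gauss: "(vderiv ^^ k) (gauss p b) = gauss ((gauss_step b ^^ k) p) b"
proof (induction k)
  case (Suc k)
  have "vderiv (gauss q b) = gauss (gauss_step b q) b" for q
    by (rule ext) (simp add: vderiv_def vector_derivative_at[OF gauss_derivative])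
  then show ?case by (simp add: Suc)
qed simp

lemma gauss_mult_power: "of_real x ^ j * gauss p b x = gauss (monom 1 j * p) b x"
  by (simp add: gauss_def poly_monom)

lemma schwartz_gauss: "gauss p b \<in> schwartz"
proof -
  have "bounded (range (gauss p b))" for p
  proof -
    obtain C where C: "\<And>x. cmod (gauss p b x) \<le> C * rho Line x" using gauss_bound by blast
    have "cmod (gauss p b x) \<le> \<bar>C\<bar>" for x
    proof -
      have "C * rho Line x \<le> \<bar>C\<bar> * rho Line x" by (intro mult_right_mono) auto
      also have "\<dots> \<le> \<bar>C\<bar> * 1" by (intro mult_left_mono rho_le_1) auto
      finally show ?thesis using C[of x] by simp
    qed
    then show ?thesis unfolding bounded_iff by blast
  qed
  then show ?thesis
    unfolding schwartz_def smooth_fun_def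
    by (auto simp: vderiv_gauss gauss_mult_power intro: differentiableI_vector[OF gauss_derivative])
qed

lemma integrable_gauss: "integrable lborel (gauss p b)"
proof -
  obtain C where "\<And>x. cmod (gauss p b x) \<le> C * rho Line x" using gauss_bound by blast
  from integrable_of_rho_bound[OF borel_measurable_continuous_onI[OF continuous_gauss] this]
  show ?thesis by (simp add: cell_def set_integrable_def)
qed

text \<open>This is the characteristic function of the standard normal distribution.\<close>

lemma integral_gaussian_cis:
  "(LINT x|lborel. cis (t * x) * of_real (exp (- (x\<^sup>2 / 2)))) = of_real (sqrt (2 * pi) * exp (- (t\<^sup>2 / 2)))"
proof -
  have "of_real (exp (- (t\<^sup>2) / 2)) = (LINT x|std_normal_distribution. iexp (t * x))"
    using fun_cong[OF char_std_normal_distribution, of t] by (simp add: char_def)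
  also have "\<dots> = (LINT x|lborel. std_normal_density x *\<^sub>R iexp (t * x))"
    by (subst integral_density) auto
  also have "\<dots> = (LINT x|lborel. of_real (1 / sqrt (2 * pi)) * (cis (t * x) * of_real (exp (- (x\<^sup>2 / 2)))))"
    by (intro Bochner_Integration.integral_cong refl)
      (simp add: std_normal_density_def scaleR_conv_of_real cis_conv_exp exp_of_real mult_ac)
  also have "\<dots> = of_real (1 / sqrt (2 * pi)) * (LINT x|lborel. cis (t * x) * of_real (exp (- (x\<^sup>2 / 2))))"
    by simp
  finally show ?thesis
    by (simp add: field_simps)
qed

section \<open>Exponential sums and their density\<close>

inductive expsum :: "(real \<Rightarrow> complex) \<Rightarrow> bool" where
  single: "expsum (\<lambda>x. c * cis (a * x))"
| add: "expsum f \<Longrightarrow> expsum g \<Longrightarrow> expsum (\<lambda>x. f x + g x)"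

lemma expsum_const: "expsum (\<lambda>x. c)"
  using expsum.single[of c 0] by simp

lemma expsum_scale: "expsum f \<Longrightarrow> expsum (\<lambda>x. c * f x)"
proof (induction rule: expsum.induct)
  case (single d a)
  then show ?case using expsum.single[of "c * d" a] by (simp add: mult.assoc)
qed (simp add: distrib_left expsum.add)

lemma expsum_mult:
  assumes "expsum f" "expsum g" shows "expsum (\<lambda>x. f x * g x)"
  using assms(1)
proof (induction rule: expsum.induct)
  case (single c a)
  have "expsum (\<lambda>x. cis (a * x) * g x)"
    using assms(2)
  proof (induction rule: expsum.induct)
    case (single d b)
    have "(\<lambda>x. cis (a * x) * (d * cis (b * x))) = (\<lambda>x. d * cis ((a + b) * x))"
      by (simp add: fun_eq_iff mult.left_commute[of _ d] cis_mult distrib_right)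
    then show ?case using expsum.single[of d "a + b"] by simp
  qed (simp add: distrib_left expsum.add)
  from expsum_scale[OF this, of c] show ?case by (simp add: mult.assoc)
qed (simp add: distrib_right expsum.add)

lemma expsum_rescale: "expsum f \<Longrightarrow> expsum (\<lambda>x. f (r * x))"
proof (induction rule: expsum.induct)
  case (single c a)
  then show ?case using expsum.single[of c "a * r"] by (simp add: mult.assoc)
qed (simp add: expsum.add)

text \<open>Real polynomials in the coordinates of a point of the unit circle are trigonometric
  polynomials, because the coordinates of \<open>cis x\<close> are combinations of \<open>cis
  x\<close> and \<open>cis (-x)\<close>.\<close>

lemma expsum_real_polynomial:
  fixes f :: "complex \<Rightarrow> real"
  assumes "real_polynomial_function f"
  shows "expsum (\<lambda>x. of_real (f (cis x)))"
  using assms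
proof (induction rule: real_polynomial_function.induct)
  case (linear f)
  interpret f: bounded_linear f by fact
  have "f (cis x) = cos x * f 1 + sin x * f \<i>" for x
  proof -
    have "cis x = cos x *\<^sub>R 1 + sin x *\<^sub>R \<i>" by (simp add: complex_eq_iff)
    then show ?thesis by (simp only: f.add f.scaleR real_scaleR_def)
  qed
  then have "(\<lambda>x. of_real (f (cis x))) =
      (\<lambda>x. (of_real (f 1) / 2 + of_real (f \<i>) / (2 * \<i>)) * cis (1 * x) + (of_real (f 1) / 2 - of_real (f \<i>) / (2 * \<i>)) * cis (- 1 * x))"
    by (auto simp: fun_eq_iff complex_eq_iff field_simps)
  then show ?case by (simp only:) (intro expsum.intros)
qed (auto intro: expsum_const expsum_mult expsum.add)

lemma expsum_polynomial_function:
  fixes P :: "complex \<Rightarrow> complex"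
  assumes "polynomial_function P"
  shows "expsum (\<lambda>x. P (cis x))"
proof -
  have "real_polynomial_function (Re \<circ> P)" "real_polynomial_function (Im \<circ> P)"
    using assms bounded_linear_Re bounded_linear_Im unfolding polynomial_function_def by blast+
  from expsum.add[OF expsum_real_polynomial[OF this(1)] expsum_scale[OF expsum_real_polynomial[OF this(2)], of \<i>]]
  show ?thesis by (simp add: complex_eq[symmetric])
qed

lemma continuous_expsum: "expsum f \<Longrightarrow> continuous_on A f"
  by (induction rule: expsum.induct) (auto intro!: continuous_intros)

text \<open>The interval \<open>[-N, N]\<close> is wrapped onto an arc of the unit circle by
  \<open>x \<mapsto> cis (x / N)\<close>, and \<open>g\<close> is transported to a continuous
  function on the whole circle without increasing its supremum. A Stone-Weierstrass approximation
  of that function is periodic in \<open>x\<close>, hence bounded on the whole line by its bound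
  on the circle.\<close>

lemma bounded_continuous_expsum_approx:
  fixes g :: "real \<Rightarrow> complex"
  assumes g: "continuous_on UNIV g" "\<And>x. cmod (g x) \<le> B" and N: "0 < N"
  obtains f where "expsum f" "\<And>x. cmod (f x) \<le> B + 1"
    "\<And>x. \<bar>x\<bar> \<le> N \<Longrightarrow> cmod (f x - g x) \<le> 1 / N"
proof -
  \<comment> \<open>A cut-off that is \<open>1\<close> on the right half of the circle, which
    contains the arc, and vanishes at \<open>-1\<close>, where \<open>Arg\<close> jumps.\<close>
  define \<kappa> where "\<kappa> z = min 1 (Re z + 1)" for z
  define F where "F z = of_real (\<kappa> z) * g (N * Arg z)" for z
  have \<kappa>: "0 \<le> \<kappa> z" "\<kappa> z \<le> 1" if "z \<in> sphere 0 1" for z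
    using abs_Re_le_cmod[of z] that by (auto simp: \<kappa>_def)
  have FB: "cmod (F z) \<le> \<kappa> z * B" if "z \<in> sphere 0 1" for z
    using \<kappa>[OF that] g(2) by (auto simp: F_def norm_mult intro!: mult_left_mono)
  have "continuous_on (sphere 0 1) F"
    unfolding continuous_on_eq_continuous_within
  proof
    fix z :: complex assume z: "z \<in> sphere 0 1"
    show "continuous (at z within sphere 0 1) F"
    proof (cases "z = -1")
      case True
      have "(F \<longlongrightarrow> 0) (at z within sphere 0 1)"
      proof (rule Lim_null_comparison)
        show "\<forall>\<^sub>F w in at z within sphere 0 1. cmod (F w) \<le> \<kappa> w * B"
          using FB by (auto simp: eventually_at_filter)
        have "((\<lambda>w. min 1 (Re w + 1) * B) \<longlongrightarrow> min 1 (Re z + 1) * B) (at z within sphere 0 1)"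
          by (intro tendsto_intros)
        then show "((\<lambda>w. \<kappa> w * B) \<longlongrightarrow> 0) (at z within sphere 0 1)"
          by (simp add: \<kappa>_def True)
      qed
      moreover have "F z = 0" by (simp add: F_def \<kappa>_def True)
      ultimately show ?thesis by (simp add: continuous_within)
    next
      case False
      have "z \<notin> \<real>\<^sub>\<le>\<^sub>0"
      proof
        assume "z \<in> \<real>\<^sub>\<le>\<^sub>0"
        then obtain r where r: "z = of_real r" "r \<le> 0" by (auto elim: nonpos_Reals_cases)
        then have "r = -1" using z by simp
        with r False show False by simp
      qed
      then have "isCont Arg z" by (rule continuous_at_Arg)
      moreover have "isCont g x" for x using g(1) by (simp add: continuous_on_eq_continuous_at)
      ultimately have "isCont (g \<circ> (\<lambda>w. N * Arg w)) z"
        by (intro continuous_at_compose continuous_intros)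
      then have "isCont (\<lambda>w. g (N * Arg w)) z" by (simp add: o_def)
      then have "isCont F z"
        unfolding F_def[abs_def] \<kappa>_def by (intro continuous_intros linear_continuous_at[OF bounded_linear_Re])
      then show ?thesis by (rule continuous_at_imp_continuous_within)
    qed
  qed
  then obtain P where P: "polynomial_function P" "\<And>z. z \<in> sphere 0 1 \<Longrightarrow> cmod (F z - P z) < min 1 (1 / N)"
    using Stone_Weierstrass_polynomial_function[of "sphere 0 1" F "min 1 (1 / N)"] N by auto
  define f where "f x = P (cis (1 / N * x))" for x
  show ?thesis
  proof (rule that[of f])
    show "expsum f"
      unfolding f_def[abs_def] using expsum_rescale[OF expsum_polynomial_function[OF P(1)], of "1 / N"] by simp
    have cis: "cis y \<in> sphere 0 1" for y by simp
    have "B \<ge> 0" using order.trans[OF norm_ge_zero g(2)] .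
    then show "cmod (f x) \<le> B + 1" for x
      using P(2)[OF cis, of "1 / N * x"] FB[OF cis, of "1 / N * x"] \<kappa>[OF cis, of "1 / N * x"]
        norm_triangle_ineq3[of "P (cis (1 / N * x))" "F (cis (1 / N * x))"]
        mult_right_mono[of "\<kappa> (cis (1 / N * x))" 1 B]
      by (simp add: f_def norm_minus_commute) linarith
    show "cmod (f x - g x) \<le> 1 / N" if x: "\<bar>x\<bar> \<le> N" for x
    proof -
      have y: "\<bar>1 / N * x\<bar> \<le> 1" using x N by (simp add: abs_mult)
      then have y': "-1 \<le> 1 / N * x" "1 / N * x \<le> 1" by linarith+
      have "0 \<le> cos (1 / N * x)"
        using y' pi_gt3 by (intro cos_ge_zero) linarith+
      moreover have "Arg (cis (1 / N * x)) = 1 / N * x"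
        using y' pi_gt3 by (intro Arg_cis, unfold greaterThanAtMost_iff) linarith
      ultimately have "F (cis (1 / N * x)) = g x"
        using N by (simp add: F_def \<kappa>_def)
      then show ?thesis using P(2)[OF cis, of "1 / N * x"] by (simp add: f_def norm_minus_commute)
    qed
  qed
qed

text \<open>Measurable functions are almost everywhere limits of continuous functions. These
  approximants of \<open>h exp (x\<^sup>2/2)\<close> are projected to a ball that contains the
  range, so that they are uniformly bounded, and are replaced by exponential sums on intervals
  that grow with \<open>n\<close>. Outside such an interval only the uniform bound is known; this
  is enough, as the factor \<open>exp (-x\<^sup>2/2)\<close> makes the approximants \<open>exp
  (-x\<^sup>2/2) \<Phi>\<^sub>n\<close> dominated.\<close>

lemma gaussian_expsum_dense:
  fixes h :: "real \<Rightarrow> complex"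
  assumes h: "h \<in> borel_measurable borel" "\<And>x. cmod (h x) \<le> R" "\<And>x. R < \<bar>x\<bar> \<Longrightarrow> h x = 0"
  obtains \<Phi> :: "nat \<Rightarrow> real \<Rightarrow> complex" and C where "\<And>n. expsum (\<Phi> n)" "\<And>n x. cmod (\<Phi> n x) \<le> C"
    "AE x in lborel. (\<lambda>n. of_real (exp (- (x\<^sup>2 / 2))) * \<Phi> n x) \<longlonglongrightarrow> h x"
proof -
  define B where "B = exp (R\<^sup>2 / 2) * R"
  define H where "H x = of_real (exp (x\<^sup>2 / 2)) * h x" for x
  have HB: "cmod (H x) \<le> B" for x
  proof (cases "R < \<bar>x\<bar>")
    case False
    then have "x\<^sup>2 \<le> R\<^sup>2" using abs_le_square_iff[of x R] by linarith
    then show ?thesis using h(2)[of x] unfolding B_def H_def norm_mult by (intro mult_mono) auto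
  next
    case True
    then show ?thesis using h(3) order.trans[OF norm_ge_zero h(2)] by (simp add: H_def B_def)
  qed
  have B: "0 \<le> B" using order.trans[OF norm_ge_zero HB] .
  have "H \<in> borel_measurable borel"
    unfolding H_def[abs_def] using h(1) by measurable
  then have "H \<in> borel_measurable lborel" by simp
  then have "H \<in> borel_measurable lebesgue"
    by (rule measurable_completion)
  then have "H measurable_on UNIV"
    by (rule lebesgue_measurable_imp_measurable_on) simp
  then obtain S g where S: "negligible S" and g: "\<And>n. continuous_on UNIV (g n)"
    "\<And>x. x \<notin> S \<Longrightarrow> (\<lambda>n. g n x) \<longlonglongrightarrow> H x"
    unfolding measurable_on_def by auto
  define cp where "cp = closest_point (cball (0::complex) B)"
  have cp: "continuous_on UNIV cp" "cmod (cp z) \<le> B" for z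
    unfolding cp_def using B closest_point_in_set[of "cball 0 B" z]
    by (auto intro!: continuous_on_closest_point)
  have g': "continuous_on UNIV (\<lambda>x. cp (g n x))" for n
    by (rule continuous_on_compose2[OF cp(1) g(1)]) auto
  have "\<exists>f. expsum f \<and> (\<forall>x. cmod (f x) \<le> B + 1) \<and> (\<forall>x. \<bar>x\<bar> \<le> real (Suc n) \<longrightarrow> cmod (f x - cp (g n x)) \<le> 1 / real (Suc n))" for n
    by (rule bounded_continuous_expsum_approx[OF g' cp(2), of "real (Suc n)" n]) auto
  then obtain \<Phi> where \<Phi>: "\<And>n. expsum (\<Phi> n)" "\<And>n x. cmod (\<Phi> n x) \<le> B + 1"
    "\<And>n x. \<bar>x\<bar> \<le> real (Suc n) \<Longrightarrow> cmod (\<Phi> n x - cp (g n x)) \<le> 1 / real (Suc n)"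
    by metis
  have lim: "(\<lambda>n. of_real (exp (- (x\<^sup>2 / 2))) * \<Phi> n x) \<longlonglongrightarrow> h x" if x: "x \<notin> S" for x
  proof -
    have "isCont cp (H x)" using cp(1) by (simp add: continuous_on_eq_continuous_at)
    then have "(\<lambda>n. cp (g n x)) \<longlonglongrightarrow> cp (H x)"
      using g(2)[OF x] isCont_tendsto_compose by blast
    also have "cp (H x) = H x" unfolding cp_def using HB by (intro closest_point_self) simp
    finally have l1: "(\<lambda>n. cp (g n x)) \<longlonglongrightarrow> H x" .
    have "(\<lambda>n. \<Phi> n x - cp (g n x)) \<longlonglongrightarrow> 0"
    proof (rule Lim_null_comparison)
      obtain n0 where n0: "\<bar>x\<bar> \<le> real n0" using real_arch_simple by blast
      show "\<forall>\<^sub>F n in sequentially. cmod (\<Phi> n x - cp (g n x)) \<le> 1 / real (Suc n)"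
        using eventually_ge_at_top[of n0] by eventually_elim (use \<Phi>(3) n0 in auto)
      show "(\<lambda>n. 1 / real (Suc n)) \<longlonglongrightarrow> 0"
        using LIMSEQ_inverse_real_of_nat by (simp add: inverse_eq_divide)
    qed
    from tendsto_add[OF this l1] have "(\<lambda>n. \<Phi> n x) \<longlonglongrightarrow> H x" by simp
    from tendsto_mult_left[OF this, of "of_real (exp (- (x\<^sup>2 / 2)))"]
    have "(\<lambda>n. of_real (exp (- (x\<^sup>2 / 2))) * \<Phi> n x) \<longlonglongrightarrow> of_real (exp (- (x\<^sup>2 / 2))) * H x" .
    also have "of_real (exp (- (x\<^sup>2 / 2))) * H x = h x"
      by (simp add: H_def mult.assoc[symmetric] exp_minus flip: of_real_mult)
    finally show ?thesis .
  qed
  have "AE x in lebesgue. x \<notin> S"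
    using S by (auto simp: negligible_iff_null_sets intro: AE_not_in)
  then have "AE x in lborel. x \<notin> S"
    by (simp add: AE_completion_iff)
  then have "AE x in lborel. (\<lambda>n. of_real (exp (- (x\<^sup>2 / 2))) * \<Phi> n x) \<longlonglongrightarrow> h x"
    by eventually_elim (rule lim)
  with \<Phi> that show ?thesis by blast
qed

text \<open>By linearity \<open>g\<close> is orthogonal to \<open>exp (-x\<^sup>2/2)\<close> times
  every exponential sum. Approximating a truncation of the complex conjugate of \<open>g\<close>
  by such functions shows that the integral of \<open>|g|\<^sup>2\<close> over the set where
  \<open>|x|\<close> and \<open>|g|\<close> are at most \<open>n\<close> is zero.\<close>

lemma gaussian_fourier_injective:
  fixes g :: "real \<Rightarrow> complex"
  assumes g: "g \<in> borel_measurable borel"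
    and int: "integrable lborel (\<lambda>x. g x * of_real (exp (- (x\<^sup>2 / 2))))"
    and zero: "\<And>a. (LINT x|lborel. g x * (of_real (exp (- (x\<^sup>2 / 2))) * cis (a * x))) = 0"
  shows "AE x in lborel. g x = 0"
proof -
  let ?e = "\<lambda>x. complex_of_real (exp (- (x\<^sup>2 / 2)))"
  have es: "integrable lborel (\<lambda>x. g x * (?e x * f x)) \<and> (LINT x|lborel. g x * (?e x * f x)) = 0" if "expsum f" for f
    using that
  proof (induction rule: expsum.induct)
    case (single c a)
    have "(\<lambda>x. ?e x * cis (a * x)) \<in> borel_measurable borel"
      by (intro borel_measurable_continuous_onI continuous_intros) auto
    then have i: "integrable lborel (\<lambda>x. g x * (?e x * cis (a * x)))"
      by (intro Bochner_Integration.integrable_bound[OF int]) (use g in \<open>auto simp: norm_mult\<close>)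
    have "(\<lambda>x. g x * (?e x * (c * cis (a * x)))) = (\<lambda>x. c * (g x * (?e x * cis (a * x))))" by auto
    then show ?case using i zero[of a] by simp
  next
    case (add f1 f2)
    then show ?case by (simp add: distrib_left)
  qed
  have "AE x in lborel. \<bar>x\<bar> \<le> real n \<and> cmod (g x) \<le> real n \<longrightarrow> g x = 0" for n
  proof -
    define h where "h x = (if \<bar>x\<bar> \<le> real n \<and> cmod (g x) \<le> real n then cnj (g x) else 0)" for x
    note g[measurable]
    have cnj[measurable]: "(\<lambda>x. cnj (g x)) \<in> borel_measurable borel"
      by (rule borel_measurable_continuous_on[OF _ g]) (intro continuous_intros)
    have h: "h \<in> borel_measurable borel"
      unfolding h_def[abs_def] by measurable
    have hb: "cmod (h x) \<le> real n" and h0: "real n < \<bar>x\<bar> \<Longrightarrow> h x = 0" for x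
      by (auto simp: h_def)
    obtain \<Phi> C where \<Phi>: "\<And>n. expsum (\<Phi> n)" "\<And>n x. cmod (\<Phi> n x) \<le> C"
      "AE x in lborel. (\<lambda>n. ?e x * \<Phi> n x) \<longlonglongrightarrow> h x"
    proof (rule gaussian_expsum_dense[OF h hb])
      show "h x = 0" if "real n < \<bar>x\<bar>" for x using that by (rule h0)
    qed (rule that)
    have C: "integrable lborel (\<lambda>x. C * cmod (g x * ?e x))" using int by auto
    have "(\<lambda>k. LINT x|lborel. g x * (?e x * \<Phi> k x)) \<longlonglongrightarrow> (LINT x|lborel. g x * h x)"
    proof (rule integral_dominated_convergence[OF _ _ C])
      show "(\<lambda>x. g x * h x) \<in> borel_measurable lborel" using g h by simp
      show "(\<lambda>x. g x * (?e x * \<Phi> k x)) \<in> borel_measurable lborel" for k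
        using es[OF \<Phi>(1)] by (intro borel_measurable_integrable) auto
      show "AE x in lborel. (\<lambda>k. g x * (?e x * \<Phi> k x)) \<longlonglongrightarrow> g x * h x"
        using \<Phi>(3) by eventually_elim (rule tendsto_mult_left)
      show "AE x in lborel. cmod (g x * (?e x * \<Phi> k x)) \<le> C * cmod (g x * ?e x)" for k
      proof (rule AE_I2)
        fix x
        show "cmod (g x * (?e x * \<Phi> k x)) \<le> C * cmod (g x * ?e x)"
          using mult_right_mono[OF \<Phi>(2)[of k x], of "cmod (g x * ?e x)"] by (simp add: norm_mult mult_ac)
      qed
    qed
    moreover have "(LINT x|lborel. g x * (?e x * \<Phi> k x)) = 0" for k using es[OF \<Phi>(1)] by simp
    ultimately have 0: "(LINT x|lborel. g x * h x) = 0" by (simp add: LIMSEQ_const_iff)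
    define w where "w x = (if \<bar>x\<bar> \<le> real n \<and> cmod (g x) \<le> real n then (cmod (g x))\<^sup>2 else 0)" for x
    have gh: "g x * h x = of_real (w x)" for x
      using complex_norm_square[of "g x"] by (simp add: h_def w_def)
    have wm: "w \<in> borel_measurable borel" unfolding w_def[abs_def] by measurable
    have "integrable lborel (\<lambda>x. indicator {- real n..real n} x *\<^sub>R (real n)\<^sup>2)"
      by simp
    then have wi: "integrable lborel w"
    proof (rule Bochner_Integration.integrable_bound)
      show "AE x in lborel. norm (w x) \<le> norm (indicator {- real n..real n} x *\<^sub>R (real n)\<^sup>2)"
        by (intro AE_I2) (auto simp: w_def indicator_def abs_le_iff power_mono)
    qed (use wm in simp)
    have "of_real (LINT x|lborel. w x) = (0::complex)"
      using 0 by (simp add: gh)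
    then have "(LINT x|lborel. w x) = 0" by simp
    moreover have "AE x in lborel. 0 \<le> w x" by (simp add: w_def)
    ultimately have "AE x in lborel. w x = 0"
      using integral_nonneg_eq_0_iff_AE[OF wi] by blast
    then show ?thesis by eventually_elim (auto simp: w_def)
  qed
  then have "AE x in lborel. \<forall>n. \<bar>x\<bar> \<le> real n \<and> cmod (g x) \<le> real n \<longrightarrow> g x = 0"
    unfolding AE_all_countable by blast
  then show ?thesis
  proof eventually_elim
    case (elim x)
    obtain n where "max \<bar>x\<bar> (cmod (g x)) \<le> real n" using real_arch_simple by blast
    then show ?case using elim[rule_format, of n] by simp
  qed
qed

section \<open>Fourier transforms of decaying functions\<close>

text \<open>The seminorm of order \<open>0\<close> is the supremum norm on both domains, so a
  function that is bounded by \<open>rho\<close> defines a distribution of order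
  \<open>0\<close>.\<close>

lemma test_function_bound:
  assumes "\<phi> \<in> test_functions M"
  shows "continuous_on UNIV \<phi>" and "cmod (\<phi> x) \<le> test_seminorm M 0 \<phi>"
proof -
  have "smooth_fun \<phi>"
    using assms by (cases M) (auto simp: test_functions_def schwartz_def)
  then have d: "\<phi> differentiable (at x)" for x
    unfolding smooth_fun_def by (metis funpow_0)
  then show c: "continuous_on UNIV \<phi>"
    by (intro continuous_at_imp_continuous_on ballI differentiable_imp_continuous_within)
  have "bounded (range \<phi>)"
  proof (cases M)
    case Line
    then have "\<forall>j k. bounded (range (\<lambda>x. complex_of_real (x ^ j) * (vderiv ^^ k) \<phi> x))"
      using assms by (auto simp: test_functions_def schwartz_def)
    from this[rule_format, of 0 0] show ?thesis by simp
  next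
    case Torus
    then have per: "function_on Torus \<phi>" using assms by (auto simp: test_functions_def)
    have "range \<phi> \<subseteq> \<phi> ` {0..2 * pi}"
    proof
      fix z assume "z \<in> range \<phi>"
      then obtain x where "z = \<phi> x" by auto
      then show "z \<in> \<phi> ` {0..2 * pi}"
        by (metis torus_representative[OF per, of x] atLeastAtMost_iff image_eqI less_imp_le)
    qed
    moreover have "bounded (\<phi> ` {0..2 * pi})"
      by (intro compact_imp_bounded compact_continuous_image continuous_on_subset[OF c]) auto
    ultimately show ?thesis by (rule bounded_subset[rotated])
  qed
  then have "bdd_above (range (\<lambda>x. cmod (\<phi> x)))"
    unfolding bounded_iff bdd_above_def by auto
  then have "cmod (\<phi> x) \<le> (SUP x. cmod (\<phi> x))"
    by (intro cSUP_upper) auto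
  then show "cmod (\<phi> x) \<le> test_seminorm M 0 \<phi>"
    by (cases M) (simp_all add: test_seminorm_def)
qed

lemma decaying_times_bounded:
  fixes \<phi> :: "real \<Rightarrow> complex"
  assumes v: "decaying M C v" and "continuous_on UNIV \<phi>" "\<And>x. cmod (\<phi> x) \<le> B"
  shows "set_integrable lborel (cell M) (\<lambda>x. complex_of_real (v x) * \<phi> x)"
    and "cmod (LINT x:cell M|lborel. complex_of_real (v x) * \<phi> x) \<le> C * B * rho_mass M"
proof -
  have m: "(\<lambda>x. complex_of_real (v x) * \<phi> x) \<in> borel_measurable borel"
    by (intro borel_measurable_continuous_onI continuous_intros assms decayingD(1)[OF v])
  have b: "norm (complex_of_real (v x) * \<phi> x) \<le> (C * B) * rho M x" for x
    using mult_mono[OF decayingD(3)[OF v] assms(3), of x x] decaying_const_nonneg[OF v]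
    by (simp add: norm_mult mult_ac)
  show "set_integrable lborel (cell M) (\<lambda>x. complex_of_real (v x) * \<phi> x)"
    by (rule integrable_of_rho_bound[OF m b])
  show "cmod (LINT x:cell M|lborel. complex_of_real (v x) * \<phi> x) \<le> C * B * rho_mass M"
    using integral_of_rho_bound[OF m b] by simp
qed

lemma regular_fun_decaying:
  assumes v: "decaying M C v" shows "regular_fun M v"
  unfolding regular_fun_def
  using decayingD(2)[OF v] decaying_times_bounded(1)[OF v] test_function_bound by metis

lemma distribution_decaying:
  assumes v: "decaying M C v" shows "distribution M (dist_of_fun M v)"
  unfolding distribution_def
proof (intro conjI ballI allI)
  fix f g :: "real \<Rightarrow> complex" and a b
  assume f: "f \<in> test_functions M" and g: "g \<in> test_functions M"
  note i = decaying_times_bounded(1)[OF v test_function_bound]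
  have "dist_of_fun M v (\<lambda>x. a * f x + b * g x) =
      (LINT x:cell M|lborel. a * (complex_of_real (v x) * f x) + b * (complex_of_real (v x) * g x))"
    unfolding dist_of_fun_def by (simp add: algebra_simps)
  also have "\<dots> = a * dist_of_fun M v f + b * dist_of_fun M v g"
    using i[OF f f] i[OF g g] by (simp add: dist_of_fun_def set_integral_add)
  finally show "dist_of_fun M v (\<lambda>x. a * f x + b * g x) = a * dist_of_fun M v f + b * dist_of_fun M v g" .
next
  show "\<exists>K N. \<forall>f\<in>test_functions M. cmod (dist_of_fun M v f) \<le> K * test_seminorm M N f"
    using decaying_times_bounded(2)[OF v test_function_bound]
    by (intro exI[of _ "C * rho_mass M"] exI[of _ 0]) (auto simp: dist_of_fun_def mult_ac)
qed

text \<open>The frequencies for which \<open>cis (x \<xi>)\<close> is a function on the domain, so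
  that integration by parts against it leaves no boundary terms.\<close>

definition freqs :: "spatial_domain \<Rightarrow> real set" where
  "freqs M = (case M of Line \<Rightarrow> UNIV | Torus \<Rightarrow> \<int>)"

definition fourier_scale :: "spatial_domain \<Rightarrow> real" where
  "fourier_scale M = (case M of Line \<Rightarrow> 1 | Torus \<Rightarrow> 2 * pi)"

definition cos_transform :: "spatial_domain \<Rightarrow> (real \<Rightarrow> real) \<Rightarrow> real \<Rightarrow> real" where
  "cos_transform M v \<xi> = (LINT x:cell M|lborel. cos (\<xi> * x) * v x)"

definition sin_transform :: "spatial_domain \<Rightarrow> (real \<Rightarrow> real) \<Rightarrow> real \<Rightarrow> real" where
  "sin_transform M v \<xi> = (LINT x:cell M|lborel. sin (\<xi> * x) * v x)"

text \<open>The transform of a real function is kept as a pair of real integrals, because the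
  growth of low frequencies is measured with the sine transform alone.\<close>

definition ft :: "spatial_domain \<Rightarrow> (real \<Rightarrow> real) \<Rightarrow> real \<Rightarrow> complex" where
  "ft M v \<xi> = Complex (cos_transform M v \<xi>) (- sin_transform M v \<xi>) / of_real (fourier_scale M)"

lemma fourier_scale_ge_1: "1 \<le> fourier_scale M"
  using pi_gt3 by (cases M) (auto simp: fourier_scale_def)

lemma continuous_cis_linear: "continuous_on A (\<lambda>x::real. cis (- (x * \<xi>)))"
  by (intro continuous_intros)

lemma ft_eq_integral:
  assumes v: "decaying M C v"
  shows "(LINT x:cell M|lborel. complex_of_real (v x) * cis (- (x * \<xi>))) = of_real (fourier_scale M) * ft M v \<xi>"
proof -
  let ?f = "\<lambda>x. indicator (cell M) x *\<^sub>R (complex_of_real (v x) * cis (- (x * \<xi>)))"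
  have i: "integrable lborel ?f"
    using decaying_times_bounded(1)[OF v continuous_cis_linear[of _ \<xi>], of 1] by (simp add: set_integrable_def)
  have "Re (LINT x|lborel. ?f x) = (LINT x|lborel. Re (?f x))"
    using integral_bounded_linear[OF bounded_linear_Re i] by simp
  also have "\<dots> = cos_transform M v \<xi>"
    unfolding cos_transform_def set_lebesgue_integral_def
    by (rule Bochner_Integration.integral_cong) (simp_all add: mult_ac)
  finally have re: "Re (LINT x|lborel. ?f x) = cos_transform M v \<xi>" .
  have "Im (LINT x|lborel. ?f x) = (LINT x|lborel. Im (?f x))"
    using integral_bounded_linear[OF bounded_linear_Im i] by simp
  also have "\<dots> = - sin_transform M v \<xi>"
    unfolding sin_transform_def set_lebesgue_integral_def Bochner_Integration.integral_minus[symmetric]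
    by (rule Bochner_Integration.integral_cong) (simp_all add: mult_ac)
  finally have "(LINT x|lborel. ?f x) = Complex (cos_transform M v \<xi>) (- sin_transform M v \<xi>)"
    using re by (simp add: complex_eq_iff)
  then show ?thesis
    using fourier_scale_ge_1[of M] by (simp add: ft_def set_lebesgue_integral_def)
qed

lemma ft_bound:
  assumes v: "decaying M C v" shows "cmod (ft M v \<xi>) \<le> C * rho_mass M"
proof -
  have "fourier_scale M * cmod (ft M v \<xi>) \<le> C * rho_mass M"
    using decaying_times_bounded(2)[OF v continuous_cis_linear[of _ \<xi>], of 1] fourier_scale_ge_1[of M]
    by (simp add: ft_eq_integral[OF v] norm_mult)
  moreover have "1 * cmod (ft M v \<xi>) \<le> fourier_scale M * cmod (ft M v \<xi>)"
    by (intro mult_right_mono fourier_scale_ge_1) auto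
  ultimately show ?thesis by simp
qed

lemma decaying_times_bounded_real:
  assumes v: "decaying M C v" and "continuous_on UNIV q" "\<And>x. \<bar>q x\<bar> \<le> B"
  shows "set_integrable lborel (cell M) (\<lambda>x. q x * v x)"
    and "\<bar>LINT x:cell M|lborel. q x * v x\<bar> \<le> C * B * rho_mass M"
proof -
  have m: "(\<lambda>x. q x * v x) \<in> borel_measurable borel"
    by (intro borel_measurable_continuous_onI continuous_intros assms decayingD(1)[OF v])
  have b: "norm (q x * v x) \<le> (C * B) * rho M x" for x
    using mult_mono[OF decayingD(3)[OF v] assms(3), of x x] decaying_const_nonneg[OF v]
    by (simp add: abs_mult mult_ac)
  show "set_integrable lborel (cell M) (\<lambda>x. q x * v x)"
    by (rule integrable_of_rho_bound[OF m b])
  show "\<bar>LINT x:cell M|lborel. q x * v x\<bar> \<le> C * B * rho_mass M"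
    using integral_of_rho_bound[OF m b] by simp
qed

lemma transform_integrable:
  assumes "decaying M C v"
  shows "set_integrable lborel (cell M) (\<lambda>x. cos (\<xi> * x) * v x)"
    and "set_integrable lborel (cell M) (\<lambda>x. sin (\<xi> * x) * v x)"
  by (rule decaying_times_bounded_real[OF assms, where B = 1]; auto intro!: continuous_intros)+

lemma ft_diff:
  assumes v: "decaying M C v" and w: "decaying M D w"
  shows "ft M (\<lambda>x. v x - w x) \<xi> = ft M v \<xi> - ft M w \<xi>"
proof -
  have "cos_transform M (\<lambda>x. v x - w x) \<xi> = cos_transform M v \<xi> - cos_transform M w \<xi>"
    "sin_transform M (\<lambda>x. v x - w x) \<xi> = sin_transform M v \<xi> - sin_transform M w \<xi>"
    unfolding cos_transform_def sin_transform_def right_diff_distrib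
    by (intro set_integral_diff(2) transform_integrable[OF v] transform_integrable[OF w])+
  then show ?thesis
    by (simp add: ft_def complex_eq_iff diff_divide_distrib)
qed

lemma trig_periodic:
  assumes "\<xi> \<in> freqs M"
  shows "function_on M (\<lambda>x. cos (\<xi> * x))" and "function_on M (\<lambda>x. sin (\<xi> * x))"
proof -
  have "cos (\<xi> * (x + 2 * pi)) = cos (\<xi> * x) \<and> sin (\<xi> * (x + 2 * pi)) = sin (\<xi> * x)"
    if int: "\<xi> \<in> \<int>" for x
  proof -
    obtain k where k: "\<xi> = of_int k" using int by (auto elim: Ints_cases)
    have e: "\<xi> * (x + 2 * pi) = \<xi> * x + 2 * pi * of_int k" by (simp add: k algebra_simps)
    have "cos (2 * pi * of_int k) = 1" "sin (2 * pi * of_int k) = 0"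
      using cos_int_2pin[of k] sin_int_2pin[of k] by (simp_all add: mult_ac)
    then show ?thesis unfolding e cos_add sin_add by simp
  qed
  with assms show "function_on M (\<lambda>x. cos (\<xi> * x))" "function_on M (\<lambda>x. sin (\<xi> * x))"
    by (auto simp: function_on_def freqs_def split: spatial_domain.splits)
qed

lemma decaying_bounded_mult:
  assumes v: "decaying M C v" and q: "continuous_on UNIV q" "function_on M q" "\<And>x. \<bar>q x\<bar> \<le> B"
  shows "decaying M (C * B) (\<lambda>x. q x * v x)"
proof -
  have "\<bar>q x * v x\<bar> \<le> (C * B) * rho M x" for x
    using mult_mono[OF decayingD(3)[OF v] q(3), of x x] decaying_const_nonneg[OF v]
    by (simp add: abs_mult mult_ac)
  then show ?thesis
    using decayingD(1,2)[OF v] q by (auto simp: decaying_def dominated_def function_on_def intro!: continuous_intros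
        split: spatial_domain.splits)
qed

lemma decaying_trig_mult:
  assumes "decaying M C v" "\<xi> \<in> freqs M"
  shows "decaying M C (\<lambda>x. cos (\<xi> * x) * v x)" and "decaying M C (\<lambda>x. sin (\<xi> * x) * v x)"
proof -
  have "decaying M (C * 1) (\<lambda>x. cos (\<xi> * x) * v x)" "decaying M (C * 1) (\<lambda>x. sin (\<xi> * x) * v x)"
    by (rule decaying_bounded_mult[OF assms(1)]; use trig_periodic[OF assms(2)] in \<open>auto intro!: continuous_intros\<close>)+
  then show "decaying M C (\<lambda>x. cos (\<xi> * x) * v x)" "decaying M C (\<lambda>x. sin (\<xi> * x) * v x)" by simp_all
qed

lemma cell_integral_derivative':
  assumes J: "decaying M C J" and J': "decaying M D J'"
    and d: "\<And>x. (J has_real_derivative J' x) (at x)"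
  shows "(LINT x:cell M|lborel. J' x) = 0"
proof (rule cell_integral_derivative[OF d decayingD(1)[OF J'] decayingD(2)[OF J]])
  show "\<bar>J x\<bar> \<le> max C D * rho M x" "\<bar>J' x\<bar> \<le> max C D * rho M x" for x
    using decayingD(3)[OF decaying_mono[OF J, of "max C D"]] decayingD(3)[OF decaying_mono[OF J', of "max C D"]] by auto
qed

text \<open>Integration by parts: the functions \<open>cos (\<xi> x) v x\<close> and \<open>sin
  (\<xi> x) v x\<close> have derivatives with integral zero.\<close>

lemma transform_derivative:
  assumes v: "decaying M C v" and v': "decaying M D v'"
    and d: "\<And>x. (v has_real_derivative v' x) (at x)" and \<xi>: "\<xi> \<in> freqs M"
  shows "cos_transform M v' \<xi> = \<xi> * sin_transform M v \<xi>" and "sin_transform M v' \<xi> = - \<xi> * cos_transform M v \<xi>"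
proof -
  note t = decaying_trig_mult[OF v \<xi>] decaying_trig_mult[OF v' \<xi>]
  have scale: "decaying M (\<bar>r\<bar> * B) (\<lambda>x. r * f x)" if "decaying M B f" for r B f
    by (rule decaying_lipschitz_comp[OF that]) (auto simp: abs_mult right_diff_distrib[symmetric])
  have "0 = (LINT x:cell M|lborel. cos (\<xi> * x) * v' x + (- \<xi>) * (sin (\<xi> * x) * v x))"
    by (rule cell_integral_derivative'[symmetric, OF t(1) decaying_add[OF t(3) scale[OF t(2)]]])
      (auto intro!: derivative_eq_intros d)
  also have "(LINT x:cell M|lborel. cos (\<xi> * x) * v' x + (- \<xi>) * (sin (\<xi> * x) * v x)) =
      (LINT x:cell M|lborel. cos (\<xi> * x) * v' x) + (LINT x:cell M|lborel. (- \<xi>) * (sin (\<xi> * x) * v x))"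
    by (intro set_integral_add(2) transform_integrable[OF v'] set_integrable_mult_right transform_integrable[OF v])
  finally show "cos_transform M v' \<xi> = \<xi> * sin_transform M v \<xi>"
    unfolding cos_transform_def sin_transform_def set_integral_mult_right by simp
  have "0 = (LINT x:cell M|lborel. sin (\<xi> * x) * v' x + \<xi> * (cos (\<xi> * x) * v x))"
    by (rule cell_integral_derivative'[symmetric, OF t(2) decaying_add[OF t(4) scale[OF t(1)]]])
      (auto intro!: derivative_eq_intros d)
  also have "(LINT x:cell M|lborel. sin (\<xi> * x) * v' x + \<xi> * (cos (\<xi> * x) * v x)) =
      (LINT x:cell M|lborel. sin (\<xi> * x) * v' x) + (LINT x:cell M|lborel. \<xi> * (cos (\<xi> * x) * v x))"
    by (intro set_integral_add(2) transform_integrable[OF v'] set_integrable_mult_right transform_integrable[OF v])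
  finally show "sin_transform M v' \<xi> = - \<xi> * cos_transform M v \<xi>"
    unfolding cos_transform_def sin_transform_def set_integral_mult_right by simp
qed

lemma ft_derivative:
  assumes "decaying M C v" "decaying M D v'" "\<And>x. (v has_real_derivative v' x) (at x)" "\<xi> \<in> freqs M"
  shows "ft M v' \<xi> = \<i> * of_real \<xi> * ft M v \<xi>"
  using transform_derivative[OF assms] by (simp add: ft_def complex_eq_iff)

lemma ft_measurable:
  assumes v: "decaying M C v" shows "ft M v \<in> borel_measurable (freq_measure M)"
proof (cases M)
  case Line
  note decayingD(4)[OF v, measurable]
  have "cos_transform M v \<in> borel_measurable borel" "sin_transform M v \<in> borel_measurable borel"
    unfolding cos_transform_def[abs_def] sin_transform_def[abs_def] set_lebesgue_integral_def
    by (rule lborel.borel_measurable_lebesgue_integral, measurable)+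
  then have "ft M v \<in> borel_measurable borel"
    unfolding ft_def[abs_def] Complex_eq by measurable
  then show ?thesis by (simp add: Line freq_measure_def)
qed (simp add: freq_measure_def)

lemma integrable_inverse_weight: "integrable (freq_measure M) (\<lambda>\<xi>. inverse (1 + \<xi>\<^sup>2))"
proof (cases M)
  case Line
  then show ?thesis
    using integrable_inverse_1_plus_square by (simp add: freq_measure_def set_integrable_def)
next
  case Torus
  let ?f = "\<lambda>\<xi>::real. inverse (1 + \<xi>\<^sup>2)"
  have "summable (\<lambda>n. norm (?f (real n)))"
  proof (rule summable_comparison_test')
    show "summable (\<lambda>n. inverse (real n ^ 2))" by (rule inverse_power_summable) simp
    show "norm (norm (?f (real n))) \<le> inverse (real n ^ 2)" if "1 \<le> n" for n
      using that by (auto intro!: le_imp_inverse_le)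
  qed
  then have s: "Infinite_Set_Sum.abs_summable_on (\<lambda>n. ?f (real n)) UNIV" "Infinite_Set_Sum.abs_summable_on (\<lambda>n. ?f (- real n)) UNIV"
    by (simp_all add: abs_summable_on_nat_iff')
  have "Infinite_Set_Sum.abs_summable_on ?f (range real)" "Infinite_Set_Sum.abs_summable_on ?f (range (\<lambda>n. - real n))"
    using s by (simp_all add: abs_summable_on_reindex_iff[symmetric] inj_on_def)
  then have "Infinite_Set_Sum.abs_summable_on ?f (range real \<union> range (\<lambda>n. - real n))"
    by (rule abs_summable_on_union)
  moreover have "range real \<union> range (\<lambda>n. - real n) = (\<int> :: real set)"
  proof -
    have "x \<in> range real \<union> range (\<lambda>n. - real n)" if "x \<in> \<int>" for x :: real
    proof -
      obtain k where k: "x = of_int k" using \<open>x \<in> \<int>\<close> by (auto elim: Ints_cases)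
      show ?thesis
      proof (cases "0 \<le> k")
        case True
        then have "x = real (nat k)" by (simp add: k)
        then show ?thesis by blast
      next
        case False
        then have "x = - real (nat (- k))" by (simp add: k)
        then show ?thesis by blast
      qed
    qed
    then show ?thesis by auto
  qed
  ultimately show ?thesis
    by (simp add: Torus freq_measure_def abs_summable_on_def)
qed

lemma AE_freqs: "AE \<xi> in freq_measure M. \<xi> \<in> freqs M"
  by (cases M) (auto simp: freq_measure_def freqs_def AE_count_space)

lemma weight_measurable [measurable]:
  "(\<lambda>\<xi>. (1 + \<xi>\<^sup>2) powr s) \<in> borel_measurable (freq_measure M)"
  by (cases M) (auto simp: freq_measure_def)

text \<open>Decay of \<open>g\<close> like \<open>(1 + \<xi>\<^sup>2)\<^sup>-\<^sup>m\<close>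
  leaves the integrand below \<open>K\<^sup>2 / (1 + \<xi>\<^sup>2)\<close>, which is integrable
  for the Lebesgue measure and summable over the integers.\<close>

lemma sobolev_integral_bound:
  assumes g: "g \<in> borel_measurable (freq_measure M)"
    and b: "\<And>\<xi>. \<xi> \<in> freqs M \<Longrightarrow> (1 + \<xi>\<^sup>2) ^ m * cmod (g \<xi>) \<le> K" and m: "\<sigma> + 1 \<le> 2 * real m"
  shows "integrable (freq_measure M) (\<lambda>\<xi>. (1 + \<xi>\<^sup>2) powr \<sigma> * (cmod (g \<xi>))\<^sup>2)"
    and "(LINT \<xi>|freq_measure M. (1 + \<xi>\<^sup>2) powr \<sigma> * (cmod (g \<xi>))\<^sup>2) \<le> K\<^sup>2 * (LINT \<xi>|freq_measure M. inverse (1 + \<xi>\<^sup>2))"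
proof -
  have p: "(1 + \<xi>\<^sup>2) powr \<sigma> * (cmod (g \<xi>))\<^sup>2 \<le> K\<^sup>2 * inverse (1 + \<xi>\<^sup>2)" if "\<xi> \<in> freqs M" for \<xi>
  proof -
    have pos: "1 \<le> 1 + \<xi>\<^sup>2" by simp
    have "(1 + \<xi>\<^sup>2) powr \<sigma> \<le> (1 + \<xi>\<^sup>2) powr (2 * real m - 1)"
      using m pos by (intro powr_mono) auto
    also have "\<dots> = ((1 + \<xi>\<^sup>2) ^ m)\<^sup>2 * inverse (1 + \<xi>\<^sup>2)"
    proof -
      have "(1 + \<xi>\<^sup>2) powr (2 * real m - 1) = (1 + \<xi>\<^sup>2) powr real (m * 2) / (1 + \<xi>\<^sup>2) powr 1"
        by (simp only: powr_diff[symmetric] of_nat_mult of_nat_numeral mult.commute)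
      also have "(1 + \<xi>\<^sup>2) powr real (m * 2) = ((1 + \<xi>\<^sup>2) ^ m)\<^sup>2"
        using pos by (subst powr_realpow) (auto simp only: power_mult)
      finally show ?thesis using pos by (simp add: divide_inverse)
    qed
    finally have "(1 + \<xi>\<^sup>2) powr \<sigma> * (cmod (g \<xi>))\<^sup>2 \<le> ((1 + \<xi>\<^sup>2) ^ m)\<^sup>2 * inverse (1 + \<xi>\<^sup>2) * (cmod (g \<xi>))\<^sup>2"
      by (rule mult_right_mono) simp
    also have "\<dots> = ((1 + \<xi>\<^sup>2) ^ m * cmod (g \<xi>))\<^sup>2 * inverse (1 + \<xi>\<^sup>2)"
      by (simp only: power_mult_distrib mult_ac)
    also have "\<dots> \<le> K\<^sup>2 * inverse (1 + \<xi>\<^sup>2)"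
      using b[OF that] by (intro mult_right_mono power_mono) auto
    finally show ?thesis .
  qed
  have ae: "AE \<xi> in freq_measure M. (1 + \<xi>\<^sup>2) powr \<sigma> * (cmod (g \<xi>))\<^sup>2 \<le> K\<^sup>2 * inverse (1 + \<xi>\<^sup>2)"
    using AE_freqs by eventually_elim (rule p)
  have i: "integrable (freq_measure M) (\<lambda>\<xi>. K\<^sup>2 * inverse (1 + \<xi>\<^sup>2))"
    using integrable_inverse_weight by auto
  show int: "integrable (freq_measure M) (\<lambda>\<xi>. (1 + \<xi>\<^sup>2) powr \<sigma> * (cmod (g \<xi>))\<^sup>2)"
  proof (rule Bochner_Integration.integrable_bound[OF i])
    show "AE \<xi> in freq_measure M. norm ((1 + \<xi>\<^sup>2) powr \<sigma> * (cmod (g \<xi>))\<^sup>2) \<le> norm (K\<^sup>2 * inverse (1 + \<xi>\<^sup>2))"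
      using ae by eventually_elim (simp add: abs_mult)
  qed (use g in measurable)
  show "(LINT \<xi>|freq_measure M. (1 + \<xi>\<^sup>2) powr \<sigma> * (cmod (g \<xi>))\<^sup>2) \<le> K\<^sup>2 * (LINT \<xi>|freq_measure M. inverse (1 + \<xi>\<^sup>2))"
    using integral_mono_AE[OF int i ae] by simp
qed

section \<open>Distributional Fourier transforms and Sobolev norms\<close>

lemma schwartz_integrable:
  assumes "\<phi> \<in> schwartz"
  shows "\<phi> \<in> borel_measurable borel" and "integrable lborel \<phi>"
proof -
  have t: "\<phi> \<in> test_functions Line" using assms by (simp add: test_functions_def)
  show m: "\<phi> \<in> borel_measurable borel"
    by (rule borel_measurable_continuous_onI[OF test_function_bound(1)[OF t]])
  have b: "bounded (range (\<lambda>x. complex_of_real (x ^ j) * (vderiv ^^ k) \<phi> x))" for j k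
    using assms by (simp add: schwartz_def)
  obtain B0 where B0: "\<And>x. cmod (\<phi> x) \<le> B0"
    using b[of 0 0] by (auto simp: bounded_iff)
  obtain B2 where B2: "\<And>x. x\<^sup>2 * cmod (\<phi> x) \<le> B2"
    using b[of 2 0] by (auto simp: bounded_iff norm_mult norm_power)
  have i: "integrable lborel (\<lambda>x. (B0 + B2) * inverse (1 + x\<^sup>2))"
    using integrable_inverse_weight[of Line] by (simp add: freq_measure_def)
  show "integrable lborel \<phi>"
  proof (rule Bochner_Integration.integrable_bound[OF i])
    show "AE x in lborel. norm (\<phi> x) \<le> norm ((B0 + B2) * inverse (1 + x\<^sup>2))"
    proof (rule AE_I2)
      fix x
      have "(1 + x\<^sup>2) * cmod (\<phi> x) \<le> B0 + B2"
        using B0[of x] B2[of x] by (simp add: distrib_right)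
      moreover have "0 < 1 + x\<^sup>2" by (simp add: add_pos_nonneg)
      ultimately have "cmod (\<phi> x) \<le> (B0 + B2) * inverse (1 + x\<^sup>2)"
        by (simp add: field_simps)
      then show "norm (\<phi> x) \<le> norm ((B0 + B2) * inverse (1 + x\<^sup>2))" by simp
    qed
  qed (use m in simp)
qed

text \<open>On the line this is Fubini's theorem for \<open>v x cis (- x \<xi>) \<phi>
  \<xi>\<close>.\<close>

lemma has_fourier_decaying:
  assumes v: "decaying M C v"
  shows "has_fourier M (dist_of_fun M v) (ft M v)"
proof (cases M)
  case Torus
  then show ?thesis
    using ft_eq_integral[OF v] by (simp add: has_fourier_def dist_of_fun_def fourier_scale_def)
next
  case Line
  have m[measurable]: "ft Line v \<in> borel_measurable borel"
    using ft_measurable[OF v] by (simp add: Line freq_measure_def)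
  have vm[measurable]: "v \<in> borel_measurable borel" using decayingD(4)[OF v] .
  have vi: "integrable lborel v"
    using integrable_of_rho_bound[of v C Line] decayingD(3)[OF v] vm
    by (simp add: Line cell_def set_integrable_def)
  have ft: "ft Line v \<xi> = (LINT x|lborel. complex_of_real (v x) * cis (- (x * \<xi>)))" for \<xi>
    using ft_eq_integral[OF v, of \<xi>] by (simp add: Line fourier_scale_def cell_def set_lebesgue_integral_def)
  have "integrable lborel (\<lambda>\<xi>. ft Line v \<xi> * \<phi> \<xi>) \<and>
      dist_of_fun Line v (fourier \<phi>) = (LINT \<xi>|lborel. ft Line v \<xi> * \<phi> \<xi>)" if \<phi>: "\<phi> \<in> schwartz" for \<phi>
  proof
    note \<phi>m[measurable] = schwartz_integrable(1)[OF \<phi>] and \<phi>i = schwartz_integrable(2)[OF \<phi>]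
    have b: "cmod (ft Line v \<xi>) \<le> C * rho_mass Line" for \<xi>
      using ft_bound[OF v] Line by simp
    show "integrable lborel (\<lambda>\<xi>. ft Line v \<xi> * \<phi> \<xi>)"
    proof (rule Bochner_Integration.integrable_bound)
      show "integrable lborel (\<lambda>\<xi>. C * rho_mass Line * cmod (\<phi> \<xi>))" using \<phi>i by auto
      show "AE \<xi> in lborel. norm (ft Line v \<xi> * \<phi> \<xi>) \<le> norm (C * rho_mass Line * cmod (\<phi> \<xi>))"
        using mult_right_mono[OF b norm_ge_zero] decaying_const_nonneg[OF v]
        by (intro AE_I2) (simp add: norm_mult abs_mult)
    qed measurable
    let ?f = "\<lambda>x \<xi>. complex_of_real (v x) * (cis (- (\<xi> * x)) * \<phi> \<xi>)"
    have cis[measurable]: "(\<lambda>p::real \<times> real. cis (- (snd p * fst p))) \<in> borel_measurable (lborel \<Otimes>\<^sub>M lborel)"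
      by (subst measurable_cong_sets[OF sets_pair_measure_cong[OF sets_lborel sets_lborel] refl],
          subst borel_prod, intro borel_measurable_continuous_onI continuous_intros)
    have f: "integrable (lborel \<Otimes>\<^sub>M lborel) (case_prod ?f)"
    proof (rule lborel_pair.Fubini_integrable)
      show "case_prod ?f \<in> borel_measurable (lborel \<Otimes>\<^sub>M lborel)"
        unfolding case_prod_beta by measurable
      have "(LINT \<xi>|lborel. norm (case_prod ?f (x, \<xi>))) = \<bar>v x\<bar> * (LINT \<xi>|lborel. cmod (\<phi> \<xi>))" for x
        by (simp add: norm_mult)
      then show "integrable lborel (\<lambda>x. LINT \<xi>|lborel. norm (case_prod ?f (x, \<xi>)))"
        using vi by auto
      have "integrable lborel (\<lambda>\<xi>. cis (- (\<xi> * x)) * \<phi> \<xi>)" for x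
      proof (rule Bochner_Integration.integrable_bound[OF \<phi>i])
        have "(\<lambda>\<xi>. cis (- (\<xi> * x))) \<in> borel_measurable borel"
          by (intro borel_measurable_continuous_onI continuous_intros)
        then show "(\<lambda>\<xi>. cis (- (\<xi> * x)) * \<phi> \<xi>) \<in> borel_measurable lborel" by simp
      qed (simp add: norm_mult)
      then show "AE x in lborel. integrable lborel (\<lambda>\<xi>. case_prod ?f (x, \<xi>))"
        by simp
    qed
    have "dist_of_fun Line v (fourier \<phi>) = (LINT x|lborel. LINT \<xi>|lborel. ?f x \<xi>)"
      by (simp add: dist_of_fun_def cell_def fourier_def set_lebesgue_integral_def)
    also have "\<dots> = (LINT \<xi>|lborel. LINT x|lborel. ?f x \<xi>)"
      using lborel_pair.Fubini_integral[OF f] by simp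
    also have "\<dots> = (LINT \<xi>|lborel. ft Line v \<xi> * \<phi> \<xi>)"
    proof (rule Bochner_Integration.integral_cong[OF refl])
      fix \<xi>
      have "(LINT x|lborel. ?f x \<xi>) = (LINT x|lborel. complex_of_real (v x) * cis (- (x * \<xi>)) * \<phi> \<xi>)"
        by (simp add: mult_ac)
      then show "(LINT x|lborel. ?f x \<xi>) = ft Line v \<xi> * \<phi> \<xi>" unfolding ft by simp
    qed
    finally show "dist_of_fun Line v (fourier \<phi>) = (LINT \<xi>|lborel. ft Line v \<xi> * \<phi> \<xi>)" .
  qed
  then show ?thesis by (simp add: has_fourier_def Line)
qed

lemma has_fourier_measurable: "has_fourier M U g \<Longrightarrow> g \<in> borel_measurable (freq_measure M)"
  by (cases M) (auto simp: has_fourier_def freq_measure_def)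

lemma has_fourier_diff:
  "has_fourier M U g \<Longrightarrow> has_fourier M V h \<Longrightarrow> has_fourier M (\<lambda>\<phi>. U \<phi> - V \<phi>) (\<lambda>\<xi>. g \<xi> - h \<xi>)"
  by (cases M) (auto simp: has_fourier_def diff_divide_distrib left_diff_distrib)

lemma gauss_modulated: "gauss 1 (\<i> * of_real a) x = of_real (exp (- (x\<^sup>2 / 2))) * cis (a * x)"
proof -
  have "\<i> * of_real a * of_real x - of_real (x\<^sup>2 / 2) = of_real (- (x\<^sup>2 / 2)) + \<i> * of_real (a * x)"
    by simp
  then show ?thesis
    by (simp only: gauss_def poly_1 mult_1 exp_add exp_of_real cis_conv_exp)
qed

lemma has_fourier_Line_gauss:
  assumes "has_fourier Line U g"
  shows "g \<in> borel_measurable borel"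
    and "integrable lborel (\<lambda>\<xi>. g \<xi> * (of_real (exp (- (\<xi>\<^sup>2 / 2))) * cis (a * \<xi>)))"
    and "U (fourier (gauss 1 (\<i> * of_real a))) = (LINT \<xi>|lborel. g \<xi> * (of_real (exp (- (\<xi>\<^sup>2 / 2))) * cis (a * \<xi>)))"
  using assms schwartz_gauss[of 1 "\<i> * of_real a"] by (auto simp: has_fourier_def gauss_modulated[abs_def])

text \<open>The modulated Gaussians are Schwartz functions, so the difference of two Fourier
  transforms of the same distribution is orthogonal to all of them.\<close>

lemma has_fourier_unique:
  assumes g: "has_fourier M U g" and h: "has_fourier M U h"
  shows "AE \<xi> in freq_measure M. g \<xi> = h \<xi>"
proof (cases M)
  case Torus
  then show ?thesis
    using g h by (auto simp: has_fourier_def freq_measure_def AE_count_space)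
next
  case Line
  note g' = has_fourier_Line_gauss[OF g[unfolded Line]] and h' = has_fourier_Line_gauss[OF h[unfolded Line]]
  have "AE \<xi> in lborel. g \<xi> - h \<xi> = 0"
  proof (rule gaussian_fourier_injective)
    show "(\<lambda>\<xi>. g \<xi> - h \<xi>) \<in> borel_measurable borel" using g'(1) h'(1) by measurable
    show "integrable lborel (\<lambda>\<xi>. (g \<xi> - h \<xi>) * of_real (exp (- (\<xi>\<^sup>2 / 2))))"
      using g'(2)[of 0] h'(2)[of 0] by (simp add: left_diff_distrib)
    show "(LINT \<xi>|lborel. (g \<xi> - h \<xi>) * (of_real (exp (- (\<xi>\<^sup>2 / 2))) * cis (a * \<xi>))) = 0" for a
      using Bochner_Integration.integral_diff[OF g'(2)[of a] h'(2)[of a]] g'(3)[of a] h'(3)[of a]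
      by (simp add: left_diff_distrib)
  qed
  then show ?thesis unfolding Line freq_measure_def spatial_domain.case by simp
qed

lemma sobolev_norm_eq:
  assumes g: "has_fourier M U g"
  shows "sobolev_norm M s U = sqrt (LINT \<xi>|freq_measure M. (1 + \<xi>\<^sup>2) powr s * (cmod (g \<xi>))\<^sup>2)"
proof -
  define h where "h = (SOME g. has_fourier M U g)"
  have h: "has_fourier M U h" unfolding h_def by (rule someI[of "has_fourier M U", OF g])
  note [measurable] = has_fourier_measurable[OF g] has_fourier_measurable[OF h]
  have "(LINT \<xi>|freq_measure M. (1 + \<xi>\<^sup>2) powr s * (cmod (h \<xi>))\<^sup>2) =
      (LINT \<xi>|freq_measure M. (1 + \<xi>\<^sup>2) powr s * (cmod (g \<xi>))\<^sup>2)"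
    using has_fourier_unique[OF h g] by (intro integral_cong_AE) (auto elim!: eventually_mono)
  then show ?thesis by (simp add: sobolev_norm_def h_def)
qed

section \<open>Continuity of smooth curves into every Sobolev space\<close>

text \<open>Each spatial derivative multiplies the transform by \<open>\<i> \<xi>\<close>.\<close>

lemma smooth_curve_ft_bound:
  assumes "smooth_curve M k u"
  shows "\<exists>C\<ge>0. \<forall>t\<in>{0..T}. \<forall>t'\<in>{0..T}. \<forall>\<xi>\<in>freqs M.
      \<bar>\<xi>\<bar> ^ k * cmod (ft M (u t) \<xi>) \<le> C \<and> \<bar>\<xi>\<bar> ^ k * cmod (ft M (u t) \<xi> - ft M (u t') \<xi>) \<le> C * \<bar>t - t'\<bar>"
  using assms
proof (induction k arbitrary: u)
  case 0
  then have u: "decaying_curve M u" by simp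
  obtain C where C: "0 \<le> C" "\<And>t. 0 \<le> t \<Longrightarrow> t \<le> T \<Longrightarrow> decaying M C (u t)"
    "\<And>t t' x. 0 \<le> t \<Longrightarrow> t \<le> T \<Longrightarrow> 0 \<le> t' \<Longrightarrow> t' \<le> T \<Longrightarrow> \<bar>u t x - u t' x\<bar> \<le> C * \<bar>t - t'\<bar> * rho M x"
    using decaying_curveE[OF u] by metis
  have "cmod (ft M (u t) \<xi>) \<le> C * rho_mass M" if "t \<in> {0..T}" for t \<xi>
    using ft_bound[OF C(2)] that by simp
  moreover have "cmod (ft M (u t) \<xi> - ft M (u t') \<xi>) \<le> C * rho_mass M * \<bar>t - t'\<bar>"
    if "t \<in> {0..T}" "t' \<in> {0..T}" for t t' \<xi>
  proof -
    have d: "decaying M C (u t)" "decaying M C (u t')" using C(2) that by auto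
    have "\<bar>u t x - u t' x\<bar> \<le> (C * \<bar>t - t'\<bar>) * rho M x" for x
      using C(3)[of t t' x] that by simp
    from ft_bound[OF decaying_diff[OF d this]] show ?thesis
      by (simp add: ft_diff[OF d] mult_ac)
  qed
  ultimately show ?case
    using C(1) by (intro exI[of _ "C * rho_mass M"]) auto
next
  case (Suc k)
  obtain u' where u': "smooth_curve M k u'" "\<And>t x. 0 \<le> t \<Longrightarrow> (u t has_real_derivative u' t x) (at x)"
    using smooth_curve_SucE[OF Suc.prems(1)] by blast
  obtain C where C: "0 \<le> C" and b: "\<And>t t' \<xi>. t \<in> {0..T} \<Longrightarrow> t' \<in> {0..T} \<Longrightarrow> \<xi> \<in> freqs M \<Longrightarrow>
      \<bar>\<xi>\<bar> ^ k * cmod (ft M (u' t) \<xi>) \<le> C \<and> \<bar>\<xi>\<bar> ^ k * cmod (ft M (u' t) \<xi> - ft M (u' t') \<xi>) \<le> C * \<bar>t - t'\<bar>"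
    using Suc.IH[OF u'(1)] by blast
  have d: "ft M (u' t) \<xi> = \<i> * of_real \<xi> * ft M (u t) \<xi>" if "t \<in> {0..T}" "\<xi> \<in> freqs M" for t \<xi>
  proof -
    have t: "0 \<le> t" using that by simp
    obtain D where D: "decaying M D (u t)" using decaying_curveD[OF smooth_curve_decaying[OF Suc.prems] t] by blast
    obtain D' where D': "decaying M D' (u' t)" using decaying_curveD[OF smooth_curve_decaying[OF u'(1)] t] by blast
    show ?thesis by (rule ft_derivative[OF D D' u'(2)[OF t] that(2)])
  qed
  have "\<bar>\<xi>\<bar> ^ Suc k * cmod (ft M (u t) \<xi>) \<le> C \<and> \<bar>\<xi>\<bar> ^ Suc k * cmod (ft M (u t) \<xi> - ft M (u t') \<xi>) \<le> C * \<bar>t - t'\<bar>"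
    if "t \<in> {0..T}" "t' \<in> {0..T}" "\<xi> \<in> freqs M" for t t' \<xi>
    using b[OF that] d[OF that(1,3)] d[OF that(2,3)]
    by (simp add: norm_mult mult_ac flip: right_diff_distrib)
  with C show ?case by blast
qed

lemma weight_power_le: "(1 + \<xi>\<^sup>2) ^ m \<le> 2 ^ m * (1 + \<bar>\<xi>\<bar> ^ (2 * m))" for \<xi> :: real
proof -
  have "(1 + \<xi>\<^sup>2) ^ m \<le> (2 * max 1 (\<xi>\<^sup>2)) ^ m"
    by (intro power_mono) auto
  also have "\<dots> = 2 ^ m * (max 1 (\<xi>\<^sup>2)) ^ m" by (simp add: power_mult_distrib)
  also have "(max 1 (\<xi>\<^sup>2)) ^ m \<le> 1 + \<bar>\<xi>\<bar> ^ (2 * m)"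
    by (auto simp: max_def power_mult)
  finally show ?thesis by simp
qed

lemma smooth_curve_weighted_ft_bound:
  assumes u: "\<And>k. smooth_curve M k u"
  obtains C where "0 \<le> C"
    "\<And>t \<xi>. 0 \<le> t \<Longrightarrow> t \<le> T \<Longrightarrow> \<xi> \<in> freqs M \<Longrightarrow> (1 + \<xi>\<^sup>2) ^ m * cmod (ft M (u t) \<xi>) \<le> C"
    "\<And>t t' \<xi>. 0 \<le> t \<Longrightarrow> t \<le> T \<Longrightarrow> 0 \<le> t' \<Longrightarrow> t' \<le> T \<Longrightarrow> \<xi> \<in> freqs M \<Longrightarrow>
      (1 + \<xi>\<^sup>2) ^ m * cmod (ft M (u t) \<xi> - ft M (u t') \<xi>) \<le> C * \<bar>t - t'\<bar>"
proof -
  obtain C0 where C0: "0 \<le> C0" "\<And>t t' \<xi>. t \<in> {0..T} \<Longrightarrow> t' \<in> {0..T} \<Longrightarrow> \<xi> \<in> freqs M \<Longrightarrow>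
      cmod (ft M (u t) \<xi>) \<le> C0 \<and> cmod (ft M (u t) \<xi> - ft M (u t') \<xi>) \<le> C0 * \<bar>t - t'\<bar>"
    using smooth_curve_ft_bound[OF u[of 0], of T] by auto
  obtain C1 where C1: "0 \<le> C1" "\<And>t t' \<xi>. t \<in> {0..T} \<Longrightarrow> t' \<in> {0..T} \<Longrightarrow> \<xi> \<in> freqs M \<Longrightarrow>
      \<bar>\<xi>\<bar> ^ (2 * m) * cmod (ft M (u t) \<xi>) \<le> C1 \<and> \<bar>\<xi>\<bar> ^ (2 * m) * cmod (ft M (u t) \<xi> - ft M (u t') \<xi>) \<le> C1 * \<bar>t - t'\<bar>"
    using smooth_curve_ft_bound[OF u[of "2 * m"], of T] by blast
  have w: "(1 + \<xi>\<^sup>2) ^ m * r \<le> 2 ^ m * (a + b)"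
    if "0 \<le> r" "r \<le> a" "\<bar>\<xi>\<bar> ^ (2 * m) * r \<le> b" for r a b \<xi> :: real
  proof -
    have "(1 + \<xi>\<^sup>2) ^ m * r \<le> 2 ^ m * (1 + \<bar>\<xi>\<bar> ^ (2 * m)) * r"
      by (intro mult_right_mono weight_power_le that)
    also have "\<dots> = 2 ^ m * (r + \<bar>\<xi>\<bar> ^ (2 * m) * r)" by (simp add: algebra_simps)
    also have "\<dots> \<le> 2 ^ m * (a + b)" using that by (intro mult_left_mono add_mono) auto
    finally show ?thesis .
  qed
  show ?thesis
  proof (rule that[of "2 ^ m * (C0 + C1)"])
    show "(1 + \<xi>\<^sup>2) ^ m * cmod (ft M (u t) \<xi>) \<le> 2 ^ m * (C0 + C1)"
      if "0 \<le> t" "t \<le> T" "\<xi> \<in> freqs M" for t \<xi>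
      using C0(2)[of t t \<xi>] C1(2)[of t t \<xi>] that by (intro w) auto
    show "(1 + \<xi>\<^sup>2) ^ m * cmod (ft M (u t) \<xi> - ft M (u t') \<xi>) \<le> 2 ^ m * (C0 + C1) * \<bar>t - t'\<bar>"
      if "0 \<le> t" "t \<le> T" "0 \<le> t'" "t' \<le> T" "\<xi> \<in> freqs M" for t t' \<xi>
      using w[of "cmod (ft M (u t) \<xi> - ft M (u t') \<xi>)" "C0 * \<bar>t - t'\<bar>" \<xi> "C1 * \<bar>t - t'\<bar>"]
        C0(2)[of t t' \<xi>] C1(2)[of t t' \<xi>] that by (simp add: algebra_simps)
  qed (use C0(1) C1(1) in simp)
qed

text \<open>Smooth curves are Lipschitz in time with values in every Sobolev space, locally
  uniformly in time.\<close>

lemma smooth_curve_continuous_into_sobolev: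
  assumes u: "\<And>k. smooth_curve M k u"
  shows "continuous_into_sobolev M \<sigma> u"
proof -
  obtain m :: nat where "(\<sigma> + 1) / 2 \<le> real m" using real_arch_simple by blast
  then have m: "\<sigma> + 1 \<le> 2 * real m" by simp
  have d: "\<exists>C. decaying M C (u t)" if "0 \<le> t" for t
    using decaying_curveD[OF _ that] smooth_curve_decaying[OF u] by blast
  have hf: "has_fourier M (dist_of_fun M (u t)) (ft M (u t))" if "0 \<le> t" for t
    using d[OF that] has_fourier_decaying by blast
  have reg: "regular_fun M (u t) \<and> in_sobolev M \<sigma> (dist_of_fun M (u t))" if t: "0 \<le> t" for t
  proof -
    obtain C where C: "decaying M C (u t)" using d[OF t] by blast
    obtain K where K: "\<And>\<tau> \<xi>. 0 \<le> \<tau> \<Longrightarrow> \<tau> \<le> t \<Longrightarrow> \<xi> \<in> freqs M \<Longrightarrow> (1 + \<xi>\<^sup>2) ^ m * cmod (ft M (u \<tau>) \<xi>) \<le> K"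
      using smooth_curve_weighted_ft_bound[OF u, of t m] by metis
    have "integrable (freq_measure M) (\<lambda>\<xi>. (1 + \<xi>\<^sup>2) powr \<sigma> * (cmod (ft M (u t) \<xi>))\<^sup>2)"
      by (rule sobolev_integral_bound(1)[OF ft_measurable[OF C] K m]) (use t in auto)
    then show ?thesis
      using regular_fun_decaying[OF C] distribution_decaying[OF C] hf[OF t] unfolding in_sobolev_def by blast
  qed
  moreover have "((\<lambda>\<tau>. sobolev_norm M \<sigma> (\<lambda>\<phi>. dist_of_fun M (u \<tau>) \<phi> - dist_of_fun M (u t) \<phi>)) \<longlongrightarrow> 0) (at t within {0..})"
    if t: "0 \<le> t" for t
  proof -
    obtain K where K: "0 \<le> K" "\<And>s s' \<xi>. 0 \<le> s \<Longrightarrow> s \<le> t + 1 \<Longrightarrow> 0 \<le> s' \<Longrightarrow> s' \<le> t + 1 \<Longrightarrow> \<xi> \<in> freqs M \<Longrightarrow>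
      (1 + \<xi>\<^sup>2) ^ m * cmod (ft M (u s) \<xi> - ft M (u s') \<xi>) \<le> K * \<bar>s - s'\<bar>"
      using smooth_curve_weighted_ft_bound[OF u, of "t + 1" m] by metis
    define W where "W = (LINT \<xi>|freq_measure M. inverse (1 + \<xi>\<^sup>2))"
    have W: "0 \<le> W" unfolding W_def by (intro integral_nonneg_AE AE_I2) simp
    have b: "norm (sobolev_norm M \<sigma> (\<lambda>\<phi>. dist_of_fun M (u \<tau>) \<phi> - dist_of_fun M (u t) \<phi>)) \<le> K * \<bar>\<tau> - t\<bar> * sqrt W"
      if \<tau>: "0 \<le> \<tau>" "\<tau> < t + 1" for \<tau>
    proof -
      have meas: "(\<lambda>\<xi>. ft M (u \<tau>) \<xi> - ft M (u t) \<xi>) \<in> borel_measurable (freq_measure M)"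
        using d[OF \<tau>(1)] d[OF t] ft_measurable by (intro borel_measurable_diff) blast+
      have "(LINT \<xi>|freq_measure M. (1 + \<xi>\<^sup>2) powr \<sigma> * (cmod (ft M (u \<tau>) \<xi> - ft M (u t) \<xi>))\<^sup>2) \<le> (K * \<bar>\<tau> - t\<bar>)\<^sup>2 * W"
        unfolding W_def
        by (rule sobolev_integral_bound(2)[OF meas _ m]) (use K(2)[of \<tau> t] \<tau> t in auto)
      from real_sqrt_le_mono[OF this]
      have "sobolev_norm M \<sigma> (\<lambda>\<phi>. dist_of_fun M (u \<tau>) \<phi> - dist_of_fun M (u t) \<phi>) \<le> K * \<bar>\<tau> - t\<bar> * sqrt W"
        using K(1) by (simp add: sobolev_norm_eq[OF has_fourier_diff[OF hf[OF \<tau>(1)] hf[OF t]]] real_sqrt_mult)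
      moreover have "0 \<le> sobolev_norm M \<sigma> (\<lambda>\<phi>. dist_of_fun M (u \<tau>) \<phi> - dist_of_fun M (u t) \<phi>)"
        unfolding sobolev_norm_def by (intro real_sqrt_ge_zero integral_nonneg_AE AE_I2) simp
      ultimately show ?thesis by simp
    qed
    show ?thesis
    proof (rule Lim_null_comparison)
      have "\<forall>\<^sub>F \<tau> in at t within {0..}. \<tau> \<in> {..<t + 1}"
        by (rule eventually_at_topological[THEN iffD2], rule exI[of _ "{..<t + 1}"]) auto
      moreover have "\<forall>\<^sub>F \<tau> in at t within {0..}. \<tau> \<in> {0..}"
        by (auto simp: eventually_at_filter)
      ultimately show "\<forall>\<^sub>F \<tau> in at t within {0..}. norm (sobolev_norm M \<sigma> (\<lambda>\<phi>. dist_of_fun M (u \<tau>) \<phi> - dist_of_fun M (u t) \<phi>))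
          \<le> K * \<bar>\<tau> - t\<bar> * sqrt W"
        by eventually_elim (use b in auto)
      show "((\<lambda>\<tau>. K * \<bar>\<tau> - t\<bar> * sqrt W) \<longlongrightarrow> 0) (at t within {0..})"
        by (auto intro!: tendsto_eq_intros)
    qed
  qed
  ultimately show ?thesis unfolding continuous_into_sobolev_def by blast
qed

theorem bbm_curve_smooth_solution: "bbm_curve M u \<Longrightarrow> smooth_bbm_solution M u"
  using bbm_curve_solves smooth_curve_continuous_into_sobolev
  unfolding smooth_bbm_solution_def bbm_curve_def by blast

section \<open>Building blocks for smooth data\<close>

lemma smooth_profileD:
  assumes "smooth_profile M a"
  obtains C where "decaying M C a"
  using assms unfolding smooth_profile_def by metis

lemma smooth_profile_add:
  assumes "smooth_profile M a" "smooth_profile M b"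
  shows "smooth_profile M (\<lambda>x. a x + b x)"
proof -
  obtain A where A: "A 0 = a" "\<And>j. \<exists>C. decaying M C (A j)" "\<And>j x. (A j has_real_derivative A (Suc j) x) (at x)"
    using assms(1) unfolding smooth_profile_def by metis
  obtain B where B: "B 0 = b" "\<And>j. \<exists>C. decaying M C (B j)" "\<And>j x. (B j has_real_derivative B (Suc j) x) (at x)"
    using assms(2) unfolding smooth_profile_def by metis
  show ?thesis
    unfolding smooth_profile_def
  proof (intro exI[of _ "\<lambda>j x. A j x + B j x"] conjI allI)
    show "\<exists>C. decaying M C (\<lambda>x. A j x + B j x)" for j
      using A(2)[of j] B(2)[of j] decaying_add by blast
    show "((\<lambda>x. A j x + B j x) has_real_derivative A (Suc j) x + B (Suc j) x) (at x)" for j x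
      by (intro DERIV_add A B)
  qed (simp add: A B)
qed

lemma decaying_scale:
  assumes "decaying M C f" shows "decaying M (\<bar>r\<bar> * C) (\<lambda>x. r * f x)"
  by (rule decaying_lipschitz_comp[OF assms]) (auto simp: abs_mult right_diff_distrib[symmetric])

lemma smooth_profile_scale:
  assumes "smooth_profile M a" shows "smooth_profile M (\<lambda>x. r * a x)"
proof -
  obtain A where A: "A 0 = a" "\<And>j. \<exists>C. decaying M C (A j)" "\<And>j x. (A j has_real_derivative A (Suc j) x) (at x)"
    using assms unfolding smooth_profile_def by metis
  show ?thesis
    unfolding smooth_profile_def
  proof (intro exI[of _ "\<lambda>j x. r * A j x"] conjI allI)
    show "\<exists>C. decaying M C (\<lambda>x. r * A j x)" for j
      using A(2)[of j] decaying_scale by blast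
    show "((\<lambda>x. r * A j x) has_real_derivative r * A (Suc j) x) (at x)" for j x
      by (intro DERIV_cmult A)
  qed (simp add: A)
qed

lemma smooth_profile_trig:
  assumes k: "k \<in> \<int>" shows "smooth_profile Torus (\<lambda>x. Re (c * cis (k * x)))"
  unfolding smooth_profile_def
proof (intro exI[of _ "\<lambda>j x. Re (((\<i> * of_real k) ^ j * c) * cis (k * x))"] conjI allI)
  fix j x
  let ?c = "(\<i> * of_real k) ^ j * c"
  have "function_on Torus (\<lambda>x. Re (?c * cis (k * x)))"
    using trig_periodic[of k Torus] k by (simp add: freqs_def function_on_def)
  moreover have "\<bar>Re (?c * cis (k * x))\<bar> \<le> cmod ?c" for x
    using abs_Re_le_cmod[of "?c * cis (k * x)"] by (simp add: norm_mult)
  ultimately show "\<exists>C. decaying Torus C (\<lambda>x. Re (?c * cis (k * x)))"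
    by (intro exI[of _ "cmod ?c"]) (auto simp: decaying_def dominated_def intro!: continuous_intros)
  have "((\<lambda>x. ?c * cis (k * x)) has_vector_derivative ?c * (\<i> * of_real k * cis (k * x))) (at x)"
  proof -
    have "((\<lambda>z. ?c * exp (\<i> * of_real k * z)) has_field_derivative ?c * (\<i> * of_real k * exp (\<i> * of_real k * of_real x))) (at (of_real x))"
      by (auto intro!: derivative_eq_intros)
    from has_vector_derivative_real_field[OF this] show ?thesis
      by (simp add: cis_conv_exp mult_ac)
  qed
  from bounded_linear.has_vector_derivative[OF bounded_linear_Re this]
  show "((\<lambda>x. Re (?c * cis (k * x))) has_real_derivative Re ((\<i> * of_real k) ^ Suc j * c * cis (k * x))) (at x)"
    by (simp add: has_real_derivative_iff_has_vector_derivative mult_ac)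
qed simp

lemma ft_add:
  assumes v: "decaying M C v" and w: "decaying M D w"
  shows "ft M (\<lambda>x. v x + w x) \<xi> = ft M v \<xi> + ft M w \<xi>"
proof -
  have "cos_transform M (\<lambda>x. v x + w x) \<xi> = cos_transform M v \<xi> + cos_transform M w \<xi>"
    "sin_transform M (\<lambda>x. v x + w x) \<xi> = sin_transform M v \<xi> + sin_transform M w \<xi>"
    unfolding cos_transform_def sin_transform_def distrib_left
    by (intro set_integral_add(2) transform_integrable[OF v] transform_integrable[OF w])+
  then show ?thesis
    by (simp add: ft_def complex_eq_iff add_divide_distrib diff_divide_distrib)
qed

lemma ft_scale: "ft M (\<lambda>x. r * v x) \<xi> = of_real r * ft M v \<xi>"
proof -
  have "cos_transform M (\<lambda>x. r * v x) \<xi> = r * cos_transform M v \<xi>" "sin_transform M (\<lambda>x. r * v x) \<xi> = r * sin_transform M v \<xi>"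
    unfolding cos_transform_def sin_transform_def mult.left_commute[of _ r] by (simp_all add: set_integral_mult_right)
  then show ?thesis by (simp add: ft_def complex_eq_iff)
qed

lemma decaying_modulate:
  assumes v: "decaying M C v" and k: "k \<in> freqs M"
  shows "decaying M (C * cmod c) (\<lambda>x. Re (c * cis (k * x)) * v x)"
proof (rule decaying_bounded_mult[OF v])
  show "function_on M (\<lambda>x. Re (c * cis (k * x)))"
    using trig_periodic[OF k] by (auto simp: function_on_def split: spatial_domain.splits)
  show "\<bar>Re (c * cis (k * x))\<bar> \<le> cmod c" for x
    using abs_Re_le_cmod[of "c * cis (k * x)"] by (simp add: norm_mult)
qed (auto intro!: continuous_intros)

text \<open>Multiplication by a wave of frequency \<open>k\<close> translates the transform by
  \<open>k\<close> and \<open>-k\<close>. For \<open>v = 1\<close> on the torus this gives the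
  orthogonality of exponentials; for the envelope it gives the transform of a wave packet.\<close>

lemma ft_modulate:
  assumes v: "decaying M C v" and k: "k \<in> freqs M"
  shows "ft M (\<lambda>x. Re (c * cis (k * x)) * v x) \<xi> = (c * ft M v (\<xi> - k) + cnj c * ft M v (\<xi> + k)) / 2"
proof -
  let ?S = "complex_of_real (fourier_scale M)"
  have i: "set_integrable lborel (cell M) (\<lambda>x. complex_of_real (v x) * cis (- (x * \<zeta>)))" for \<zeta>
    by (rule decaying_times_bounded(1)[OF v continuous_cis_linear, where B = 1]) simp
  have e: "complex_of_real (Re (c * cis (k * x)) * v x) * cis (- (x * \<xi>)) =
      c / 2 * (complex_of_real (v x) * cis (- (x * (\<xi> - k)))) + cnj c / 2 * (complex_of_real (v x) * cis (- (x * (\<xi> + k))))" for x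
  proof -
    have c1: "cis (- (x * (\<xi> - k))) = cis (- (x * \<xi>)) * cis (k * x)" "cis (- (x * (\<xi> + k))) = cis (- (x * \<xi>)) * cnj (cis (k * x))"
      by (simp_all add: cis_mult cis_cnj algebra_simps)
    have re: "complex_of_real (Re (c * cis (k * x))) = (c * cis (k * x) + cnj c * cnj (cis (k * x))) / 2"
      unfolding complex_cnj_mult[symmetric] by (simp only: complex_add_cnj) simp
    show ?thesis unfolding c1 of_real_mult re by (simp add: algebra_simps add_divide_distrib)
  qed
  have "?S * ft M (\<lambda>x. Re (c * cis (k * x)) * v x) \<xi> =
      (LINT x:cell M|lborel. c / 2 * (complex_of_real (v x) * cis (- (x * (\<xi> - k)))) + cnj c / 2 * (complex_of_real (v x) * cis (- (x * (\<xi> + k)))))"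
    unfolding ft_eq_integral[OF decaying_modulate[OF v k], symmetric] e ..
  also have "\<dots> = c / 2 * (?S * ft M v (\<xi> - k)) + cnj c / 2 * (?S * ft M v (\<xi> + k))"
    unfolding ft_eq_integral[OF v, symmetric] set_integral_mult_right[symmetric]
    by (intro set_integral_add(2) set_integrable_mult_right i)
  finally have "?S * ft M (\<lambda>x. Re (c * cis (k * x)) * v x) \<xi> = ?S * ((c * ft M v (\<xi> - k) + cnj c * ft M v (\<xi> + k)) / 2)"
    by (simp add: algebra_simps add_divide_distrib)
  moreover have "?S \<noteq> 0" using fourier_scale_ge_1[of M] by auto
  ultimately show ?thesis by (metis mult_left_cancel)
qed

section \<open>Symmetry of the Fourier transform of a real distribution\<close>

lemma fourier_gauss_modulated:
  "fourier (gauss 1 (\<i> * of_real a)) = (\<lambda>\<xi>. of_real (sqrt (2 * pi) * exp (- ((a - \<xi>)\<^sup>2 / 2))))"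
proof
  fix \<xi>
  have "cis (- (x * \<xi>)) * (E * cis (a * x)) = cis ((a - \<xi>) * x) * E" for x E
  proof -
    have "cis (- (x * \<xi>)) * cis (a * x) = cis ((a - \<xi>) * x)"
      by (simp add: cis_mult algebra_simps)
    then show ?thesis by (simp only: mult.left_commute[of _ E] mult.commute[of _ E])
  qed
  then have "fourier (gauss 1 (\<i> * of_real a)) \<xi> = (LINT x|lborel. cis ((a - \<xi>) * x) * of_real (exp (- (x\<^sup>2 / 2))))"
    unfolding fourier_def gauss_modulated by (simp only:)
  then show "fourier (gauss 1 (\<i> * of_real a)) \<xi> = of_real (sqrt (2 * pi) * exp (- ((a - \<xi>)\<^sup>2 / 2)))"
    by (simp only: integral_gaussian_cis)
qed

lemma fourier_gauss_modulated_schwartz: "fourier (gauss 1 (\<i> * of_real a)) \<in> schwartz"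
proof -
  have "fourier (gauss 1 (\<i> * of_real a)) = gauss [:of_real (sqrt (2 * pi) * exp (- (a\<^sup>2 / 2))):] (of_real a)"
  proof
    fix x
    have "of_real a * of_real x - of_real (x\<^sup>2 / 2) = complex_of_real (a * x - x\<^sup>2 / 2)" by simp
    moreover have "- ((a - x)\<^sup>2 / 2) = - (a\<^sup>2 / 2) + (a * x - x\<^sup>2 / 2)"
      by (simp add: power2_diff field_simps)
    ultimately show "fourier (gauss 1 (\<i> * of_real a)) x = gauss [:of_real (sqrt (2 * pi) * exp (- (a\<^sup>2 / 2))):] (of_real a) x"
      unfolding fourier_gauss_modulated gauss_def by (simp only: exp_add exp_of_real) simp
  qed
  then show ?thesis by (simp add: schwartz_gauss)
qed

lemma torus_test_function:
  assumes k: "k \<in> \<int>"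
  shows "(\<lambda>x. a * cis (k * x) + b * cis (- (k * x))) \<in> test_functions Torus"
proof -
  let ?F = "\<lambda>a b x. a * cis (k * x) + b * cis (- (k * x))"
  have d: "(?F a b has_vector_derivative ?F (\<i> * of_real k * a) (- \<i> * of_real k * b) x) (at x)" for a b x
  proof -
    have "((\<lambda>z. a * exp (\<i> * of_real k * z) + b * exp (- (\<i> * of_real k * z))) has_field_derivative
        (\<i> * of_real k * a) * exp (\<i> * of_real k * of_real x) + (- \<i> * of_real k * b) * exp (- (\<i> * of_real k * of_real x))) (at (of_real x))"
      by (auto intro!: derivative_eq_intros)
    from has_vector_derivative_real_field[OF this] show ?thesis
      by (simp add: cis_conv_exp mult_ac)
  qed
  have v: "vderiv (?F a b) = ?F (\<i> * of_real k * a) (- \<i> * of_real k * b)" for a b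
    by (rule ext) (simp only: vderiv_def vector_derivative_at[OF d])
  have "\<exists>a' b'. (vderiv ^^ n) (?F a b) = ?F a' b'" for n
  proof (induction n)
    case 0
    show ?case by (intro exI[of _ a] exI[of _ b]) simp
  next
    case (Suc n)
    then obtain a' b' where "(vderiv ^^ n) (?F a b) = ?F a' b'" by blast
    then have "(vderiv ^^ Suc n) (?F a b) = ?F (\<i> * of_real k * a') (- \<i> * of_real k * b')"
      by (simp only: funpow.simps o_apply v)
    then show ?case by blast
  qed
  then have "smooth_fun (?F a b)"
    unfolding smooth_fun_def by (metis differentiableI_vector[OF d])
  moreover have "cis (k * (x + 2 * pi)) = cis (k * x)" "cis (- (k * (x + 2 * pi))) = cis (- (k * x))" for x
    using trig_periodic[of k Torus] k by (simp_all add: freqs_def function_on_def complex_eq_iff)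
  ultimately show ?thesis
    by (simp add: test_functions_def function_on_def)
qed

text \<open>The Fourier transforms of the modulated Gaussians are translated Gaussians and in
  particular real, so \<open>u0\<close> takes real values there. Hence \<open>g \<xi>\<close> and
  \<open>cnj (g (- \<xi>))\<close> have the same integrals against all modulated Gaussians. On the
  torus the same is read off from the real test functions \<open>cos (\<xi> x)\<close> and
  \<open>sin (\<xi> x)\<close>.\<close>

lemma fourier_hermitian:
  assumes g: "has_fourier M u0 g" and u0: "distribution M u0" and real: "real_distribution M u0"
  shows "AE \<xi> in freq_measure M. g (- \<xi>) = cnj (g \<xi>)"
proof (cases M)
  case Torus
  have "g (- \<xi>) = cnj (g \<xi>)" if \<xi>: "\<xi> \<in> \<int>" for \<xi>
  proof -
    let ?c = "\<lambda>x. complex_of_real (cos (\<xi> * x))" and ?s = "\<lambda>x. complex_of_real (sin (\<xi> * x))"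
    have e: "?c = (\<lambda>x. 1 / 2 * cis (\<xi> * x) + 1 / 2 * cis (- (\<xi> * x)))"
      "?s = (\<lambda>x. (- \<i> / 2) * cis (\<xi> * x) + (\<i> / 2) * cis (- (\<xi> * x)))"
      by (simp_all add: fun_eq_iff complex_eq_iff)
    have t: "?c \<in> test_functions Torus" "?s \<in> test_functions Torus"
      unfolding e by (rule torus_test_function[OF \<xi>])+
    have r: "u0 ?c \<in> \<real>" "u0 ?s \<in> \<real>"
      using real t unfolding Defs.real_distribution_def Torus by auto
    have lin0: "\<forall>f\<in>test_functions Torus. \<forall>g\<in>test_functions Torus. \<forall>a b.
        u0 (\<lambda>x. a * f x + b * g x) = a * u0 f + b * u0 g"
      using u0 unfolding distribution_def Torus by blast
    have lin: "u0 (\<lambda>x. a * ?c x + b * ?s x) = a * u0 ?c + b * u0 ?s" for a b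
      by (rule lin0[rule_format, OF t])
    have "(\<lambda>x. cis (- (x * \<xi>))) = (\<lambda>x. 1 * ?c x + (- \<i>) * ?s x)" "(\<lambda>x. cis (- (x * - \<xi>))) = (\<lambda>x. 1 * ?c x + \<i> * ?s x)"
      by (simp_all add: fun_eq_iff complex_eq_iff mult.commute)
    then have "u0 (\<lambda>x. cis (- (x * \<xi>))) = u0 ?c - \<i> * u0 ?s" "u0 (\<lambda>x. cis (- (x * - \<xi>))) = u0 ?c + \<i> * u0 ?s"
      by (simp_all only: lin) simp_all
    moreover have "g \<zeta> = u0 (\<lambda>x. cis (- (x * \<zeta>))) / complex_of_real (2 * pi)" if "\<zeta> \<in> \<int>" for \<zeta>
      using g that by (simp add: has_fourier_def Torus)
    ultimately have "g \<xi> = (u0 ?c - \<i> * u0 ?s) / complex_of_real (2 * pi)" "g (- \<xi>) = (u0 ?c + \<i> * u0 ?s) / complex_of_real (2 * pi)"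
      using \<xi> by (simp_all del: mult_minus_right)
    then show ?thesis using r by (simp add: Reals_cnj_iff)
  qed
  then show ?thesis unfolding Torus freq_measure_def spatial_domain.case by (simp add: AE_count_space)
next
  case Line
  note g' = has_fourier_Line_gauss[OF g[unfolded Line]]
  let ?e = "\<lambda>\<xi>. complex_of_real (exp (- (\<xi>\<^sup>2 / 2)))"
  define g2 where "g2 \<xi> = cnj (g (- \<xi>))" for \<xi>
  have cnj_m: "(\<lambda>\<xi>. cnj (f \<xi>)) \<in> borel_measurable borel" if "f \<in> borel_measurable borel" for f :: "real \<Rightarrow> complex"
    by (rule borel_measurable_continuous_on[OF _ that]) (intro continuous_intros)
  have gm: "(\<lambda>\<xi>. g (- \<xi>)) \<in> borel_measurable borel"
    using measurable_compose[OF _ g'(1), of uminus borel] by simp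
  have g2m: "g2 \<in> borel_measurable borel"
    unfolding g2_def[abs_def] by (rule cnj_m[OF gm])
  have refl: "cnj (g \<xi> * (?e \<xi> * cis (a * \<xi>))) = g2 (0 + -1 * \<xi>) * (?e (0 + -1 * \<xi>) * cis (a * (0 + -1 * \<xi>)))" for a \<xi>
    by (simp add: g2_def cis_cnj)
  have int: "integrable lborel (\<lambda>\<xi>. g2 \<xi> * (?e \<xi> * cis (a * \<xi>)))" for a
  proof -
    have "integrable lborel (\<lambda>\<xi>. cnj (g \<xi> * (?e \<xi> * cis (a * \<xi>))))"
      using g'(2)[of a] by (intro integrable_bounded_linear[OF bounded_linear_cnj])
    then show ?thesis
      unfolding refl by (subst (asm) lborel_integrable_real_affine_iff) auto
  qed
  have eq: "(LINT \<xi>|lborel. g2 \<xi> * (?e \<xi> * cis (a * \<xi>))) = (LINT \<xi>|lborel. g \<xi> * (?e \<xi> * cis (a * \<xi>)))" for a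
  proof -
    have "u0 (fourier (gauss 1 (\<i> * of_real a))) \<in> \<real>"
      using real fourier_gauss_modulated_schwartz[of a] fourier_gauss_modulated[of a]
      unfolding Defs.real_distribution_def Line by (auto simp: test_functions_def)
    then have "(LINT \<xi>|lborel. g \<xi> * (?e \<xi> * cis (a * \<xi>))) = cnj (LINT \<xi>|lborel. g \<xi> * (?e \<xi> * cis (a * \<xi>)))"
      unfolding g'(3) by (simp add: Reals_cnj_iff)
    also have "\<dots> = (LINT \<xi>|lborel. cnj (g \<xi> * (?e \<xi> * cis (a * \<xi>))))"
      by (rule integral_bounded_linear[OF bounded_linear_cnj g'(2), symmetric])
    also have "\<dots> = (LINT \<xi>|lborel. g2 \<xi> * (?e \<xi> * cis (a * \<xi>)))"
      unfolding refl by (subst lborel_integral_real_affine[of "-1" _ 0]) simp_all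
    finally show ?thesis by simp
  qed
  have "AE \<xi> in lborel. g \<xi> - g2 \<xi> = 0"
  proof (rule gaussian_fourier_injective)
    show "(\<lambda>\<xi>. g \<xi> - g2 \<xi>) \<in> borel_measurable borel" using g'(1) g2m by measurable
    show "integrable lborel (\<lambda>\<xi>. (g \<xi> - g2 \<xi>) * ?e \<xi>)"
      using g'(2)[of 0] int[of 0] by (simp add: left_diff_distrib)
    show "(LINT \<xi>|lborel. (g \<xi> - g2 \<xi>) * (?e \<xi> * cis (a * \<xi>))) = 0" for a
      using Bochner_Integration.integral_diff[OF g'(2)[of a] int[of a]] eq[of a]
      by (simp add: left_diff_distrib)
  qed
  then have "AE \<xi> in lborel. g (- \<xi>) = cnj (g \<xi>)"
    by eventually_elim (auto simp: g2_def)
  then show ?thesis unfolding Line freq_measure_def spatial_domain.case .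
qed

section \<open>Density of smooth data\<close>

lemma weight_le_1: "s \<le> 0 \<Longrightarrow> (1 + \<xi>\<^sup>2) powr s \<le> 1" for \<xi> :: real
  using powr_mono[of s 0 "1 + \<xi>\<^sup>2"] by (simp add: add_nonneg_eq_0_iff)

lemma cmod_add_square: "(cmod (a + b))\<^sup>2 \<le> 2 * (cmod a)\<^sup>2 + 2 * (cmod b)\<^sup>2"
proof -
  have "(cmod (a + b))\<^sup>2 \<le> (cmod a + cmod b)\<^sup>2"
    by (intro power_mono norm_triangle_ineq) simp
  also have "\<dots> \<le> 2 * (cmod a)\<^sup>2 + 2 * (cmod b)\<^sup>2"
    using sum_squares_bound[of "cmod a" "cmod b"] by (simp add: power2_sum)
  finally show ?thesis .
qed

text \<open>The elementary inequality \<open>|x + y|\<^sup>2 \<le> 2 |x|\<^sup>2 + 2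
  |y|\<^sup>2\<close> serves as the triangle inequality; the factor \<open>2\<close> is
  harmless.\<close>

lemma weighted_square_add:
  assumes [measurable]: "g \<in> borel_measurable (freq_measure M)" "h \<in> borel_measurable (freq_measure M)"
    and g: "integrable (freq_measure M) (\<lambda>\<xi>. (1 + \<xi>\<^sup>2) powr s * (cmod (g \<xi>))\<^sup>2)"
    and h: "integrable (freq_measure M) (\<lambda>\<xi>. (1 + \<xi>\<^sup>2) powr s * (cmod (h \<xi>))\<^sup>2)"
  shows "integrable (freq_measure M) (\<lambda>\<xi>. (1 + \<xi>\<^sup>2) powr s * (cmod (g \<xi> + h \<xi>))\<^sup>2)" (is ?A)
    and "(LINT \<xi>|freq_measure M. (1 + \<xi>\<^sup>2) powr s * (cmod (g \<xi> + h \<xi>))\<^sup>2) \<le>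
      2 * (LINT \<xi>|freq_measure M. (1 + \<xi>\<^sup>2) powr s * (cmod (g \<xi>))\<^sup>2) +
      2 * (LINT \<xi>|freq_measure M. (1 + \<xi>\<^sup>2) powr s * (cmod (h \<xi>))\<^sup>2)"
proof -
  have p: "(1 + \<xi>\<^sup>2) powr s * (cmod (g \<xi> + h \<xi>))\<^sup>2 \<le>
      2 * ((1 + \<xi>\<^sup>2) powr s * (cmod (g \<xi>))\<^sup>2) + 2 * ((1 + \<xi>\<^sup>2) powr s * (cmod (h \<xi>))\<^sup>2)" for \<xi>
    using mult_left_mono[OF cmod_add_square, of "(1 + \<xi>\<^sup>2) powr s" "g \<xi>" "h \<xi>"] by (simp add: algebra_simps)
  have i: "integrable (freq_measure M) (\<lambda>\<xi>. 2 * ((1 + \<xi>\<^sup>2) powr s * (cmod (g \<xi>))\<^sup>2) + 2 * ((1 + \<xi>\<^sup>2) powr s * (cmod (h \<xi>))\<^sup>2))"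
    using g h by auto
  show A: ?A
    by (rule Bochner_Integration.integrable_bound[OF i]) (use p in \<open>auto simp: abs_mult intro!: AE_I2\<close>)
  have "(LINT \<xi>|freq_measure M. (1 + \<xi>\<^sup>2) powr s * (cmod (g \<xi> + h \<xi>))\<^sup>2) \<le>
      (LINT \<xi>|freq_measure M. 2 * ((1 + \<xi>\<^sup>2) powr s * (cmod (g \<xi>))\<^sup>2) + 2 * ((1 + \<xi>\<^sup>2) powr s * (cmod (h \<xi>))\<^sup>2))"
    by (rule integral_mono[OF A i p])
  then show "(LINT \<xi>|freq_measure M. (1 + \<xi>\<^sup>2) powr s * (cmod (g \<xi> + h \<xi>))\<^sup>2) \<le>
      2 * (LINT \<xi>|freq_measure M. (1 + \<xi>\<^sup>2) powr s * (cmod (g \<xi>))\<^sup>2) +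
      2 * (LINT \<xi>|freq_measure M. (1 + \<xi>\<^sup>2) powr s * (cmod (h \<xi>))\<^sup>2)"
    using g h by simp
qed

lemma ft_gaussian_translate:
  "ft Line (\<lambda>x. Re (gauss [:of_real (r * exp (- (\<alpha>\<^sup>2 / 2))):] (- of_real \<alpha>) x)) \<xi> =
    of_real (r * sqrt (2 * pi)) * (of_real (exp (- (\<xi>\<^sup>2 / 2))) * cis (\<alpha> * \<xi>))"
proof -
  let ?v = "\<lambda>x. Re (gauss [:of_real (r * exp (- (\<alpha>\<^sup>2 / 2))):] (- of_real \<alpha>) x)"
  obtain C where C: "decaying Line C ?v"
    using smooth_profile_gauss smooth_profileD by blast
  have v: "?v x = r * exp (- ((x + \<alpha>)\<^sup>2 / 2))" for x
  proof -
    have "- of_real \<alpha> * of_real x - of_real (x\<^sup>2 / 2) = complex_of_real (- \<alpha> * x - x\<^sup>2 / 2)" by simp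
    moreover have "- ((x + \<alpha>)\<^sup>2 / 2) = - (\<alpha>\<^sup>2 / 2) + (- \<alpha> * x - x\<^sup>2 / 2)"
      by (simp add: power2_sum field_simps)
    ultimately show ?thesis
      unfolding gauss_def by (simp only: exp_add exp_of_real) simp
  qed
  have "ft Line ?v \<xi> = (LINT x|lborel. complex_of_real (?v x) * cis (- (x * \<xi>)))"
    using ft_eq_integral[OF C, of \<xi>] by (simp add: fourier_scale_def cell_def set_lebesgue_integral_def)
  also have "\<dots> = (LINT y|lborel. complex_of_real (?v (- \<alpha> + 1 * y)) * cis (- ((- \<alpha> + 1 * y) * \<xi>)))"
    by (subst lborel_integral_real_affine[of 1 _ "- \<alpha>"]) simp_all
  also have "\<dots> = (LINT y|lborel. (of_real r * cis (\<alpha> * \<xi>)) * (cis (- \<xi> * y) * of_real (exp (- (y\<^sup>2 / 2)))))"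
  proof (rule Bochner_Integration.integral_cong[OF refl])
    fix y
    have "cis (- ((- \<alpha> + 1 * y) * \<xi>)) = cis (\<alpha> * \<xi>) * cis (- \<xi> * y)"
      by (simp add: cis_mult algebra_simps)
    then show "complex_of_real (?v (- \<alpha> + 1 * y)) * cis (- ((- \<alpha> + 1 * y) * \<xi>)) =
        (of_real r * cis (\<alpha> * \<xi>)) * (cis (- \<xi> * y) * of_real (exp (- (y\<^sup>2 / 2))))"
      unfolding v by simp
  qed
  also have "\<dots> = (of_real r * cis (\<alpha> * \<xi>)) * of_real (sqrt (2 * pi) * exp (- ((- \<xi>)\<^sup>2 / 2)))"
    by (subst integral_mult_right_zero) (simp only: integral_gaussian_cis)
  finally show ?thesis by simp
qed

text \<open>Taking the real part of a function symmetrizes its Fourier transform, which accounts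
  for the right-hand side. Translated real Gaussians realize it for a single exponential.\<close>

lemma expsum_profile:
  assumes "expsum f"
  shows "\<exists>a. smooth_profile Line a \<and> (\<forall>\<xi>. ft Line a \<xi> =
    (of_real (exp (- (\<xi>\<^sup>2 / 2))) * f \<xi> + cnj (of_real (exp (- (\<xi>\<^sup>2 / 2))) * f (- \<xi>))) / 2)"
  using assms
proof (induction rule: expsum.induct)
  case (single c \<alpha>)
  have "(of_real (exp (- (\<xi>\<^sup>2 / 2))) * (c * cis (\<alpha> * \<xi>)) + cnj (of_real (exp (- (\<xi>\<^sup>2 / 2))) * (c * cis (\<alpha> * - \<xi>)))) / 2 =
      of_real (Re c) * (of_real (exp (- (\<xi>\<^sup>2 / 2))) * cis (\<alpha> * \<xi>))" for \<xi>
  proof -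
    have "complex_of_real (Re c) = (c + cnj c) / 2" by (simp add: complex_add_cnj)
    then show ?thesis by (simp add: cis_cnj algebra_simps add_divide_distrib)
  qed
  moreover have "of_real (Re c / sqrt (2 * pi) * sqrt (2 * pi)) = complex_of_real (Re c)"
    by simp
  ultimately show ?case
    using ft_gaussian_translate[of "Re c / sqrt (2 * pi)" \<alpha>]
    by (intro exI[of _ "\<lambda>x. Re (gauss [:of_real (Re c / sqrt (2 * pi) * exp (- (\<alpha>\<^sup>2 / 2))):] (- of_real \<alpha>) x)"] conjI smooth_profile_gauss)
      (simp only: simp_thms)
next
  case (add f1 f2)
  obtain a1 where a1: "smooth_profile Line a1" "\<And>\<xi>. ft Line a1 \<xi> =
    (of_real (exp (- (\<xi>\<^sup>2 / 2))) * f1 \<xi> + cnj (of_real (exp (- (\<xi>\<^sup>2 / 2))) * f1 (- \<xi>))) / 2" using add.IH(1) by blast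
  obtain a2 where a2: "smooth_profile Line a2" "\<And>\<xi>. ft Line a2 \<xi> =
    (of_real (exp (- (\<xi>\<^sup>2 / 2))) * f2 \<xi> + cnj (of_real (exp (- (\<xi>\<^sup>2 / 2))) * f2 (- \<xi>))) / 2" using add.IH(2) by blast
  obtain C1 where C1: "decaying Line C1 a1" using a1(1) smooth_profileD by blast
  obtain C2 where C2: "decaying Line C2 a2" using a2(1) smooth_profileD by blast
  show ?case
    by (intro exI[of _ "\<lambda>x. a1 x + a2 x"] conjI smooth_profile_add a1 a2)
      (simp add: ft_add[OF C1 C2] a1(2) a2(2) field_simps)
qed

lemma ft_Torus_1:
  assumes "\<xi> \<in> \<int>" shows "ft Torus (\<lambda>x. 1) \<xi> = (if \<xi> = 0 then 1 else 0)"
proof (cases "\<xi> = 0")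
  case True
  have "measure lborel {0..<2 * pi} = 2 * pi" by simp
  then show ?thesis
    by (simp add: True ft_def cos_transform_def sin_transform_def fourier_scale_def cell_def set_lebesgue_integral_def complex_eq_iff)
next
  case False
  have one: "decaying Torus 1 (\<lambda>x. 1)" and zero: "decaying Torus 0 (\<lambda>x. 0)"
    by (auto simp: decaying_def dominated_def function_on_def)
  have "ft Torus (\<lambda>x. 0) \<xi> = \<i> * of_real \<xi> * ft Torus (\<lambda>x. 1) \<xi>"
    by (rule ft_derivative[OF one zero]) (use assms in \<open>auto simp: freqs_def\<close>)
  moreover have "ft Torus (\<lambda>x. 0) \<xi> = 0"
    by (simp add: ft_def cos_transform_def sin_transform_def complex_eq_iff)
  ultimately show ?thesis using False by simp
qed

lemma torus_fourier_block:
  assumes "\<xi> \<in> \<int>" "k \<in> \<int>"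
  shows "ft Torus (\<lambda>x. Re (c * cis (k * x))) \<xi> = ((if \<xi> = k then c else 0) + (if \<xi> = - k then cnj c else 0)) / 2"
proof -
  have one: "decaying Torus 1 (\<lambda>x. 1)"
    by (auto simp: decaying_def dominated_def function_on_def)
  have "ft Torus (\<lambda>x. Re (c * cis (k * x)) * 1) \<xi> = (c * ft Torus (\<lambda>x. 1) (\<xi> - k) + cnj c * ft Torus (\<lambda>x. 1) (\<xi> + k)) / 2"
    by (rule ft_modulate[OF one]) (use assms in \<open>auto simp: freqs_def\<close>)
  moreover have "\<xi> + k = 0 \<longleftrightarrow> \<xi> = - k" by linarith
  ultimately show ?thesis using assms by (simp add: ft_Torus_1)
qed

lemma torus_finite_profile:
  assumes "finite F" "F \<subseteq> \<int>"
  shows "\<exists>a. smooth_profile Torus a \<and> (\<forall>\<xi>\<in>\<int>. ft Torus a \<xi> =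
    ((if \<xi> \<in> F then g \<xi> else 0) + cnj (if - \<xi> \<in> F then g (- \<xi>) else 0)) / 2)"
  using assms
proof (induction F rule: finite_induct)
  case empty
  have "ft Torus (\<lambda>x. Re (0 * cis (0 * x))) \<xi> = 0" if "\<xi> \<in> \<int>" for \<xi>
    using torus_fourier_block[OF that, of 0 0] by (simp split: if_splits)
  then show ?case
    using smooth_profile_trig[of 0 0] by (intro exI[of _ "\<lambda>x. Re (0 * cis (0 * x))"]) simp
next
  case (insert k F)
  then have k: "k \<in> \<int>" by simp
  obtain a where a: "smooth_profile Torus a" "\<And>\<xi>. \<xi> \<in> \<int> \<Longrightarrow> ft Torus a \<xi> =
    ((if \<xi> \<in> F then g \<xi> else 0) + cnj (if - \<xi> \<in> F then g (- \<xi>) else 0)) / 2"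
    using insert by auto
  let ?b = "\<lambda>x. Re (g k * cis (k * x))"
  have b: "smooth_profile Torus ?b" by (rule smooth_profile_trig[OF k])
  obtain C1 where C1: "decaying Torus C1 ?b" using b smooth_profileD by blast
  obtain C2 where C2: "decaying Torus C2 a" using a(1) smooth_profileD by blast
  have "ft Torus (\<lambda>x. ?b x + a x) \<xi> =
      ((if \<xi> \<in> insert k F then g \<xi> else 0) + cnj (if - \<xi> \<in> insert k F then g (- \<xi>) else 0)) / 2"
    if \<xi>: "\<xi> \<in> \<int>" for \<xi>
  proof -
    have "- \<xi> = k \<longleftrightarrow> \<xi> = - k" by auto
    then show ?thesis
      unfolding ft_add[OF C1 C2] torus_fourier_block[OF \<xi> k] a(2)[OF \<xi>]
      using insert.hyps(2) by (auto simp: add_divide_distrib)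
  qed
  then show ?case using smooth_profile_add[OF b a(1)] by blast
qed

lemma smooth_profiles_dense_torus:
  assumes int: "integrable (count_space \<int>) (\<lambda>\<xi>. (1 + \<xi>\<^sup>2) powr s * (cmod (g \<xi>))\<^sup>2)"
    and herm: "\<And>\<xi>. \<xi> \<in> \<int> \<Longrightarrow> g (- \<xi>) = cnj (g \<xi>)" and \<eta>: "0 < \<eta>"
  shows "\<exists>a. smooth_profile Torus a \<and>
    (LINT \<xi>|count_space \<int>. (1 + \<xi>\<^sup>2) powr s * (cmod (ft Torus a \<xi> - g \<xi>))\<^sup>2) < \<eta>"
proof -
  let ?T = "\<lambda>n \<xi>. if \<bar>\<xi>\<bar> \<le> real n then 0 else (1 + \<xi>\<^sup>2) powr s * (cmod (g \<xi>))\<^sup>2"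
  have "(\<lambda>n. LINT \<xi>|count_space \<int>. ?T n \<xi>) \<longlonglongrightarrow> (LINT \<xi>|count_space (\<int>::real set). 0)"
  proof (rule integral_dominated_convergence[OF _ _ int])
    show "AE \<xi> in count_space \<int>. (\<lambda>n. ?T n \<xi>) \<longlonglongrightarrow> 0"
    proof (rule AE_I2)
      fix \<xi> :: real
      obtain n where n: "\<bar>\<xi>\<bar> \<le> real n" using real_arch_simple by blast
      have "\<forall>\<^sub>F m in sequentially. ?T m \<xi> = 0"
        using eventually_ge_at_top[of n] by eventually_elim (use n in auto)
      then show "(\<lambda>n. ?T n \<xi>) \<longlonglongrightarrow> 0" by (rule tendsto_eventually)
    qed
  qed auto
  then have "(\<lambda>n. LINT \<xi>|count_space \<int>. ?T n \<xi>) \<longlonglongrightarrow> 0" by simp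
  then obtain n where n: "(LINT \<xi>|count_space \<int>. ?T n \<xi>) < \<eta>"
    using order_tendstoD(2)[OF _ \<eta>] eventually_happens'[OF sequentially_bot] by blast
  define F where "F = {\<xi>\<in>\<int>. \<bar>\<xi>\<bar> \<le> real n}"
  have "F \<subseteq> of_int ` {- int n..int n}"
  proof
    fix \<xi> assume "\<xi> \<in> F"
    then obtain k where "\<xi> = of_int k" "\<bar>of_int k\<bar> \<le> real n" by (auto simp: F_def elim!: Ints_cases)
    then show "\<xi> \<in> of_int ` {- int n..int n}" by (intro image_eqI[of _ _ k]) auto
  qed
  then have "finite F" by (rule finite_subset) simp
  moreover have "F \<subseteq> \<int>" by (auto simp: F_def)
  ultimately obtain a where a: "smooth_profile Torus a" "\<And>\<xi>. \<xi> \<in> \<int> \<Longrightarrow> ft Torus a \<xi> =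
    ((if \<xi> \<in> F then g \<xi> else 0) + cnj (if - \<xi> \<in> F then g (- \<xi>) else 0)) / 2"
    using torus_finite_profile[of F g] by blast
  have "(LINT \<xi>|count_space \<int>. (1 + \<xi>\<^sup>2) powr s * (cmod (ft Torus a \<xi> - g \<xi>))\<^sup>2) = (LINT \<xi>|count_space \<int>. ?T n \<xi>)"
  proof (rule Bochner_Integration.integral_cong[OF refl])
    fix \<xi> :: real assume "\<xi> \<in> space (count_space \<int>)"
    then have \<xi>: "\<xi> \<in> \<int>" by simp
    have "ft Torus a \<xi> = (if \<bar>\<xi>\<bar> \<le> real n then g \<xi> else 0)"
      using a(2)[OF \<xi>] herm[OF \<xi>] \<xi> by (auto simp: F_def)
    then show "(1 + \<xi>\<^sup>2) powr s * (cmod (ft Torus a \<xi> - g \<xi>))\<^sup>2 = ?T n \<xi>" by simp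
  qed
  with n a(1) show ?thesis by auto
qed

text \<open>The transform is truncated to a bounded function \<open>h\<close> of bounded support,
  which is approximated by \<open>gaussian_expsum_dense\<close>. Because \<open>s \<le> 0\<close>,
  the weight is at most \<open>1\<close>, and dominated convergence applies. Passing to the real
  part symmetrizes the error; since \<open>g\<close> is hermitian, its norm does not
  increase.\<close>

lemma smooth_profiles_dense_line:
  assumes g[measurable]: "g \<in> borel_measurable borel"
    and int: "integrable lborel (\<lambda>\<xi>. (1 + \<xi>\<^sup>2) powr s * (cmod (g \<xi>))\<^sup>2)"
    and herm: "AE \<xi> in lborel. g (- \<xi>) = cnj (g \<xi>)" and \<eta>: "0 < \<eta>" and s: "s \<le> 0"
  shows "\<exists>a. smooth_profile Line a \<and>
    (LINT \<xi>|lborel. (1 + \<xi>\<^sup>2) powr s * (cmod (ft Line a \<xi> - g \<xi>))\<^sup>2) < \<eta>"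
proof -
  let ?w = "\<lambda>\<xi>::real. (1 + \<xi>\<^sup>2) powr s"
  let ?e = "\<lambda>\<xi>::real. complex_of_real (exp (- (\<xi>\<^sup>2 / 2)))"
  have fm: "freq_measure Line = lborel" by (simp add: freq_measure_def)
  define h where "h n \<xi> = (if \<bar>\<xi>\<bar> \<le> real n \<and> cmod (g \<xi>) \<le> real n then g \<xi> else 0)" for n \<xi>
  have h[measurable]: "h n \<in> borel_measurable borel" for n
    unfolding h_def[abs_def] by measurable
  have "(\<lambda>n. LINT \<xi>|lborel. ?w \<xi> * (cmod (h n \<xi> - g \<xi>))\<^sup>2) \<longlonglongrightarrow> (LINT \<xi>|(lborel :: real measure). 0)"
  proof (rule integral_dominated_convergence[OF _ _ int])
    show "AE \<xi> in lborel. (\<lambda>n. ?w \<xi> * (cmod (h n \<xi> - g \<xi>))\<^sup>2) \<longlonglongrightarrow> 0"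
    proof (rule AE_I2)
      fix \<xi> :: real
      obtain n where n: "max \<bar>\<xi>\<bar> (cmod (g \<xi>)) \<le> real n" using real_arch_simple by blast
      have "\<forall>\<^sub>F m in sequentially. ?w \<xi> * (cmod (h m \<xi> - g \<xi>))\<^sup>2 = 0"
        using eventually_ge_at_top[of n] by eventually_elim (use n in \<open>auto simp: h_def\<close>)
      then show "(\<lambda>n. ?w \<xi> * (cmod (h n \<xi> - g \<xi>))\<^sup>2) \<longlonglongrightarrow> 0" by (rule tendsto_eventually)
    qed
    show "AE \<xi> in lborel. norm (?w \<xi> * (cmod (h n \<xi> - g \<xi>))\<^sup>2) \<le> ?w \<xi> * (cmod (g \<xi>))\<^sup>2" for n
      by (intro AE_I2) (auto simp: h_def)
  qed measurable
  then have "(\<lambda>n. LINT \<xi>|lborel. ?w \<xi> * (cmod (h n \<xi> - g \<xi>))\<^sup>2) \<longlonglongrightarrow> 0" by simp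
  moreover have "0 < \<eta> / 4" using \<eta> by simp
  ultimately obtain n where n: "(LINT \<xi>|lborel. ?w \<xi> * (cmod (h n \<xi> - g \<xi>))\<^sup>2) < \<eta> / 4"
    using order_tendstoD(2) eventually_happens'[OF sequentially_bot] by blast
  have hb: "cmod (h n \<xi>) \<le> real n" and h0: "real n < \<bar>\<xi>\<bar> \<Longrightarrow> h n \<xi> = 0" for \<xi>
    by (auto simp: h_def)
  obtain \<Phi> C where \<Phi>: "\<And>k. expsum (\<Phi> k)" "\<And>k \<xi>. cmod (\<Phi> k \<xi>) \<le> C"
    "AE \<xi> in lborel. (\<lambda>k. ?e \<xi> * \<Phi> k \<xi>) \<longlonglongrightarrow> h n \<xi>"
  proof (rule gaussian_expsum_dense[OF h hb])
    show "h n \<xi> = 0" if "real n < \<bar>\<xi>\<bar>" for \<xi> using that by (rule h0)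
  qed (rule that)
  have \<Phi>m[measurable]: "\<Phi> k \<in> borel_measurable borel" for k
    by (rule borel_measurable_continuous_onI[OF continuous_expsum[OF \<Phi>(1)]])
  define dom where "dom \<xi> = 2 * C\<^sup>2 * exp (- (\<xi>\<^sup>2 / 2)) + 2 * (indicator {- real n..real n} \<xi> * (real n)\<^sup>2)" for \<xi> :: real
  have "integrable lborel (\<lambda>\<xi>. cmod (gauss 1 0 \<xi>))" by (intro integrable_norm integrable_gauss)
  then have "integrable lborel (\<lambda>\<xi>::real. exp (- (\<xi>\<^sup>2 / 2)))"
    by (simp add: gauss_def)
  then have dom: "integrable lborel dom"
    unfolding dom_def[abs_def] by (intro Bochner_Integration.integrable_add integrable_mult_right integrable_mult_left) auto
  have step: "?w \<xi> * (cmod (?e \<xi> * \<Phi> k \<xi> - h n \<xi>))\<^sup>2 \<le> dom \<xi>" for k \<xi>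
  proof -
    have "?w \<xi> * (cmod (?e \<xi> * \<Phi> k \<xi> - h n \<xi>))\<^sup>2 \<le> 1 * (cmod (?e \<xi> * \<Phi> k \<xi> - h n \<xi>))\<^sup>2"
      by (intro mult_right_mono weight_le_1 s) auto
    also have "\<dots> \<le> 2 * (cmod (?e \<xi> * \<Phi> k \<xi>))\<^sup>2 + 2 * (cmod (h n \<xi>))\<^sup>2"
      using cmod_add_square[of "?e \<xi> * \<Phi> k \<xi>" "- h n \<xi>"] by simp
    also have "(cmod (?e \<xi> * \<Phi> k \<xi>))\<^sup>2 \<le> C\<^sup>2 * exp (- (\<xi>\<^sup>2 / 2))"
    proof -
      have "(cmod (?e \<xi> * \<Phi> k \<xi>))\<^sup>2 = (cmod (\<Phi> k \<xi>))\<^sup>2 * (exp (- (\<xi>\<^sup>2 / 2)) * exp (- (\<xi>\<^sup>2 / 2)))"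
        by (simp add: norm_mult power_mult_distrib power2_eq_square)
      also have "\<dots> \<le> C\<^sup>2 * (1 * exp (- (\<xi>\<^sup>2 / 2)))"
        using \<Phi>(2)[of k \<xi>] by (intro mult_mono power_mono) auto
      finally show ?thesis by simp
    qed
    also have "(cmod (h n \<xi>))\<^sup>2 \<le> indicator {- real n..real n} \<xi> * (real n)\<^sup>2"
      using hb[of \<xi>] h0[of \<xi>] by (auto simp: indicator_def abs_le_iff not_le intro!: power_mono)
    finally show ?thesis by (simp add: dom_def)
  qed
  have "(\<lambda>k. LINT \<xi>|lborel. ?w \<xi> * (cmod (?e \<xi> * \<Phi> k \<xi> - h n \<xi>))\<^sup>2) \<longlonglongrightarrow> (LINT \<xi>|(lborel :: real measure). 0)"
  proof (rule integral_dominated_convergence[OF _ _ dom])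
    show "AE \<xi> in lborel. (\<lambda>k. ?w \<xi> * (cmod (?e \<xi> * \<Phi> k \<xi> - h n \<xi>))\<^sup>2) \<longlonglongrightarrow> 0"
      using \<Phi>(3)
    proof eventually_elim
      case (elim \<xi>)
      have "(\<lambda>k. ?w \<xi> * (cmod (?e \<xi> * \<Phi> k \<xi> - h n \<xi>))\<^sup>2) \<longlonglongrightarrow> ?w \<xi> * (cmod (h n \<xi> - h n \<xi>))\<^sup>2"
        by (intro tendsto_intros elim)
      then show ?case by simp
    qed
    show "AE \<xi> in lborel. norm (?w \<xi> * (cmod (?e \<xi> * \<Phi> k \<xi> - h n \<xi>))\<^sup>2) \<le> dom \<xi>" for k
      using step by (intro AE_I2) simp
  qed measurable
  then have "(\<lambda>k. LINT \<xi>|lborel. ?w \<xi> * (cmod (?e \<xi> * \<Phi> k \<xi> - h n \<xi>))\<^sup>2) \<longlonglongrightarrow> 0" by simp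
  moreover have "0 < \<eta> / 4" using \<eta> by simp
  ultimately obtain k where k: "(LINT \<xi>|lborel. ?w \<xi> * (cmod (?e \<xi> * \<Phi> k \<xi> - h n \<xi>))\<^sup>2) < \<eta> / 4"
    using order_tendstoD(2) eventually_happens'[OF sequentially_bot] by blast
  define D where "D \<xi> = (?e \<xi> * \<Phi> k \<xi> - h n \<xi>) + (h n \<xi> - g \<xi>)" for \<xi>
  have i1: "integrable lborel (\<lambda>\<xi>. ?w \<xi> * (cmod (?e \<xi> * \<Phi> k \<xi> - h n \<xi>))\<^sup>2)"
    by (rule Bochner_Integration.integrable_bound[OF dom]) (use step[of _ k] in \<open>auto intro!: AE_I2 order.trans[OF step abs_ge_self]\<close>)
  have i2: "integrable lborel (\<lambda>\<xi>. ?w \<xi> * (cmod (h n \<xi> - g \<xi>))\<^sup>2)"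
    by (rule Bochner_Integration.integrable_bound[OF int]) (auto intro!: AE_I2 simp: h_def)
  have Dm[measurable]: "D \<in> borel_measurable borel" unfolding D_def[abs_def] by measurable
  have iD: "integrable lborel (\<lambda>\<xi>. ?w \<xi> * (cmod (D \<xi>))\<^sup>2)"
    and D: "(LINT \<xi>|lborel. ?w \<xi> * (cmod (D \<xi>))\<^sup>2) < \<eta>"
    using weighted_square_add[of "\<lambda>\<xi>. ?e \<xi> * \<Phi> k \<xi> - h n \<xi>" Line "\<lambda>\<xi>. h n \<xi> - g \<xi>" s, unfolded fm, OF _ _ i1 i2] n k
    by (simp_all add: D_def)
  have iD': "integrable lborel (\<lambda>\<xi>. ?w \<xi> * (cmod (D (- \<xi>)))\<^sup>2)"
    using lborel_integrable_real_affine[OF iD, of "-1" 0] by simp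
  have D': "(LINT \<xi>|lborel. ?w \<xi> * (cmod (D (- \<xi>)))\<^sup>2) = (LINT \<xi>|lborel. ?w \<xi> * (cmod (D \<xi>))\<^sup>2)"
    by (subst (2) lborel_integral_real_affine[of "-1" _ 0]) simp_all
  obtain a where a: "smooth_profile Line a" "\<And>\<xi>. ft Line a \<xi> =
    (?e \<xi> * \<Phi> k \<xi> + cnj (?e \<xi> * \<Phi> k (- \<xi>))) / 2"
    using expsum_profile[OF \<Phi>(1)[of k]] by blast
  have ae: "AE \<xi> in lborel. ?w \<xi> * (cmod (ft Line a \<xi> - g \<xi>))\<^sup>2 \<le> (?w \<xi> * (cmod (D \<xi>))\<^sup>2 + ?w \<xi> * (cmod (D (- \<xi>)))\<^sup>2) / 2"
    using herm
  proof eventually_elim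
    case (elim \<xi>)
    have "g \<xi> = cnj (g (- \<xi>))" using elim by simp
    then have eq: "ft Line a \<xi> - g \<xi> = (D \<xi> + cnj (D (- \<xi>))) / 2"
      unfolding a(2) D_def by (simp add: field_simps)
    have "(cmod (ft Line a \<xi> - g \<xi>))\<^sup>2 = (cmod (D \<xi> + cnj (D (- \<xi>))))\<^sup>2 / 4"
      unfolding eq by (simp add: norm_divide power_divide)
    also have "\<dots> \<le> ((cmod (D \<xi>))\<^sup>2 + (cmod (D (- \<xi>)))\<^sup>2) / 2"
      using cmod_add_square[of "D \<xi>" "cnj (D (- \<xi>))"] by simp
    finally have "?w \<xi> * (cmod (ft Line a \<xi> - g \<xi>))\<^sup>2 \<le> ?w \<xi> * (((cmod (D \<xi>))\<^sup>2 + (cmod (D (- \<xi>)))\<^sup>2) / 2)"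
      by (rule mult_left_mono) simp
    then show ?case by (simp add: algebra_simps)
  qed
  obtain Ca where Ca: "decaying Line Ca a" using a(1) smooth_profileD by blast
  have am[measurable]: "ft Line a \<in> borel_measurable borel" using ft_measurable[OF Ca] by (simp add: fm)
  have i: "integrable lborel (\<lambda>\<xi>. (?w \<xi> * (cmod (D \<xi>))\<^sup>2 + ?w \<xi> * (cmod (D (- \<xi>)))\<^sup>2) / 2)"
    using iD iD' by auto
  have ia: "integrable lborel (\<lambda>\<xi>. ?w \<xi> * (cmod (ft Line a \<xi> - g \<xi>))\<^sup>2)"
  proof (rule Bochner_Integration.integrable_bound[OF i])
    show "AE \<xi> in lborel. norm (?w \<xi> * (cmod (ft Line a \<xi> - g \<xi>))\<^sup>2) \<le> norm ((?w \<xi> * (cmod (D \<xi>))\<^sup>2 + ?w \<xi> * (cmod (D (- \<xi>)))\<^sup>2) / 2)"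
      using ae by eventually_elim auto
  qed measurable
  have "(LINT \<xi>|lborel. ?w \<xi> * (cmod (ft Line a \<xi> - g \<xi>))\<^sup>2) \<le> (LINT \<xi>|lborel. (?w \<xi> * (cmod (D \<xi>))\<^sup>2 + ?w \<xi> * (cmod (D (- \<xi>)))\<^sup>2) / 2)"
    by (rule integral_mono_AE[OF ia i ae])
  also have "\<dots> = (LINT \<xi>|lborel. ?w \<xi> * (cmod (D \<xi>))\<^sup>2)"
    using iD iD' D' by simp
  also note D
  finally show ?thesis using a(1) by blast
qed

theorem smooth_profiles_dense:
  assumes s: "s \<le> 0" and u0: "in_sobolev M s u0" "real_distribution M u0" and \<eta>: "0 < \<eta>"
  obtains a g where "smooth_profile M a" "has_fourier M u0 g"
    "integrable (freq_measure M) (\<lambda>\<xi>. (1 + \<xi>\<^sup>2) powr s * (cmod (g \<xi>))\<^sup>2)"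
    "(LINT \<xi>|freq_measure M. (1 + \<xi>\<^sup>2) powr s * (cmod (ft M a \<xi> - g \<xi>))\<^sup>2) < \<eta>"
proof -
  obtain g where g: "has_fourier M u0 g"
    and int: "integrable (freq_measure M) (\<lambda>\<xi>. (1 + \<xi>\<^sup>2) powr s * (cmod (g \<xi>))\<^sup>2)"
    and dist: "distribution M u0"
    using u0(1) unfolding in_sobolev_def by blast
  have herm: "AE \<xi> in freq_measure M. g (- \<xi>) = cnj (g \<xi>)"
    by (rule fourier_hermitian[OF g dist u0(2)])
  have "\<exists>a. smooth_profile M a \<and>
      (LINT \<xi>|freq_measure M. (1 + \<xi>\<^sup>2) powr s * (cmod (ft M a \<xi> - g \<xi>))\<^sup>2) < \<eta>"
  proof (cases M)
    case Line
    then have fm: "freq_measure M = lborel" by (simp add: freq_measure_def)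
    have "g \<in> borel_measurable borel" using has_fourier_measurable[OF g] by (simp add: fm)
    from smooth_profiles_dense_line[OF this int[unfolded fm] herm[unfolded fm] \<eta> s]
    show ?thesis unfolding Line freq_measure_def spatial_domain.case .
  next
    case Torus
    then have fm: "freq_measure M = count_space \<int>" by (simp add: freq_measure_def)
    have "g (- \<xi>) = cnj (g \<xi>)" if "\<xi> \<in> \<int>" for \<xi>
      using herm that unfolding fm by (simp add: AE_count_space)
    from smooth_profiles_dense_torus[OF int[unfolded fm] this \<eta>]
    show ?thesis unfolding Torus freq_measure_def spatial_domain.case .
  qed
  with g int that show ?thesis by blast
qed

section \<open>High-frequency wave packets\<close>

text \<open>On the torus the envelope must not be constant: the square of \<open>cos (n x)\<close>
  has mean value \<open>1/2\<close> and no other low frequency, and the mean value is annihilated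
  by the spatial derivative in the equation.\<close>

definition envelope :: "spatial_domain \<Rightarrow> real \<Rightarrow> real" where
  "envelope M x = (case M of Line \<Rightarrow> exp (- (x\<^sup>2 / 2)) | Torus \<Rightarrow> 1 + cos x)"

definition wave_packet :: "spatial_domain \<Rightarrow> nat \<Rightarrow> real \<Rightarrow> real" where
  "wave_packet M n x = cos (real n * x) * envelope M x"

lemma nat_in_freqs [simp]: "real n \<in> freqs M"
  by (simp add: freqs_def split: spatial_domain.split)

lemma smooth_profile_wave_packet: "smooth_profile M (wave_packet M n)"
proof (cases M)
  case Line
  have "wave_packet Line n = (\<lambda>x. Re (gauss 1 (\<i> * of_real (real n)) x))"
    by (rule ext, unfold gauss_modulated) (simp add: wave_packet_def envelope_def)
  then show ?thesis by (simp add: Line smooth_profile_gauss)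
next
  case Torus
  have "wave_packet Torus n = (\<lambda>x. Re (1 * cis (real n * x)) + (Re (1 / 2 * cis ((real n + 1) * x)) + Re (1 / 2 * cis ((real n - 1) * x))))"
  proof
    fix x
    have "cos (real n * x) * cos x = 1 / 2 * cos ((real n + 1) * x) + 1 / 2 * cos ((real n - 1) * x)"
      by (simp add: distrib_right left_diff_distrib cos_add cos_diff field_simps)
    then show "wave_packet Torus n x = Re (1 * cis (real n * x)) + (Re (1 / 2 * cis ((real n + 1) * x)) + Re (1 / 2 * cis ((real n - 1) * x)))"
      by (simp add: wave_packet_def envelope_def distrib_left)
  qed
  then show ?thesis
    unfolding Torus by (simp only:) (intro smooth_profile_add smooth_profile_trig; simp)
qed

lemma wave_packet_0: "wave_packet M 0 = envelope M"
  by (simp add: fun_eq_iff wave_packet_def)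

lemmas smooth_profile_envelope = smooth_profile_wave_packet[of _ 0, unfolded wave_packet_0]

lemma freq_measure_translate:
  fixes F :: "real \<Rightarrow> real"
  assumes "k \<in> \<int>"
  shows "integrable (freq_measure M) F \<Longrightarrow> integrable (freq_measure M) (\<lambda>\<xi>. F (k + \<xi>))"
    and "(LINT \<xi>|freq_measure M. F (k + \<xi>)) = (LINT \<xi>|freq_measure M. F \<xi>)"
proof -
  have bij: "bij_betw (\<lambda>\<xi>. k + \<xi>) \<int> \<int>"
    by (rule bij_betwI[where g = "\<lambda>\<xi>. \<xi> - k"]) (use assms in auto)
  show "integrable (freq_measure M) (\<lambda>\<xi>. F (k + \<xi>))" if "integrable (freq_measure M) F"
    using that lborel_integrable_real_affine[of F 1 k] integrable_bij_count_space[OF bij, of F]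
    by (cases M) (simp_all add: freq_measure_def)
  show "(LINT \<xi>|freq_measure M. F (k + \<xi>)) = (LINT \<xi>|freq_measure M. F \<xi>)"
    using lborel_integral_real_affine[of 1 F k] integral_bij_count_space[OF bij, of F]
    by (cases M) (simp_all add: freq_measure_def)
qed

lemma smooth_curve_ft_square_integrable:
  assumes v: "\<And>k. smooth_curve M k (\<lambda>t. v)"
  shows "integrable (freq_measure M) (\<lambda>\<xi>. (1 + \<xi>\<^sup>2) powr s * (cmod (ft M v \<xi>))\<^sup>2)"
proof -
  obtain m :: nat where "(s + 1) / 2 \<le> real m" using real_arch_simple by blast
  then have m: "s + 1 \<le> 2 * real m" by simp
  obtain K where K: "\<And>t \<xi>. 0 \<le> t \<Longrightarrow> t \<le> (0::real) \<Longrightarrow> \<xi> \<in> freqs M \<Longrightarrow> (1 + \<xi>\<^sup>2) ^ m * cmod (ft M v \<xi>) \<le> K"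
    using smooth_curve_weighted_ft_bound[OF v, of 0 m] by metis
  obtain C where C: "decaying M C v" using decaying_curveD[OF smooth_curve_decaying[OF v], of 0] by auto
  show ?thesis
    by (rule sobolev_integral_bound(1)[OF ft_measurable[OF C] K[of 0] m]) auto
qed

lemmas smooth_profile_ft_square_integrable = smooth_curve_ft_square_integrable[OF smooth_profile_curve]

text \<open>The transform of a wave packet consists of two copies of the transform of the
  envelope, translated by \<open>n\<close> and \<open>-n\<close>. Moving the translation to the
  weight makes the weight tend to zero pointwise, because \<open>s < 0\<close>.\<close>

lemma wave_packet_small:
  assumes s: "s < 0"
  shows "(\<lambda>n. LINT \<xi>|freq_measure M. (1 + \<xi>\<^sup>2) powr s * (cmod (ft M (wave_packet M n) \<xi>))\<^sup>2) \<longlonglongrightarrow> 0"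
proof -
  let ?w = "\<lambda>\<xi>::real. (1 + \<xi>\<^sup>2) powr s"
  let ?E = "ft M (envelope M)"
  obtain C where C: "decaying M C (envelope M)" using smooth_profile_envelope smooth_profileD by blast
  have Em[measurable]: "?E \<in> borel_measurable (freq_measure M)" by (rule ft_measurable[OF C])
  have E0: "integrable (freq_measure M) (\<lambda>\<xi>. (cmod (?E \<xi>))\<^sup>2)"
  proof -
    have one: "(1 + \<xi>\<^sup>2) powr 0 = 1" for \<xi> :: real by (simp add: add_nonneg_eq_0_iff)
    show ?thesis
      using smooth_profile_ft_square_integrable[OF smooth_profile_envelope, of M 0] unfolding one mult_1 .
  qed
  have wm: "(\<lambda>\<xi>. (1 + (k + \<xi>)\<^sup>2) powr s) \<in> borel_measurable (freq_measure M)" for k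
    by (cases M) (auto simp: freq_measure_def)
  have lim: "(\<lambda>n. LINT \<xi>|freq_measure M. ?w (\<sigma> * real n + \<xi>) * (cmod (?E \<xi>))\<^sup>2) \<longlonglongrightarrow> 0" if \<sigma>: "\<sigma> = 1 \<or> \<sigma> = -1" for \<sigma>
  proof -
    have "(\<lambda>n. LINT \<xi>|freq_measure M. ?w (\<sigma> * real n + \<xi>) * (cmod (?E \<xi>))\<^sup>2) \<longlonglongrightarrow> (LINT \<xi>|freq_measure M. 0)"
    proof (rule integral_dominated_convergence[OF _ _ E0])
      show "AE \<xi> in freq_measure M. (\<lambda>n. ?w (\<sigma> * real n + \<xi>) * (cmod (?E \<xi>))\<^sup>2) \<longlonglongrightarrow> 0"
      proof (rule AE_I2)
        fix \<xi>
        have "filterlim (\<lambda>n. 1 + (\<sigma> * real n + \<xi>)\<^sup>2) at_top sequentially"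
          using \<sigma> by (elim disjE; simp; real_asymp)
        from tendsto_neg_powr[OF s this]
        have "(\<lambda>n. ?w (\<sigma> * real n + \<xi>)) \<longlonglongrightarrow> 0" .
        then show "(\<lambda>n. ?w (\<sigma> * real n + \<xi>) * (cmod (?E \<xi>))\<^sup>2) \<longlonglongrightarrow> 0"
          by (rule tendsto_mult_left_zero)
      qed
      show "AE \<xi> in freq_measure M. norm (?w (\<sigma> * real n + \<xi>) * (cmod (?E \<xi>))\<^sup>2) \<le> (cmod (?E \<xi>))\<^sup>2" for n
        using weight_le_1[of s] s by (intro AE_I2) (simp add: abs_mult mult_left_le_one_le)
    qed (use wm in measurable)
    then show ?thesis by simp
  qed
  let ?J = "\<lambda>\<sigma> n. LINT \<xi>|freq_measure M. ?w (\<sigma> * real n + \<xi>) * (cmod (?E \<xi>))\<^sup>2"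
  have le: "(LINT \<xi>|freq_measure M. ?w \<xi> * (cmod (ft M (wave_packet M n) \<xi>))\<^sup>2) \<le> (?J 1 n + ?J (-1) n) / 2" for n
  proof -
    have F: "ft M (wave_packet M n) \<xi> = (?E (\<xi> - real n) + ?E (\<xi> + real n)) / 2" for \<xi>
      using ft_modulate[OF C nat_in_freqs, of 1 n \<xi>] by (simp add: wave_packet_def[abs_def])
    have int: "integrable (freq_measure M) (\<lambda>\<xi>. ?w (k + \<xi>) * (cmod (?E \<xi>))\<^sup>2)" for k
    proof (rule Bochner_Integration.integrable_bound[OF E0])
      show "AE \<xi> in freq_measure M. norm (?w (k + \<xi>) * (cmod (?E \<xi>))\<^sup>2) \<le> norm ((cmod (?E \<xi>))\<^sup>2)"
        using weight_le_1[of s] s by (intro AE_I2) (simp add: abs_mult mult_left_le_one_le)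
    qed (use wm in measurable)
    have tr: "integrable (freq_measure M) (\<lambda>\<xi>. ?w \<xi> * (cmod (?E (\<xi> - k)))\<^sup>2) \<and>
        (LINT \<xi>|freq_measure M. ?w \<xi> * (cmod (?E (\<xi> - k)))\<^sup>2) = (LINT \<xi>|freq_measure M. ?w (k + \<xi>) * (cmod (?E \<xi>))\<^sup>2)"
      if k: "k \<in> \<int>" for k
    proof -
      have "- k \<in> \<int>" using k by simp
      from freq_measure_translate(1)[OF this int[of k]] freq_measure_translate(2)[OF this, of M "\<lambda>\<xi>. ?w (k + \<xi>) * (cmod (?E \<xi>))\<^sup>2"]
      show ?thesis by simp
    qed
    have p: "?w \<xi> * (cmod (ft M (wave_packet M n) \<xi>))\<^sup>2 \<le>
        (?w \<xi> * (cmod (?E (\<xi> - real n)))\<^sup>2 + ?w \<xi> * (cmod (?E (\<xi> - - real n)))\<^sup>2) / 2" for \<xi>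
    proof -
      have "(cmod (ft M (wave_packet M n) \<xi>))\<^sup>2 \<le> ((cmod (?E (\<xi> - real n)))\<^sup>2 + (cmod (?E (\<xi> + real n)))\<^sup>2) / 2"
        using cmod_add_square[of "?E (\<xi> - real n)" "?E (\<xi> + real n)"] unfolding F by (simp add: norm_divide power_divide)
      from mult_left_mono[OF this, of "?w \<xi>"] show ?thesis by (simp add: algebra_simps)
    qed
    have "real n \<in> \<int>" "- real n \<in> \<int>" by auto
    note t = tr[OF this(1)] tr[OF this(2)]
    have "(LINT \<xi>|freq_measure M. ?w \<xi> * (cmod (ft M (wave_packet M n) \<xi>))\<^sup>2) \<le>
        (LINT \<xi>|freq_measure M. (?w \<xi> * (cmod (?E (\<xi> - real n)))\<^sup>2 + ?w \<xi> * (cmod (?E (\<xi> - - real n)))\<^sup>2) / 2)"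
      using t by (intro integral_mono p smooth_profile_ft_square_integrable smooth_profile_wave_packet) auto
    also have "\<dots> = (?J 1 n + ?J (-1) n) / 2"
      using t by simp
    finally show ?thesis .
  qed
  have J: "(\<lambda>n. (?J 1 n + ?J (-1) n) / 2) \<longlonglongrightarrow> 0"
    using tendsto_divide[OF tendsto_add[OF lim[of 1] lim[of "-1"]] tendsto_const[of 2]] by simp
  show ?thesis
  proof (rule Lim_null_comparison[OF always_eventually J], intro allI)
    fix n
    have "0 \<le> (LINT \<xi>|freq_measure M. ?w \<xi> * (cmod (ft M (wave_packet M n) \<xi>))\<^sup>2)"
      by (intro integral_nonneg_AE AE_I2) simp
    then show "norm (LINT \<xi>|freq_measure M. ?w \<xi> * (cmod (ft M (wave_packet M n) \<xi>))\<^sup>2) \<le> (?J 1 n + ?J (-1) n) / 2"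
      using le[of n] by simp
  qed
qed

text \<open>Low frequencies at which the growth of the solution is observed. They have measure
  \<open>1\<close> in both cases and stay away from \<open>0\<close>, where the multiplier
  \<open>\<xi> / (1 + \<xi>\<^sup>2)\<close> of the equation vanishes.\<close>

definition low_freqs :: "spatial_domain \<Rightarrow> real set" where
  "low_freqs M = (case M of Line \<Rightarrow> {1..2} | Torus \<Rightarrow> {1})"

lemma low_freqs: "\<xi> \<in> low_freqs M \<Longrightarrow> \<xi> \<in> freqs M \<and> 1 \<le> \<xi> \<and> \<xi> \<le> 2"
  by (auto simp: low_freqs_def freqs_def split: spatial_domain.splits)

text \<open>On the line the transform of \<open>exp (-x\<^sup>2)\<close> is a positive Gaussian;
  on the torus the coefficient of \<open>cos x\<close> in \<open>(1 + cos x)\<^sup>2\<close> is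
  \<open>2\<close>.\<close>

lemma envelope_square_transform:
  "\<exists>\<kappa>>0. \<forall>\<xi>\<in>low_freqs M. \<kappa> \<le> cos_transform M (\<lambda>x. envelope M x * envelope M x) \<xi>"
proof (cases M)
  case Line
  have e: "cos_transform Line (\<lambda>x. envelope Line x * envelope Line x) \<xi> = sqrt pi * exp (- (\<xi>\<^sup>2 / 4))" for \<xi>
  proof -
    let ?f = "\<lambda>x. cis (\<xi> / sqrt 2 * x) * of_real (exp (- (x\<^sup>2 / 2)))"
    have f: "Re (?f (0 + sqrt 2 * x)) = cos (\<xi> * x) * (envelope Line x * envelope Line x)" for x
      by (simp add: envelope_def power_mult_distrib flip: exp_add)
    have "integrable lborel (gauss 1 (\<i> * of_real (\<xi> / sqrt 2)))" by (rule integrable_gauss)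
    then have "integrable lborel ?f" unfolding gauss_modulated[abs_def] by (simp add: mult.commute)
    then have i: "integrable lborel (\<lambda>x. ?f (0 + sqrt 2 * x))"
      by (rule lborel_integrable_real_affine) simp
    have "of_real (sqrt (2 * pi) * exp (- ((\<xi> / sqrt 2)\<^sup>2 / 2))) = \<bar>sqrt 2\<bar> *\<^sub>R (LINT x|lborel. ?f (0 + sqrt 2 * x))"
      unfolding integral_gaussian_cis[symmetric] by (rule lborel_integral_real_affine) simp
    from arg_cong[OF this, of Re]
    have "sqrt (2 * pi) * exp (- (\<xi>\<^sup>2 / 4)) = Re (\<bar>sqrt 2\<bar> *\<^sub>R (LINT x|lborel. ?f (0 + sqrt 2 * x)))"
      unfolding Re_complex_of_real by (simp only: power_divide real_sqrt_pow2 zero_le_numeral) simp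
    also have "\<dots> = sqrt 2 * (LINT x|lborel. Re (?f (0 + sqrt 2 * x)))"
      using integral_bounded_linear[OF bounded_linear_Re i] by simp
    also have "(LINT x|lborel. Re (?f (0 + sqrt 2 * x))) = cos_transform Line (\<lambda>x. envelope Line x * envelope Line x) \<xi>"
      unfolding f by (simp add: cos_transform_def cell_def set_lebesgue_integral_def)
    finally show ?thesis by (simp add: real_sqrt_mult)
  qed
  have "sqrt pi * exp (- 1) \<le> sqrt pi * exp (- (\<xi>\<^sup>2 / 4))" if "\<xi> \<in> {1..2}" for \<xi> :: real
  proof -
    have "\<xi>\<^sup>2 \<le> 2\<^sup>2" using that by (intro power_mono) auto
    then show ?thesis by (intro mult_left_mono) auto
  qed
  then show ?thesis
    by (intro exI[of _ "sqrt pi * exp (- 1)"]) (simp add: Line low_freqs_def e)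
next
  case Torus
  let ?a = "\<lambda>x. Re (3 / 2 * cis (0 * x))" and ?b = "\<lambda>x. Re (2 * cis (1 * x))" and ?c = "\<lambda>x. Re (1 / 2 * cis (2 * x))"
  have sq: "(\<lambda>x. envelope Torus x * envelope Torus x) = (\<lambda>x. ?a x + (?b x + ?c x))"
  proof
    fix x :: real
    show "envelope Torus x * envelope Torus x = ?a x + (?b x + ?c x)"
      using cos_double_cos[of x] by (simp add: envelope_def power2_eq_square algebra_simps)
  qed
  have a: "smooth_profile Torus ?a" and b: "smooth_profile Torus ?b" and c: "smooth_profile Torus ?c"
    by (rule smooth_profile_trig; simp)+
  obtain A where A: "decaying Torus A ?a" using a smooth_profileD by blast
  obtain B where B: "decaying Torus B ?b" using b smooth_profileD by blast
  obtain C where C: "decaying Torus C ?c" using c smooth_profileD by blast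
  have "ft Torus (\<lambda>x. ?a x + (?b x + ?c x)) 1 = 1"
    unfolding ft_add[OF A decaying_add[OF B C]] ft_add[OF B C] torus_fourier_block[OF Ints_1 Ints_0]
      torus_fourier_block[OF Ints_1 Ints_1] torus_fourier_block[OF Ints_1 Ints_numeral]
    by simp
  then have "Re (ft Torus (\<lambda>x. ?a x + (?b x + ?c x)) 1) = 1" by simp
  then have "cos_transform Torus (\<lambda>x. ?a x + (?b x + ?c x)) 1 = 2 * pi"
    by (simp add: ft_def fourier_scale_def)
  then show ?thesis
    unfolding Torus sq by (intro exI[of _ "2 * pi"]) (simp add: low_freqs_def)
qed

text \<open>A quantitative Riemann-Lebesgue lemma: the low-frequency factor and \<open>v\<close>
  are differentiated once, the oscillating factor is integrated. The constant \<open>3\<close> is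
  one more than the bound \<open>2\<close> for low frequencies.\<close>

lemma oscillating_transform_bound:
  assumes v: "decaying M C v" "decaying M C v'" "\<And>x. (v has_real_derivative v' x) (at x)"
    and \<xi>: "\<xi> \<in> low_freqs M" and n: "0 < n"
  shows "\<bar>cos_transform M (\<lambda>x. cos (real n * x) * v x) \<xi>\<bar> \<le> 3 * C * rho_mass M / real n"
    and "\<bar>sin_transform M (\<lambda>x. cos (real n * x) * v x) \<xi>\<bar> \<le> 3 * C * rho_mass M / real n"
proof -
  have \<xi>': "\<xi> \<in> freqs M" "\<bar>\<xi>\<bar> \<le> 2" using low_freqs[OF \<xi>] by auto
  have C: "0 \<le> C" by (rule decaying_const_nonneg[OF v(1)])
  have main: "\<bar>cos_transform M q (real n)\<bar> \<le> 3 * C * rho_mass M / real n"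
    if q: "decaying M C q" "decaying M (\<bar>r\<bar> * C + C) q'" "\<bar>r\<bar> \<le> 2" "\<And>x. (q has_real_derivative q' x) (at x)" for q q' r
  proof -
    have "\<bar>sin_transform M q' (real n)\<bar> \<le> (\<bar>r\<bar> * C + C) * 1 * rho_mass M"
      unfolding sin_transform_def
      by (rule decaying_times_bounded_real(2)[OF q(2)]) (auto intro!: continuous_intros)
    also have "\<dots> \<le> 3 * C * rho_mass M"
      using mult_right_mono[OF q(3) C] by (intro mult_right_mono) auto
    finally have "real n * \<bar>cos_transform M q (real n)\<bar> \<le> 3 * C * rho_mass M"
      using transform_derivative(2)[OF q(1,2) q(4) nat_in_freqs, of n] by (simp add: abs_mult)
    then show ?thesis using n by (simp add: field_simps)
  qed
  have "cos_transform M (\<lambda>x. cos (real n * x) * v x) \<xi> = cos_transform M (\<lambda>x. cos (\<xi> * x) * v x) (real n)"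
    "sin_transform M (\<lambda>x. cos (real n * x) * v x) \<xi> = cos_transform M (\<lambda>x. sin (\<xi> * x) * v x) (real n)"
    by (simp_all add: cos_transform_def sin_transform_def mult_ac)
  moreover have "\<bar>cos_transform M (\<lambda>x. cos (\<xi> * x) * v x) (real n)\<bar> \<le> 3 * C * rho_mass M / real n"
  proof (rule main)
    show "decaying M (\<bar>- \<xi>\<bar> * C + C) (\<lambda>x. (- \<xi>) * (sin (\<xi> * x) * v x) + cos (\<xi> * x) * v' x)"
      by (intro decaying_add decaying_scale decaying_trig_mult v \<xi>')
    show "((\<lambda>x. cos (\<xi> * x) * v x) has_real_derivative (- \<xi>) * (sin (\<xi> * x) * v x) + cos (\<xi> * x) * v' x) (at x)" for x
      using v(3)[of x] by (auto intro!: derivative_eq_intros)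
  qed (use \<xi>' decaying_trig_mult[OF v(1) \<xi>'(1)] in auto)
  moreover have "\<bar>cos_transform M (\<lambda>x. sin (\<xi> * x) * v x) (real n)\<bar> \<le> 3 * C * rho_mass M / real n"
  proof (rule main)
    show "decaying M (\<bar>\<xi>\<bar> * C + C) (\<lambda>x. \<xi> * (cos (\<xi> * x) * v x) + sin (\<xi> * x) * v' x)"
      by (intro decaying_add decaying_scale decaying_trig_mult v \<xi>')
    show "((\<lambda>x. sin (\<xi> * x) * v x) has_real_derivative \<xi> * (cos (\<xi> * x) * v x) + sin (\<xi> * x) * v' x) (at x)" for x
      using v(3)[of x] by (auto intro!: derivative_eq_intros)
  qed (use \<xi>' decaying_trig_mult[OF v(1) \<xi>'(1)] in auto)
  ultimately show "\<bar>cos_transform M (\<lambda>x. cos (real n * x) * v x) \<xi>\<bar> \<le> 3 * C * rho_mass M / real n"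
    "\<bar>sin_transform M (\<lambda>x. cos (real n * x) * v x) \<xi>\<bar> \<le> 3 * C * rho_mass M / real n"
    by simp_all
qed

section \<open>Norm inflation\<close>

lemma decaying_flux:
  assumes "decaying M D v" shows "decaying M (D + D\<^sup>2 / 2) (\<lambda>x. bbm_flux (v x))"
  using decaying_add[OF assms decaying_scale[OF decaying_mult[OF assms assms], of "1/2"]]
  by (simp add: bbm_flux_def power2_eq_square)

lemma bbm_displacement_bound:
  assumes u: "bbm_curve M u" and \<tau>: "0 \<le> \<tau>"
    and D: "\<And>\<sigma>. 0 \<le> \<sigma> \<Longrightarrow> \<sigma> \<le> \<tau> \<Longrightarrow> decaying M D (u \<sigma>)"
  shows "\<bar>u \<tau> x - u 0 x\<bar> \<le> 2 * (D + D\<^sup>2 / 2) * \<tau> * rho M x"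
proof -
  have "norm (u \<tau> x - u 0 x) \<le> (2 * (D + D\<^sup>2 / 2) * rho M x) * norm (\<tau> - 0)"
  proof (rule field_differentiable_bound[of "{0..\<tau>}" "\<lambda>\<sigma>. u \<sigma> x" "\<lambda>\<sigma>. - resolvent_dx (\<lambda>y. bbm_flux (u \<sigma> y)) x"])
    fix \<sigma> assume \<sigma>: "\<sigma> \<in> {0..\<tau>}"
    have "((\<lambda>\<tau>. u \<tau> x) has_real_derivative - resolvent_dx (\<lambda>y. bbm_flux (u \<sigma> y)) x) (at \<sigma> within {0..})"
      using u \<sigma> unfolding bbm_curve_def by simp
    then show "((\<lambda>\<tau>. u \<tau> x) has_real_derivative - resolvent_dx (\<lambda>y. bbm_flux (u \<sigma> y)) x) (at \<sigma> within {0..\<tau>})"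
      by (rule has_field_derivative_subset) auto
    show "norm (- resolvent_dx (\<lambda>y. bbm_flux (u \<sigma> y)) x) \<le> 2 * (D + D\<^sup>2 / 2) * rho M x"
      using decayingD(3)[OF decaying_resolvent_dx[OF decaying_flux[OF D]], of \<sigma> x] \<sigma> by simp
  qed (use \<tau> in auto)
  then show ?thesis using \<tau> by (simp add: mult_ac)
qed

text \<open>As long as \<open>|u| \<le> 2 B rho\<close>, the velocity is at most \<open>8
  B\<^sup>2 rho\<close>, so at times up to \<open>1 / (16 B)\<close> the solution has moved by at
  most \<open>B rho / 2\<close> and in fact \<open>|u| \<le> 3/2 B rho\<close>. The gap between
  \<open>3/2\<close> and \<open>2\<close> allows the bound to be propagated in steps of a fixed
  length \<open>h\<close>, because the solution is Lipschitz in time with some constant.\<close>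

lemma bbm_short_time_bound:
  assumes u: "bbm_curve M u" and u0: "decaying M B (u 0)" and B: "1 \<le> B" and t: "16 * B * t \<le> 1"
    and \<tau>: "0 \<le> \<tau>" "\<tau> \<le> t"
  shows "decaying M (2 * B) (u \<tau>)" and "\<bar>u \<tau> x - u 0 x\<bar> \<le> 8 * B\<^sup>2 * \<tau> * rho M x"
proof -
  have curve: "decaying_curve M u"
    using u smooth_curve_decaying unfolding bbm_curve_def by blast
  have disp: "\<bar>u \<tau> x - u 0 x\<bar> \<le> 8 * B\<^sup>2 * \<tau> * rho M x"
    if "0 \<le> \<tau>" "\<And>\<sigma>. 0 \<le> \<sigma> \<Longrightarrow> \<sigma> \<le> \<tau> \<Longrightarrow> decaying M (2 * B) (u \<sigma>)" for \<tau> x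
  proof -
    have "2 * (2 * B + (2 * B)\<^sup>2 / 2) \<le> 8 * B\<^sup>2"
      using mult_left_mono[OF B, of B] B by (simp add: power2_eq_square)
    then have "2 * (2 * B + (2 * B)\<^sup>2 / 2) * \<tau> * rho M x \<le> 8 * B\<^sup>2 * \<tau> * rho M x"
      using that(1) by (intro mult_right_mono) auto
    then show ?thesis using bbm_displacement_bound[OF u that, of x] by linarith
  qed
  obtain C where C: "0 \<le> C"
    "\<And>s s' x. 0 \<le> s \<Longrightarrow> s \<le> t \<Longrightarrow> 0 \<le> s' \<Longrightarrow> s' \<le> t \<Longrightarrow> \<bar>u s x - u s' x\<bar> \<le> C * \<bar>s - s'\<bar> * rho M x"
    using decaying_curveE[OF curve, of t] by metis
  define h where "h = B / (2 * (C + 1))"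
  have h: "0 < h" "C * h \<le> B / 2"
    using B C(1) by (simp_all add: h_def field_simps)
  have steps: "\<forall>\<sigma>. 0 \<le> \<sigma> \<longrightarrow> \<sigma> \<le> t \<longrightarrow> \<sigma> \<le> real n * h \<longrightarrow> decaying M (2 * B) (u \<sigma>)" for n
  proof (induction n)
    case 0
    then show ?case using decaying_mono[OF u0, of "2 * B"] B by auto
  next
    case (Suc n)
    show ?case
    proof (intro allI impI)
      fix \<sigma> assume \<sigma>: "0 \<le> \<sigma>" "\<sigma> \<le> t" "\<sigma> \<le> real (Suc n) * h"
      define \<sigma>' where "\<sigma>' = min \<sigma> (real n * h)"
      have \<sigma>': "0 \<le> \<sigma>'" "\<sigma>' \<le> t" "\<sigma>' \<le> real n * h" "\<bar>\<sigma> - \<sigma>'\<bar> \<le> h"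
        using \<sigma> h(1) by (auto simp: \<sigma>'_def min_def algebra_simps)
      have "\<bar>u \<sigma> x\<bar> \<le> 2 * B * rho M x" for x
      proof -
        have "\<bar>u \<sigma>' x - u 0 x\<bar> \<le> 8 * B\<^sup>2 * \<sigma>' * rho M x"
          using Suc \<sigma>' by (intro disp) auto
        also have "8 * B\<^sup>2 * \<sigma>' * rho M x \<le> B / 2 * rho M x"
        proof -
          have "B * (16 * B * \<sigma>') \<le> B * (16 * B * t)"
            using \<sigma>' B by (intro mult_left_mono) auto
          also have "\<dots> \<le> B * 1" using t B by (intro mult_left_mono) auto
          finally show ?thesis by (intro mult_right_mono) (auto simp: power2_eq_square)
        qed
        finally have 1: "\<bar>u \<sigma>' x - u 0 x\<bar> \<le> B / 2 * rho M x" .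
        have "\<bar>u \<sigma> x - u \<sigma>' x\<bar> \<le> C * \<bar>\<sigma> - \<sigma>'\<bar> * rho M x"
          using \<sigma> \<sigma>' by (intro C(2)) auto
        also have "\<dots> \<le> B / 2 * rho M x"
        proof -
          have "C * \<bar>\<sigma> - \<sigma>'\<bar> \<le> C * h" using \<sigma>'(4) C(1) by (rule mult_left_mono)
          then show ?thesis using h(2) by (intro mult_right_mono) auto
        qed
        finally have 2: "\<bar>u \<sigma> x - u \<sigma>' x\<bar> \<le> B / 2 * rho M x" .
        have "\<bar>u \<sigma> x\<bar> \<le> \<bar>u 0 x\<bar> + \<bar>u \<sigma>' x - u 0 x\<bar> + \<bar>u \<sigma> x - u \<sigma>' x\<bar>" by linarith
        then show ?thesis using 1 2 decayingD(3)[OF u0, of x] by simp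
      qed
      then show "decaying M (2 * B) (u \<sigma>)"
        using decaying_curveD[OF curve \<sigma>(1)] by (auto simp: decaying_def dominated_def)
    qed
  qed
  have all: "decaying M (2 * B) (u \<sigma>)" if "0 \<le> \<sigma>" "\<sigma> \<le> t" for \<sigma>
  proof -
    obtain n :: nat where "\<sigma> / h \<le> real n" using real_arch_simple by blast
    then show ?thesis using steps[of n] that h(1) by (auto simp: field_simps)
  qed
  then show "decaying M (2 * B) (u \<tau>)" "\<bar>u \<tau> x - u 0 x\<bar> \<le> 8 * B\<^sup>2 * \<tau> * rho M x"
    using \<tau> by (auto intro!: disp)
qed

lemma cos_transform_scale:
  shows "cos_transform M (\<lambda>x. r * v x) \<xi> = r * cos_transform M v \<xi>"
    and "sin_transform M (\<lambda>x. r * v x) \<xi> = r * sin_transform M v \<xi>"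
  unfolding cos_transform_def sin_transform_def mult.left_commute[of _ r] by (simp_all add: set_integral_mult_right)

text \<open>The operator \<open>\<partial>\<^sub>x (1 -
  \<partial>\<^sub>x\<^sup>2)\<inverse>\<close> acts on frequencies as multiplication by
  \<open>\<i> \<xi> / (1 + \<xi>\<^sup>2)\<close>, and the imaginary unit turns the sine transform
  into the cosine transform. The real form is derived by applying
  \<open>transform_derivative\<close> to the resolvent twice.\<close>

lemma sin_transform_evolution:
  assumes u: "bbm_curve M u" and \<xi>: "\<xi> \<in> freqs M" and t: "0 \<le> t"
  shows "((\<lambda>\<tau>. sin_transform M (u \<tau>) \<xi>) has_real_derivative
    \<xi> / (1 + \<xi>\<^sup>2) * cos_transform M (\<lambda>x. bbm_flux (u t x)) \<xi>) (at t within {0..})"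
proof -
  let ?f = "\<lambda>t x. bbm_flux (u t x)"
  have curve: "decaying_curve M u"
    using u smooth_curve_decaying unfolding bbm_curve_def by blast
  have f: "decaying_curve M ?f"
    using smooth_curve_flux[of M 0 u] curve by simp
  have k: "decaying_curve M (\<lambda>t x. (-1) * resolvent_dx (?f t) x)"
    by (intro decaying_curve_scale decaying_curve_resolvent f)
  have d: "((\<lambda>\<tau>. u \<tau> x) has_real_derivative (-1) * resolvent_dx (?f t) x) (at t within {0..})" if "0 \<le> t" for t x
    using u that unfolding bbm_curve_def by simp
  have "((\<lambda>\<tau>. sin_transform M (u \<tau>) \<xi>) has_real_derivative sin_transform M (\<lambda>x. (-1) * resolvent_dx (?f t) x) \<xi>) (at t within {0..})"
    unfolding sin_transform_def
    by (rule cell_integral_time_derivative[OF curve k d, where Q = 1]) (auto intro!: continuous_intros t)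
  moreover have "sin_transform M (\<lambda>x. (-1) * resolvent_dx (?f t) x) \<xi> = \<xi> / (1 + \<xi>\<^sup>2) * cos_transform M (?f t) \<xi>"
  proof -
    obtain C where C: "decaying M C (?f t)" using decaying_curveD[OF f t] by blast
    note R = decaying_resolvent[OF C] and K = decaying_resolvent_dx[OF C]
    have RF: "decaying M (2 * C + \<bar>- 1\<bar> * C) (\<lambda>x. resolvent (?f t) x + (-1) * ?f t x)"
      by (intro decaying_add decaying_scale R C)
    have s: "sin_transform M (resolvent_dx (?f t)) \<xi> = - \<xi> * cos_transform M (resolvent (?f t)) \<xi>"
      by (rule transform_derivative(2)[OF R K resolvent_derivative[OF decayingD(5)[OF C]] \<xi>])
    have "((\<lambda>x. resolvent_dx (?f t) x) has_real_derivative resolvent (?f t) x + (-1) * ?f t x) (at x)" for x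
      using resolvent_dx_derivative[OF decayingD(5)[OF C], of x] by simp
    from transform_derivative(1)[OF K RF this \<xi>]
    have c: "cos_transform M (\<lambda>x. resolvent (?f t) x + (-1) * ?f t x) \<xi> = \<xi> * sin_transform M (resolvent_dx (?f t)) \<xi>" .
    have "cos_transform M (\<lambda>x. resolvent (?f t) x + (-1) * ?f t x) \<xi> =
        cos_transform M (resolvent (?f t)) \<xi> - cos_transform M (?f t) \<xi>"
      unfolding cos_transform_def
      using set_integral_diff(2)[OF transform_integrable(1)[OF R, of \<xi>] transform_integrable(1)[OF C, of \<xi>]]
      by (simp add: right_diff_distrib)
    with c s have "(1 + \<xi>\<^sup>2) * cos_transform M (resolvent (?f t)) \<xi> = cos_transform M (?f t) \<xi>"
      by (simp add: algebra_simps power2_eq_square)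
    moreover have "1 + \<xi>\<^sup>2 \<noteq> 0" by (simp add: add_nonneg_eq_0_iff)
    ultimately have "cos_transform M (resolvent (?f t)) \<xi> = cos_transform M (?f t) \<xi> / (1 + \<xi>\<^sup>2)"
      by (simp add: field_simps)
    then show ?thesis
      unfolding cos_transform_scale s by simp
  qed
  ultimately show ?thesis by simp
qed

lemma cos_transform_bound: "decaying M C v \<Longrightarrow> \<bar>cos_transform M v \<xi>\<bar> \<le> C * rho_mass M"
  and sin_transform_bound: "decaying M C v \<Longrightarrow> \<bar>sin_transform M v \<xi>\<bar> \<le> C * rho_mass M"
  using decaying_times_bounded_real(2)[of M C v "\<lambda>x. cos (\<xi> * x)" 1] decaying_times_bounded_real(2)[of M C v "\<lambda>x. sin (\<xi> * x)" 1]
  unfolding cos_transform_def sin_transform_def by (simp_all add: continuous_intros)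

lemma cos_transform_add:
  assumes "decaying M C v" "decaying M D w"
  shows "cos_transform M (\<lambda>x. v x + w x) \<xi> = cos_transform M v \<xi> + cos_transform M w \<xi>"
    and "sin_transform M (\<lambda>x. v x + w x) \<xi> = sin_transform M v \<xi> + sin_transform M w \<xi>"
  unfolding cos_transform_def sin_transform_def distrib_left
  by (intro set_integral_add(2) transform_integrable[OF assms(1)] transform_integrable[OF assms(2)])+

text \<open>Since \<open>cos\<^sup>2 = (1 + cos (2 \<cdot>)) / 2\<close>, the square of the
  initial value consists of \<open>a\<^sup>2\<close>, a mixed term of order \<open>A\<close>, the
  main term \<open>A\<^sup>2 E\<^sup>2 / 2\<close> and an oscillating term that is small for large
  \<open>n\<close>.\<close>

lemma initial_square_transform:
  assumes a: "decaying M C a" and E: "decaying M C (envelope M)" and C: "1 \<le> C" and A: "1 \<le> A"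
    and \<kappa>: "\<kappa> \<le> cos_transform M (\<lambda>x. envelope M x * envelope M x) \<xi>"
    and small: "A\<^sup>2 * \<bar>cos_transform M (\<lambda>x. cos (real (2 * n) * x) * (envelope M x * envelope M x)) \<xi>\<bar> \<le> 1"
  shows "A\<^sup>2 * \<kappa> / 2 - 1 - 3 * A * C\<^sup>2 * rho_mass M \<le>
    cos_transform M (\<lambda>x. (a x + A * wave_packet M n x) * (a x + A * wave_packet M n x)) \<xi>"
proof -
  let ?E2 = "\<lambda>x. envelope M x * envelope M x" and ?W = "wave_packet M n"
  let ?m = "rho_mass M"
  have W: "decaying M C ?W"
    unfolding wave_packet_def[abs_def] by (rule decaying_trig_mult(1)[OF E nat_in_freqs])
  note aa = decaying_mult[OF a a] and aW = decaying_mult[OF a W] and E2 = decaying_mult[OF E E]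
  have E2n: "decaying M (C * C) (\<lambda>x. cos (real (2 * n) * x) * ?E2 x)"
    by (rule decaying_trig_mult(1)[OF E2 nat_in_freqs])
  have "(a x + A * ?W x) * (a x + A * ?W x) =
      a x * a x + (2 * A * (a x * ?W x) + (A\<^sup>2 / 2 * ?E2 x + A\<^sup>2 / 2 * (cos (real (2 * n) * x) * ?E2 x)))" for x
  proof -
    have c: "cos (real (2 * n) * x) = 2 * cos (real n * x) * cos (real n * x) - 1"
      using cos_double_cos[of "real n * x"] by (simp add: power2_eq_square mult_ac)
    show ?thesis unfolding c wave_packet_def by (simp add: power2_eq_square algebra_simps)
  qed
  then have "cos_transform M (\<lambda>x. (a x + A * ?W x) * (a x + A * ?W x)) \<xi> =
      cos_transform M (\<lambda>x. a x * a x) \<xi> + (2 * A * cos_transform M (\<lambda>x. a x * ?W x) \<xi> +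
        (A\<^sup>2 / 2 * cos_transform M ?E2 \<xi> + A\<^sup>2 / 2 * cos_transform M (\<lambda>x. cos (real (2 * n) * x) * ?E2 x) \<xi>))"
    by (simp only: cos_transform_add(1)[OF aa decaying_add[OF decaying_scale[OF aW] decaying_add[OF decaying_scale[OF E2] decaying_scale[OF E2n]]]]
        cos_transform_add(1)[OF decaying_scale[OF aW] decaying_add[OF decaying_scale[OF E2] decaying_scale[OF E2n]]]
        cos_transform_add(1)[OF decaying_scale[OF E2] decaying_scale[OF E2n]] cos_transform_scale)
  moreover have "- (C * C * ?m) \<le> cos_transform M (\<lambda>x. a x * a x) \<xi>"
    using cos_transform_bound[OF aa, of \<xi>] by linarith
  moreover have "2 * A * - (C * C * ?m) \<le> 2 * A * cos_transform M (\<lambda>x. a x * ?W x) \<xi>"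
    using cos_transform_bound[OF aW, of \<xi>] A by (intro mult_left_mono) linarith+
  moreover have "A\<^sup>2 / 2 * \<kappa> \<le> A\<^sup>2 / 2 * cos_transform M ?E2 \<xi>"
    using \<kappa> by (intro mult_left_mono) auto
  moreover have "- 1 \<le> A\<^sup>2 / 2 * cos_transform M (\<lambda>x. cos (real (2 * n) * x) * ?E2 x) \<xi>"
  proof -
    have "\<bar>A\<^sup>2 / 2 * cos_transform M (\<lambda>x. cos (real (2 * n) * x) * ?E2 x) \<xi>\<bar> \<le> 1"
      using small by (simp add: abs_mult)
    then show ?thesis by linarith
  qed
  moreover have "C * C * ?m \<le> A * (C * C * ?m)"
    using mult_right_mono[OF A, of "C * C * ?m"] C by simp
  ultimately show ?thesis
    by (simp add: power2_eq_square algebra_simps)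
qed

lemma low_freq_factor:
  assumes "\<xi> \<in> low_freqs M" shows "1 / 5 \<le> \<xi> / (1 + \<xi>\<^sup>2)" and "\<xi> / (1 + \<xi>\<^sup>2) \<le> 1"
proof -
  have x: "1 \<le> \<xi>" "\<xi> \<le> 2" using low_freqs[OF assms] by auto
  have sq: "\<xi>\<^sup>2 \<le> 2 * \<xi>" "\<xi> \<le> \<xi>\<^sup>2" using mult_right_mono[OF x(2), of \<xi>] mult_right_mono[OF x(1), of \<xi>] x by (auto simp: power2_eq_square)
  have pos: "0 < 1 + \<xi>\<^sup>2" by (simp add: add_pos_nonneg)
  show "1 / 5 \<le> \<xi> / (1 + \<xi>\<^sup>2)" "\<xi> / (1 + \<xi>\<^sup>2) \<le> 1"
    using pos sq x by (auto simp: field_simps)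
qed

text \<open>The heart of the argument. The conditions on \<open>\<delta>\<close> do not involve
  \<open>A\<close>: the first keeps \<open>t = \<delta> / A\<close> below the time of
  \<open>bbm_short_time_bound\<close> for \<open>B = 2 C A\<close>, and the second makes the error
  that stems from the motion of \<open>u\<close> during \<open>[0, t]\<close> at most half of the
  main term \<open>A\<^sup>2 \<kappa> / 2\<close>. What remains is linear in \<open>A\<close> with
  a positive coefficient.\<close>

lemma low_frequency_growth:
  assumes a: "decaying M C a" and E: "decaying M C (envelope M)" and C: "1 \<le> C" and A: "1 \<le> A"
    and \<xi>: "\<xi> \<in> low_freqs M"
    and \<kappa>: "0 < \<kappa>" "\<kappa> \<le> cos_transform M (\<lambda>x. envelope M x * envelope M x) \<xi>"
    and small2: "A\<^sup>2 * \<bar>cos_transform M (\<lambda>x. cos (real (2 * n) * x) * (envelope M x * envelope M x)) \<xi>\<bar> \<le> 1"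
    and small1: "A * \<bar>sin_transform M (wave_packet M n) \<xi>\<bar> \<le> 1"
    and u: "bbm_curve M u" and u0: "u 0 = (\<lambda>x. a x + A * wave_packet M n x)"
    and \<delta>: "0 < \<delta>" "32 * C * \<delta> \<le> 1" "768 * C ^ 3 * rho_mass M * \<delta> \<le> \<kappa>"
  shows "\<delta> * \<kappa> / 40 * A - (C * rho_mass M + 1 + \<delta> * (1 + 6 * C\<^sup>2 * rho_mass M)) \<le> sin_transform M (u (\<delta> / A)) \<xi>"
proof -
  let ?m = "rho_mass M" and ?W = "wave_packet M n"
  define B where "B = 2 * C * A"
  define t where "t = \<delta> / A"
  have m: "0 \<le> ?m" by simp
  have t: "0 < t" "A * t = \<delta>" using \<delta>(1) A by (simp_all add: t_def)
  have B: "1 \<le> B" using mult_mono[OF C A] C A unfolding B_def by linarith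
  have \<xi>f: "\<xi> \<in> freqs M" using low_freqs[OF \<xi>] by auto
  have W: "decaying M C ?W"
    unfolding wave_packet_def[abs_def] by (rule decaying_trig_mult(1)[OF E nat_in_freqs])
  have "decaying M (C + \<bar>A\<bar> * C) (u 0)"
    unfolding u0 by (intro decaying_add a decaying_scale W)
  moreover have "C + \<bar>A\<bar> * C \<le> B"
    using mult_right_mono[OF A, of C] C A by (simp add: B_def)
  ultimately have uB: "decaying M B (u 0)" by (rule decaying_mono)
  have tB: "16 * B * t \<le> 1"
  proof -
    have "16 * B * t = 32 * C * (A * t)" by (simp add: B_def)
    then show ?thesis using \<delta>(2) by (simp only: t(2))
  qed
  note short = bbm_short_time_bound[OF u uB B tB]
  have low: "A\<^sup>2 * \<kappa> / 8 - (1 + 6 * A * C\<^sup>2 * ?m) \<le> cos_transform M (\<lambda>x. bbm_flux (u \<tau> x)) \<xi>"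
    if \<tau>: "0 \<le> \<tau>" "\<tau> \<le> t" for \<tau>
  proof -
    \<comment> \<open>The change of \<open>u\<^sup>2\<close> is at most \<open>8 B\<^sup>2 \<tau>
      rho\<close> times the bound \<open>3 B\<close> for the sum of the two values.\<close>
    let ?d = "\<lambda>x. u \<tau> x * u \<tau> x - u 0 x * u 0 x"
    have u\<tau>: "decaying M (2 * B) (u \<tau>)" by (rule short(1)[OF \<tau>])
    have d: "decaying M (24 * B ^ 3 * \<tau>) ?d"
    proof (rule decaying_diff[OF decaying_mult[OF u\<tau> u\<tau>] decaying_mult[OF uB uB]])
      fix x
      have "\<bar>u \<tau> x + u 0 x\<bar> \<le> 3 * B"
      proof -
        have "\<bar>u \<tau> x + u 0 x\<bar> \<le> 2 * B * rho M x + B * rho M x"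
          using decayingD(3)[OF u\<tau>, of x] decayingD(3)[OF uB, of x] by linarith
        also have "\<dots> = 3 * B * rho M x" by simp
        also have "\<dots> \<le> 3 * B * 1" using B by (intro mult_left_mono rho_le_1) auto
        finally show ?thesis by simp
      qed
      from mult_mono[OF this short(2)[OF \<tau>, of x]]
      have "\<bar>u \<tau> x + u 0 x\<bar> * \<bar>u \<tau> x - u 0 x\<bar> \<le> 3 * B * (8 * B\<^sup>2 * \<tau> * rho M x)"
        using B by simp
      also have "\<bar>u \<tau> x + u 0 x\<bar> * \<bar>u \<tau> x - u 0 x\<bar> = \<bar>u \<tau> x * u \<tau> x - u 0 x * u 0 x\<bar>"
        by (simp add: abs_mult[symmetric] algebra_simps)
      finally show "\<bar>u \<tau> x * u \<tau> x - u 0 x * u 0 x\<bar> \<le> 24 * B ^ 3 * \<tau> * rho M x"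
        by (simp add: power2_eq_square power3_eq_cube mult_ac)
    qed
    have "(\<lambda>x. bbm_flux (u \<tau> x)) = (\<lambda>x. u \<tau> x + (1/2 * (u 0 x * u 0 x) + 1/2 * ?d x))"
      by (simp add: bbm_flux_def power2_eq_square fun_eq_iff field_simps)
    then have "cos_transform M (\<lambda>x. bbm_flux (u \<tau> x)) \<xi> =
        cos_transform M (u \<tau>) \<xi> + (1/2 * cos_transform M (\<lambda>x. u 0 x * u 0 x) \<xi> + 1/2 * cos_transform M ?d \<xi>)"
      by (simp only: cos_transform_add(1)[OF u\<tau> decaying_add[OF decaying_scale[OF decaying_mult[OF uB uB]] decaying_scale[OF d]]]
          cos_transform_add(1)[OF decaying_scale[OF decaying_mult[OF uB uB]] decaying_scale[OF d]] cos_transform_scale)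
    moreover have "- (4 * A * C\<^sup>2 * ?m) \<le> cos_transform M (u \<tau>) \<xi>"
    proof -
      have "C * ?m \<le> C * (C * ?m)" using mult_right_mono[OF C, of "C * ?m"] C m by simp
      then have "A * (C * ?m) \<le> A * (C * (C * ?m))"
        by (rule mult_left_mono) (use A in simp)
      then show ?thesis
        using cos_transform_bound[OF u\<tau>, of \<xi>] by (simp add: B_def power2_eq_square mult_ac)
    qed
    moreover have "A\<^sup>2 * \<kappa> / 2 - 1 - 3 * A * C\<^sup>2 * ?m \<le> cos_transform M (\<lambda>x. u 0 x * u 0 x) \<xi>"
      unfolding u0 by (rule initial_square_transform[OF a E C A \<kappa>(2) small2])
    moreover have "- (A\<^sup>2 * \<kappa> / 4) \<le> cos_transform M ?d \<xi>"
    proof -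
      have "24 * B ^ 3 * \<tau> * ?m \<le> 24 * B ^ 3 * t * ?m"
        using \<tau> B m by (intro mult_right_mono mult_left_mono) auto
      also have "\<dots> = A\<^sup>2 / 4 * (768 * C ^ 3 * ?m * (A * t))"
        by (simp add: B_def power2_eq_square power3_eq_cube)
      also have "\<dots> \<le> A\<^sup>2 / 4 * \<kappa>"
        unfolding t(2) using \<delta>(3) by (intro mult_left_mono) auto
      finally show ?thesis using cos_transform_bound[OF d, of \<xi>] by simp
    qed
    moreover have "0 \<le> A * C\<^sup>2 * ?m" using A m by simp
    ultimately show ?thesis by simp
  qed
  define D where "D \<tau> = \<xi> / (1 + \<xi>\<^sup>2) * cos_transform M (\<lambda>x. bbm_flux (u \<tau> x)) \<xi>" for \<tau>
  have "\<exists>\<tau>\<in>{0<..<t}. sin_transform M (u t) \<xi> - sin_transform M (u 0) \<xi> = D \<tau> * (t - 0)"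
  proof (rule mvt_simple[OF t(1)])
    fix \<tau> assume "0 \<le> \<tau>" "\<tau> \<le> t"
    then have "((\<lambda>\<tau>. sin_transform M (u \<tau>) \<xi>) has_real_derivative D \<tau>) (at \<tau> within {0..t})"
      unfolding D_def by (intro has_field_derivative_subset[OF sin_transform_evolution[OF u \<xi>f]]) auto
    then show "((\<lambda>\<tau>. sin_transform M (u \<tau>) \<xi>) has_derivative (*) (D \<tau>)) (at \<tau> within {0..t})"
      unfolding has_field_derivative_def .
  qed
  then obtain \<tau> where \<tau>: "0 < \<tau>" "\<tau> < t"
    and mvt: "sin_transform M (u t) \<xi> - sin_transform M (u 0) \<xi> = t * (\<xi> / (1 + \<xi>\<^sup>2) * cos_transform M (\<lambda>x. bbm_flux (u \<tau> x)) \<xi>)"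
    by (auto simp: D_def mult_ac)
  let ?q = "\<xi> / (1 + \<xi>\<^sup>2)" and ?X = "A\<^sup>2 * \<kappa> / 8" and ?Y = "1 + 6 * A * C\<^sup>2 * ?m"
  note q = low_freq_factor[OF \<xi>]
  have "1 / 5 * ?X - 1 * ?Y \<le> ?q * ?X - ?q * ?Y"
    using q \<kappa>(1) A m by (intro diff_mono mult_right_mono) auto
  also have "\<dots> = ?q * (?X - ?Y)" by (simp only: right_diff_distrib)
  also have "\<dots> \<le> ?q * cos_transform M (\<lambda>x. bbm_flux (u \<tau> x)) \<xi>"
    by (rule mult_left_mono) (use low[of \<tau>] \<tau> q(1) in linarith)+
  finally have "t * (1 / 5 * ?X - 1 * ?Y) \<le> sin_transform M (u t) \<xi> - sin_transform M (u 0) \<xi>"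
    unfolding mvt using t(1) by (intro mult_left_mono) auto
  moreover have "\<delta> * \<kappa> / 40 * A - \<delta> * (1 + 6 * C\<^sup>2 * ?m) \<le> t * (1 / 5 * ?X - 1 * ?Y)"
  proof -
    have "t * (1 / 5 * ?X - 1 * ?Y) = (A * t) * \<kappa> / 40 * A - (t + 6 * (A * t) * C\<^sup>2 * ?m)"
      by (simp add: field_simps power2_eq_square)
    moreover have "t \<le> \<delta>"
      using t mult_right_mono[OF A, of t] by simp
    ultimately show ?thesis unfolding t(2) by (simp add: algebra_simps)
  qed
  moreover have "- (C * ?m + 1) \<le> sin_transform M (u 0) \<xi>"
  proof -
    have "sin_transform M (u 0) \<xi> = sin_transform M a \<xi> + A * sin_transform M ?W \<xi>"
      unfolding u0 by (simp only: cos_transform_add(2)[OF a decaying_scale[OF W]] cos_transform_scale)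
    moreover have "\<bar>A * sin_transform M ?W \<xi>\<bar> \<le> 1" using small1 A by (simp add: abs_mult)
    ultimately show ?thesis using sin_transform_bound[OF a, of \<xi>] by linarith
  qed
  ultimately show ?thesis unfolding t_def by (simp add: algebra_simps)
qed

text \<open>On low frequencies \<open>1 + \<xi>\<^sup>2 \<le> 5\<close>. The factor \<open>2
  \<pi>\<close> is the normalization of Fourier coefficients on the torus.\<close>

lemma sobolev_norm_lower_bound:
  assumes s: "s \<le> 0" and v: "\<And>k. smooth_curve M k (\<lambda>t. v)" and K: "0 \<le> K"
    and low: "\<And>\<xi>. \<xi> \<in> low_freqs M \<Longrightarrow> K \<le> sin_transform M v \<xi>"
  shows "sqrt (5 powr s) * (K / (2 * pi)) \<le> sobolev_norm M s (dist_of_fun M v)"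
proof -
  obtain C where C: "decaying M C v" using decaying_curveD[OF smooth_curve_decaying[OF v], of 0] by auto
  let ?L = "5 powr s * (K / (2 * pi))\<^sup>2"
  have meas: "low_freqs M \<in> sets (freq_measure M)" and one: "measure (freq_measure M) (low_freqs M) = 1"
    and fin: "emeasure (freq_measure M) (low_freqs M) < \<infinity>"
    by (cases M; simp add: low_freqs_def freq_measure_def)+
  have p: "indicator (low_freqs M) \<xi> *\<^sub>R ?L \<le> (1 + \<xi>\<^sup>2) powr s * (cmod (ft M v \<xi>))\<^sup>2" for \<xi>
  proof (cases "\<xi> \<in> low_freqs M")
    case True
    have x: "1 \<le> \<xi>" "\<xi> \<le> 2" using low_freqs[OF True] by auto
    have "\<xi>\<^sup>2 \<le> 2\<^sup>2" using x by (intro power_mono) auto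
    then have "1 + \<xi>\<^sup>2 \<le> 5" by simp
    then have w: "5 powr s \<le> (1 + \<xi>\<^sup>2) powr s"
      using s by (intro powr_mono2') (auto simp: add_pos_nonneg)
    have "K / (2 * pi) \<le> K / fourier_scale M"
      using K pi_gt3 by (cases M) (auto simp: fourier_scale_def divide_le_eq mult_le_cancel_left1)
    also have "\<dots> \<le> sin_transform M v \<xi> / fourier_scale M"
      using low[OF True] fourier_scale_ge_1[of M] by (intro divide_right_mono) auto
    also have "\<dots> = - Im (ft M v \<xi>)" by (simp add: ft_def)
    also have "\<dots> \<le> cmod (ft M v \<xi>)" using abs_Im_le_cmod[of "ft M v \<xi>"] by linarith
    finally have "(K / (2 * pi))\<^sup>2 \<le> (cmod (ft M v \<xi>))\<^sup>2" using K by (intro power_mono) auto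
    with w show ?thesis using True by (auto intro!: mult_mono)
  qed simp
  have i: "integrable (freq_measure M) (\<lambda>\<xi>. indicator (low_freqs M) \<xi> *\<^sub>R ?L)"
    using meas fin by simp
  have "?L = (LINT \<xi>|freq_measure M. indicator (low_freqs M) \<xi> *\<^sub>R ?L)"
    using meas fin one by simp
  also have "\<dots> \<le> (LINT \<xi>|freq_measure M. (1 + \<xi>\<^sup>2) powr s * (cmod (ft M v \<xi>))\<^sup>2)"
    by (rule integral_mono[OF i smooth_curve_ft_square_integrable[OF v] p])
  finally have "sqrt ?L \<le> sobolev_norm M s (dist_of_fun M v)"
    unfolding sobolev_norm_eq[OF has_fourier_decaying[OF C]] by (rule real_sqrt_le_mono)
  then show ?thesis using K by (simp add: real_sqrt_mult)
qed

lemma smooth_curve_frozen: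
  "smooth_curve M k u \<Longrightarrow> 0 \<le> t \<Longrightarrow> smooth_curve M k (\<lambda>\<tau>. u t)"
proof (induction k arbitrary: u)
  case 0
  then show ?case using decaying_curveD[of M u t] decaying_curve_const by auto
next
  case (Suc k)
  obtain u' where u': "smooth_curve M k u'" "\<And>t x. 0 \<le> t \<Longrightarrow> (u t has_real_derivative u' t x) (at x)"
    using smooth_curve_SucE[OF Suc.prems(1)] by blast
  obtain C where C: "decaying M C (u t)"
    using decaying_curveD[OF smooth_curve_decaying[OF Suc.prems(1)] Suc.prems(2)] by blast
  show ?case
    by (intro smooth_curve_SucI[OF decaying_curve_const[OF C] Suc.IH[OF u'(1) Suc.prems(2)]] u'(2) Suc.prems(2))
qed

text \<open>The constants are chosen in the order \<open>\<delta>\<close>, \<open>A\<close>,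
  \<open>n\<close>. The smallness of \<open>\<delta>\<close> depends on \<open>a\<close> and the
  envelope only; \<open>A\<close> makes the time \<open>\<delta> / A\<close> small and the low
  frequencies large; \<open>n\<close> makes the wave packet of amplitude \<open>A\<close> small in
  \<open>H\<^sup>s\<close> and the oscillating integrals negligible.\<close>

theorem theorem1p7:
  fixes M :: spatial_domain and s \<epsilon> :: real and u0 :: "(real \<Rightarrow> complex) \<Rightarrow> complex"
  assumes "s < 0"
    and "in_sobolev M s u0" and "real_distribution M u0"
    and "\<epsilon> > 0"
  shows "\<exists>u t\<^sub>\<epsilon>. smooth_bbm_solution M u \<and> t\<^sub>\<epsilon> \<in> {0<..<\<epsilon>} \<and>
           sobolev_norm M s (\<lambda>\<phi>. dist_of_fun M (u 0) \<phi> - u0 \<phi>) < \<epsilon> \<and>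
           sobolev_norm M s (dist_of_fun M (u t\<^sub>\<epsilon>)) > inverse \<epsilon>"
proof -
  define m where "m = rho_mass M"
  have m: "0 \<le> m" by (simp add: m_def)
  have s0: "s \<le> 0" using assms(1) by simp
  have \<epsilon>2: "0 < \<epsilon>\<^sup>2 / 4" using assms(4) by simp
  obtain a g where a: "smooth_profile M a" and g: "has_fourier M u0 g"
    and gi: "integrable (freq_measure M) (\<lambda>\<xi>. (1 + \<xi>\<^sup>2) powr s * (cmod (g \<xi>))\<^sup>2)"
    and ag: "(LINT \<xi>|freq_measure M. (1 + \<xi>\<^sup>2) powr s * (cmod (ft M a \<xi> - g \<xi>))\<^sup>2) < \<epsilon>\<^sup>2 / 4"
    using smooth_profiles_dense[OF s0 assms(2,3) \<epsilon>2] by blast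
  obtain \<kappa> where \<kappa>: "0 < \<kappa>" "\<And>\<xi>. \<xi> \<in> low_freqs M \<Longrightarrow> \<kappa> \<le> cos_transform M (\<lambda>x. envelope M x * envelope M x) \<xi>"
    using envelope_square_transform by blast
  obtain C1 where C1: "decaying M C1 a" using a smooth_profileD by blast
  obtain E where E: "E 0 = envelope M" "\<And>j. \<exists>C. decaying M C (E j)" "\<And>j x. (E j has_real_derivative E (Suc j) x) (at x)"
    using smooth_profile_envelope[of M] unfolding smooth_profile_def by metis
  obtain C2 where C2: "decaying M C2 (envelope M)" using E(1) E(2)[of 0] by auto
  obtain C3 where C3: "decaying M C3 (E 1)" using E(2) by blast
  have dE: "(envelope M has_real_derivative E 1 x) (at x)" for x using E(3)[of 0 x] E(1) by simp
  define C where "C = max 1 (max C1 C2)"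
  have C: "1 \<le> C" "decaying M C a" "decaying M C (envelope M)"
    by (auto simp: C_def intro: decaying_mono[OF C1] decaying_mono[OF C2])
  define K where "K = max (max C2 C3) (max (C2 * C2) (C3 * C2 + C3 * C2))"
  have K: "decaying M K (envelope M)" "decaying M K (E 1)" "decaying M K (\<lambda>x. envelope M x * envelope M x)"
    "decaying M K (\<lambda>x. E 1 x * envelope M x + E 1 x * envelope M x)"
    by (rule decaying_mono[OF C2] decaying_mono[OF C3] decaying_mono[OF decaying_mult[OF C2 C2]]
        decaying_mono[OF decaying_add[OF decaying_mult[OF C3 C2] decaying_mult[OF C3 C2]]], simp add: K_def)+
  define \<delta> where "\<delta> = min (1 / (32 * C)) (\<kappa> / (768 * C ^ 3 * m + 1))"
  have p: "0 < 768 * C ^ 3 * m + 1" using C(1) m by (intro add_nonneg_pos mult_nonneg_nonneg) auto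
  have \<delta>: "0 < \<delta>" using p C(1) \<kappa>(1) by (simp add: \<delta>_def)
  have \<delta>1: "32 * C * \<delta> \<le> 1"
  proof -
    have "32 * C * \<delta> \<le> 32 * C * (1 / (32 * C))" using C(1) by (intro mult_left_mono) (auto simp: \<delta>_def)
    then show ?thesis using C(1) by simp
  qed
  have \<delta>2: "768 * C ^ 3 * rho_mass M * \<delta> \<le> \<kappa>"
  proof -
    have "(768 * C ^ 3 * m) * \<delta> \<le> (768 * C ^ 3 * m + 1) * \<delta>" using \<delta> by simp
    also have "\<dots> \<le> (768 * C ^ 3 * m + 1) * (\<kappa> / (768 * C ^ 3 * m + 1))"
      using p by (intro mult_left_mono) (auto simp: \<delta>_def)
    also have "\<dots> = \<kappa>" using p by simp
    finally show ?thesis by (simp add: m_def)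
  qed
  define c where "c = \<delta> * \<kappa> / 40"
  define c' where "c' = C * m + 1 + \<delta> * (1 + 6 * C\<^sup>2 * m)"
  have c: "0 < c" using \<delta> \<kappa>(1) by (simp add: c_def)
  define w where "w = sqrt (5 powr s)"
  have w: "0 < w" by (simp add: w_def)
  define Q where "Q = 2 * pi * (inverse \<epsilon> + 1) / w"
  have Q: "0 \<le> Q" using w assms(4) by (simp add: Q_def)
  define A where "A = max 1 (max (\<delta> / \<epsilon> + 1) ((c' + Q) / c))"
  have A: "1 \<le> A" "\<delta> / \<epsilon> < A" "(c' + Q) / c \<le> A" by (auto simp: A_def)
  have A1: "\<delta> / A < \<epsilon>" using A(1,2) assms(4) by (simp add: field_simps)
  have A2: "Q \<le> c * A - c'" using A(3) c by (simp add: field_simps)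
  have "0 < \<epsilon>\<^sup>2 / (4 * A\<^sup>2)" using assms(4) A(1) by simp
  from order_tendstoD(2)[OF wave_packet_small[OF assms(1)] this]
  have "\<forall>\<^sub>F n in sequentially. (LINT \<xi>|freq_measure M. (1 + \<xi>\<^sup>2) powr s * (cmod (ft M (wave_packet M n) \<xi>))\<^sup>2) < \<epsilon>\<^sup>2 / (4 * A\<^sup>2)" .
  moreover have "\<forall>\<^sub>F n in sequentially. A\<^sup>2 * (3 * K * m) \<le> real n"
    using filterlim_real_sequentially by (simp add: filterlim_at_top)
  ultimately have "\<forall>\<^sub>F n in sequentially. 0 < n \<and> A\<^sup>2 * (3 * K * m) \<le> real n \<and>
      (LINT \<xi>|freq_measure M. (1 + \<xi>\<^sup>2) powr s * (cmod (ft M (wave_packet M n) \<xi>))\<^sup>2) < \<epsilon>\<^sup>2 / (4 * A\<^sup>2)"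
    using eventually_gt_at_top[of 0] by eventually_elim simp
  then obtain n where n: "0 < n" "A\<^sup>2 * (3 * K * m) \<le> real n"
    and W: "(LINT \<xi>|freq_measure M. (1 + \<xi>\<^sup>2) powr s * (cmod (ft M (wave_packet M n) \<xi>))\<^sup>2) < \<epsilon>\<^sup>2 / (4 * A\<^sup>2)"
    using eventually_happens'[OF sequentially_bot] by blast
  have K0: "0 \<le> K" by (rule decaying_const_nonneg[OF K(1)])
  have small1: "A * \<bar>sin_transform M (wave_packet M n) \<xi>\<bar> \<le> 1" if "\<xi> \<in> low_freqs M" for \<xi>
  proof -
    have "A * \<bar>sin_transform M (wave_packet M n) \<xi>\<bar> \<le> A\<^sup>2 * (3 * K * m / real n)"
      using oscillating_transform_bound(2)[OF K(1,2) dE that n(1)] A(1) self_le_power[OF A(1), of 2]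
      unfolding wave_packet_def[abs_def] m_def by (intro mult_mono) auto
    also have "\<dots> \<le> 1" using n by (simp add: field_simps)
    finally show ?thesis .
  qed
  have small2: "A\<^sup>2 * \<bar>cos_transform M (\<lambda>x. cos (real (2 * n) * x) * (envelope M x * envelope M x)) \<xi>\<bar> \<le> 1"
    if "\<xi> \<in> low_freqs M" for \<xi>
  proof -
    have "((\<lambda>x. envelope M x * envelope M x) has_real_derivative E 1 x * envelope M x + E 1 x * envelope M x) (at x)" for x
      by (rule DERIV_mult[OF dE dE])
    from oscillating_transform_bound(1)[OF K(3,4) this that, of "2 * n"]
    have "\<bar>cos_transform M (\<lambda>x. cos (real (2 * n) * x) * (envelope M x * envelope M x)) \<xi>\<bar> \<le> 3 * K * m / real (2 * n)"
      using n(1) by (simp add: m_def)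
    also have "\<dots> \<le> 3 * K * m / real n"
      using n(1) K0 m by (intro divide_left_mono) auto
    finally have "A\<^sup>2 * \<bar>cos_transform M (\<lambda>x. cos (real (2 * n) * x) * (envelope M x * envelope M x)) \<xi>\<bar> \<le> A\<^sup>2 * (3 * K * m / real n)"
      by (rule mult_left_mono) simp
    also have "\<dots> \<le> 1" using n by (simp add: field_simps)
    finally show ?thesis .
  qed
  obtain u where init: "u 0 = (\<lambda>x. a x + A * wave_packet M n x)" and u: "bbm_curve M u"
    using bbm_global_solution[OF smooth_profile_add[OF a smooth_profile_scale[OF smooth_profile_wave_packet]]] by blast
  have t: "0 < \<delta> / A" using \<delta> A(1) by simp
  have sm: "smooth_curve M k u" for k using u unfolding bbm_curve_def by blast
  have grow: "c * A - c' \<le> sin_transform M (u (\<delta> / A)) \<xi>" if "\<xi> \<in> low_freqs M" for \<xi>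
    using low_frequency_growth[OF C(2,3,1) A(1) that \<kappa>(1) \<kappa>(2)[OF that] small2[OF that] small1[OF that] u init \<delta> \<delta>1 \<delta>2]
    by (simp add: c_def c'_def m_def)
  have "w * (Q / (2 * pi)) \<le> w * ((c * A - c') / (2 * pi))"
    using A2 w by (intro mult_left_mono divide_right_mono) auto
  also have "\<dots> \<le> sobolev_norm M s (dist_of_fun M (u (\<delta> / A)))"
    unfolding w_def
    by (rule sobolev_norm_lower_bound[OF s0 smooth_curve_frozen[OF sm] _ grow]) (use t A2 Q in auto)
  also have "w * (Q / (2 * pi)) = inverse \<epsilon> + 1" using w by (simp add: Q_def)
  finally have large: "inverse \<epsilon> < sobolev_norm M s (dist_of_fun M (u (\<delta> / A)))" by simp
  have close: "sobolev_norm M s (\<lambda>\<phi>. dist_of_fun M (u 0) \<phi> - u0 \<phi>) < \<epsilon>"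
  proof -
    let ?W = "ft M (wave_packet M n)"
    obtain D where D: "decaying M D (wave_packet M n)" using smooth_profile_wave_packet smooth_profileD by blast
    have AD: "decaying M (\<bar>A\<bar> * D) (\<lambda>x. A * wave_packet M n x)" by (rule decaying_scale[OF D])
    have u0d: "decaying M (C1 + \<bar>A\<bar> * D) (u 0)" unfolding init by (rule decaying_add[OF C1 AD])
    have ftu: "ft M (u 0) \<xi> - g \<xi> = (ft M a \<xi> - g \<xi>) + of_real A * ?W \<xi>" for \<xi>
      unfolding init by (simp add: ft_add[OF C1 AD] ft_scale)
    note [measurable] = ft_measurable[OF C1] ft_measurable[OF D] has_fourier_measurable[OF g]
    have i1: "integrable (freq_measure M) (\<lambda>\<xi>. (1 + \<xi>\<^sup>2) powr s * (cmod (ft M a \<xi> - g \<xi>))\<^sup>2)"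
      using weighted_square_add(1)[of "ft M a" M "\<lambda>\<xi>. - g \<xi>" s] smooth_profile_ft_square_integrable[OF a, of s] gi by simp
    have i2: "integrable (freq_measure M) (\<lambda>\<xi>. (1 + \<xi>\<^sup>2) powr s * (cmod (?W \<xi>))\<^sup>2)"
      by (rule smooth_profile_ft_square_integrable[OF smooth_profile_wave_packet])
    have sq: "(1 + \<xi>\<^sup>2) powr s * (cmod (of_real A * ?W \<xi>))\<^sup>2 = A\<^sup>2 * ((1 + \<xi>\<^sup>2) powr s * (cmod (?W \<xi>))\<^sup>2)" for \<xi>
      by (simp add: norm_mult power_mult_distrib)
    have i3: "integrable (freq_measure M) (\<lambda>\<xi>. (1 + \<xi>\<^sup>2) powr s * (cmod (of_real A * ?W \<xi>))\<^sup>2)"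
      unfolding sq using i2 by simp
    have "(LINT \<xi>|freq_measure M. (1 + \<xi>\<^sup>2) powr s * (cmod (ft M (u 0) \<xi> - g \<xi>))\<^sup>2) \<le>
        2 * (LINT \<xi>|freq_measure M. (1 + \<xi>\<^sup>2) powr s * (cmod (ft M a \<xi> - g \<xi>))\<^sup>2) +
        2 * (LINT \<xi>|freq_measure M. (1 + \<xi>\<^sup>2) powr s * (cmod (of_real A * ?W \<xi>))\<^sup>2)"
      unfolding ftu by (rule weighted_square_add(2)[OF _ _ i1 i3]) measurable
    also have "(LINT \<xi>|freq_measure M. (1 + \<xi>\<^sup>2) powr s * (cmod (of_real A * ?W \<xi>))\<^sup>2) =
        A\<^sup>2 * (LINT \<xi>|freq_measure M. (1 + \<xi>\<^sup>2) powr s * (cmod (?W \<xi>))\<^sup>2)"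
      unfolding sq by simp
    also have "\<dots> < \<epsilon>\<^sup>2 / 4"
    proof -
      have "A\<^sup>2 * (LINT \<xi>|freq_measure M. (1 + \<xi>\<^sup>2) powr s * (cmod (?W \<xi>))\<^sup>2) < A\<^sup>2 * (\<epsilon>\<^sup>2 / (4 * A\<^sup>2))"
        using W A(1) by (intro mult_strict_left_mono) auto
      then show ?thesis using A(1) by simp
    qed
    finally have "(LINT \<xi>|freq_measure M. (1 + \<xi>\<^sup>2) powr s * (cmod (ft M (u 0) \<xi> - g \<xi>))\<^sup>2) < \<epsilon>\<^sup>2"
      using ag by simp
    then have "sqrt (LINT \<xi>|freq_measure M. (1 + \<xi>\<^sup>2) powr s * (cmod (ft M (u 0) \<xi> - g \<xi>))\<^sup>2) < \<epsilon>"
      using assms(4) by (metis real_sqrt_less_mono real_sqrt_abs abs_of_pos)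
    then show ?thesis
      unfolding sobolev_norm_eq[OF has_fourier_diff[OF has_fourier_decaying[OF u0d] g]] .
  qed
  show ?thesis
    using bbm_curve_smooth_solution[OF u] t A1 close large by (intro exI[of _ u] exI[of _ "\<delta> / A"]) auto
qed

end
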